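(* Let $\mathcal A$ be an $n$-DPDA whose input alphabet $A$ contains $\star$, and let $\phi:A^*\to M$ be a morphism into a finite monoid. For every milestone configuration $c$ of $\mathcal A$ there exists a number $\mathrm{pb}(c)\in\mathbb N$ such that the following holds. Let $k\in\{0,\dots,n\}$ and let $R\circ R'$ be a run starting in $c$ such that $R$ is not $(k-1)$-upper, the word read by $R$ begins with at least $\mathrm{pb}(c)$ stars, and $R'$ is $k$-upper. Then for every $l\in\mathbb N$ there exists a run $S\circ S'$ starting in $c$ such that $\phi(S)=\phi(R)$, the word read by $S$ begins with at least $l$ stars, and $S'$ is $(k,\phi)$-parallel to $R'$.
   Context: Stacks: fix order $n\ge1$, finite stack alphabet $\Gamma$. A $0$-stack is $(\gamma,x)$ with $\gamma\in\Gamma$, $x=(x_n,\dots,x_1)$ a vector of $n$ positive integers (position). For $k\in\{1,\dots,n\}$ a $k$-stack is a finite list $[s_1,\dots,s_m]$ ($m\ge0$) of nonempty $(k-1)$-stacks such that for some $x_n,\dots,x_{k+1}$, every position in $s_i$ has the form $(x_n,\dots,x_{k+1},i,y_{k-1},\dots,y_1)$. The top is at the right; $s^k:s^{k-1}$ appends at the top (right-associative); for $s^r=t^r:t^{r-1}:\dots:t^k$, $\mathrm{top}^k(s^r)=t^k$. Equality of stacks includes positions. $\mathrm{pos}{\downarrow}(s)$ deletes all positions; $s\cong t$ iff $\mathrm{pos}{\downarrow}(s)=\mathrm{pos}{\downarrow}(t)$. For $k<n$, $\mathsf p_{+1}(s^k)$ adds $1$ to the $(n-k)$-th coordinate of all positions.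 Operations of order $k\ge1$: $\mathsf{pop}^k(s^r:\dots:s^k:s^{k-1})=s^r:\dots:s^k$, defined only if the topmost $k$-stack has at least two $(k-1)$-stacks; $\mathsf{push}^k_\gamma(s^r:\dots:s^0)=s^r:\dots:s^{k+1}:(s^k:\dots:s^0):\mathsf p_{+1}(s^{k-1}:\dots:s^1:(\gamma,x))$ where $s^0=(\gamma',x)$. An $n$-DPDA has transitions determined by state and topmost stack symbol, each either $\mathrm{read}(\vec q)$ ($\vec q:A\to Q$ injective; leads to $(\vec q(a),s)$ for $a\in A$, this step reads $a$) or $(q,op)$ with $op$ a stack operation of order $\le n$ (leads to $(q,op(s))$ if defined; reads nothing). Configurations are (state, nonempty $n$-stack). A run is a finite or infinite sequence $R=c_0,c_1,\dots$ with each $c_i$ a successor of $c_{i-1}$; $R(i)=c_i$, $|R|$ length, $R[i,j]=c_i,\dots,c_j$, $\circ$ concatenation. For a finite run $R$, $\phi(R)=\phi(w)$ where $w$ is the word read by $R$. History: for a finite run $R$ and a $0$-stack $s^0$ of $R(|R|)$, $\mathrm{hist}(R,s^0)$ is a $0$-stack of $R(0)$: if $|R|=0$ it is $s^0$; if $R=S\circ T$, $|T|=1$, and the last step is a read or a $\mathsf{pop}$, or a $\mathsf{push}^r_\gamma$ with $s^0$ not in the topmost $(r-1)$-stack of $R(|R|)$, it is $\mathrm{hist}(S,s^0)$; if the last step is $\mathsf{push}^r_\gamma$ and $s^0$ is in the topmost $(r-1)$-stack of $R(|R|)$, it is $\mathrm{hist}(S,t^0)$ with $t^0$ equal to $s^0$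 with the $(n-r+1)$-th position coordinate decreased by $1$. For a $k$-stack $s^k$, $k\ge1$, $\mathrm{hist}(R,s^k)$ is the $k$-stack of $R(0)$ containing $\mathrm{hist}(R,s^0)$ for all $0$-stacks $s^0$ of $s^k$. For $k\in\{0,\dots,n\}$, $R$ is $k$-upper if $\mathrm{hist}(R,\mathrm{top}^k(R(|R|)))=\mathrm{top}^k(R(0))$; by convention no run is $(-1)$-upper. Milestone: a configuration $c$ is a milestone if there exist an infinite run $R$ from $c$ reading only stars and an infinite set $I\subseteq\mathbb N$ with $0\in I$ such that $R[i,j]$ is $0$-upper for all $i,j\in I$ with $i\le j$. Parallel runs: every nonempty $k$-upper run $R$ has a unique decomposition $R=R_1\circ\dots\circ R_r$ into nonempty $k$-upper runs obtained by repeatedly cutting off the shortest nonempty suffix that is $k$-upper (the empty run has $r=0$). Two $k$-upper runs $R=R_1\circ\dots\circ R_r$ and $S=S_1\circ\dots\circ S_s$ (so decomposed) are $(k,\phi)$-parallel if $r=s$, for each $i\in\{1,\dots,r\}$ we have $\phi(R_i)=\phi(S_i)$ and $\mathrm{top}^k(R_i(0))\cong\mathrm{top}^k(S_i(0))$, and $\mathrm{top}^k(R(|R|))\cong\mathrm{top}^k(S(|S|))$. *)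

theory Defs
  imports Main
begin

text \<open>Higher-order stacks over alphabet 'g. A 0-stack is Leaf g x where x is the
position vector (x_n,...,x_1) stored as a list: the j-th coordinate (1-indexed) is x ! (j-1),
so x_r is stored at index n - r. A k-stack (k >= 1) is Node ss, the top being last ss.\<close>

datatype 'g stack = Leaf 'g "nat list" | Node "'g stack list"

fun children :: "'g stack \<Rightarrow> 'g stack list" where
  "children (Leaf g x) = []"
| "children (Node ss) = ss"

fun positions :: "'g stack \<Rightarrow> nat list set" where
  "positions (Leaf g x) = {x}"
| "positions (Node ss) = (\<Union>t\<in>set ss. positions t)"

fun nonempty_stack :: "'g stack \<Rightarrow> bool" where
  "nonempty_stack (Leaf g x) = True"
| "nonempty_stack (Node ss) = (ss \<noteq> [])"

fun wf_stack :: "nat \<Rightarrow> nat \<Rightarrow> 'g stack \<Rightarrow> bool" where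
  "wf_stack n 0 (Leaf g x) = (length x = n \<and> (\<forall>c\<in>set x. 0 < c))"
| "wf_stack n (Suc k) (Node ss) =
     ((\<forall>t\<in>set ss. wf_stack n k t \<and> nonempty_stack t) \<and>
      (\<exists>pre. \<forall>i<length ss. \<forall>p\<in>positions (ss ! i).
          take (n - Suc k) p = pre \<and> p ! (n - Suc k) = Suc i))"
| "wf_stack n 0 (Node ss) = False"
| "wf_stack n (Suc k) (Leaf g x) = False"

fun strip_pos :: "'g stack \<Rightarrow> 'g stack" where
  "strip_pos (Leaf g x) = Leaf g []"
| "strip_pos (Node ss) = Node (map strip_pos ss)"

definition stack_cong :: "'g stack \<Rightarrow> 'g stack \<Rightarrow> bool" where
  "stack_cong s t \<longleftrightarrow> strip_pos s = strip_pos t"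

lemma size_last_less[termination_simp]:
  "ts \<noteq> [] \<Longrightarrow> size (last ts) < Suc (Suc (size (t::'g stack) + size_list size ts))"
proof -
  assume "ts \<noteq> []"
  then have "last ts \<in> set ts" by simp
  then have "size (last ts) \<le> size_list size ts" by (rule size_list_estimation') simp
  then show ?thesis by simp
qed

fun descend :: "nat \<Rightarrow> 'g stack \<Rightarrow> 'g stack" where
  "descend 0 s = s"
| "descend (Suc m) (Node []) = Node []"
| "descend (Suc m) (Node (t # ts)) = descend m (last (t # ts))"
| "descend (Suc m) (Leaf g x) = Leaf g x"

definition ktop :: "nat \<Rightarrow> nat \<Rightarrow> 'g stack \<Rightarrow> 'g stack" where
  "ktop n k s = descend (n - k) s"

fun substacks :: "nat \<Rightarrow> 'g stack \<Rightarrow> 'g stack set" where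
  "substacks 0 s = {s}"
| "substacks (Suc m) (Node ss) = (\<Union>t\<in>set ss. substacks m t)"
| "substacks (Suc m) (Leaf g x) = {}"

fun topsym :: "'g stack \<Rightarrow> 'g" where
  "topsym (Leaf g x) = g"
| "topsym (Node []) = undefined"
| "topsym (Node (t # ts)) = topsym (last (t # ts))"

fun set_topsym :: "'g \<Rightarrow> 'g stack \<Rightarrow> 'g stack" where
  "set_topsym \<gamma> (Leaf g x) = Leaf \<gamma> x"
| "set_topsym \<gamma> (Node []) = Node []"
| "set_topsym \<gamma> (Node (t # ts)) = Node (butlast (t # ts) @ [set_topsym \<gamma> (last (t # ts))])"

fun incr_coord :: "nat \<Rightarrow> 'g stack \<Rightarrow> 'g stack" where
  "incr_coord j (Leaf g x) = Leaf g (x[j := Suc (x ! j)])"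
| "incr_coord j (Node ss) = Node (map (incr_coord j) ss)"

fun modify_top :: "nat \<Rightarrow> ('g stack \<Rightarrow> 'g stack) \<Rightarrow> 'g stack \<Rightarrow> 'g stack" where
  "modify_top 0 f s = f s"
| "modify_top (Suc m) f (Node []) = Node []"
| "modify_top (Suc m) f (Node (t # ts)) = Node (butlast (t # ts) @ [modify_top m f (last (t # ts))])"
| "modify_top (Suc m) f (Leaf g x) = Leaf g x"

definition stk_pop :: "nat \<Rightarrow> nat \<Rightarrow> 'g stack \<Rightarrow> 'g stack option" where
  "stk_pop n k s =
     (if 2 \<le> length (children (ktop n k s))
      then Some (modify_top (n - k) (\<lambda>t. Node (butlast (children t))) s)
      else None)"

text \<open>push^k_gamma on an n-stack: p_{+1} on the copied (k-1)-stack adds 1 to the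
  (n-k+1)-th coordinate, i.e. x_k, stored at index n - k.\<close>
definition stk_push :: "nat \<Rightarrow> nat \<Rightarrow> 'g \<Rightarrow> 'g stack \<Rightarrow> 'g stack" where
  "stk_push n k \<gamma> s =
     modify_top (n - k)
       (\<lambda>t. Node (children t @ [incr_coord (n - k) (set_topsym \<gamma> (last (children t)))])) s"

datatype 'g stack_op = Pop nat | Push nat 'g

datatype ('q, 'a, 'g) transition = Read "'a \<Rightarrow> 'q" | Op 'q "'g stack_op"

type_synonym ('q, 'g) config = "'q \<times> 'g stack"

definition is_dpda :: "nat \<Rightarrow> ('q \<Rightarrow> 'g \<Rightarrow> ('q, 'a, 'g) transition) \<Rightarrow> bool" where
  "is_dpda n \<delta> \<longleftrightarrow> 1 \<le> n \<and> (\<forall>q g. case \<delta> q g of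
       Read f \<Rightarrow> inj f
     | Op q' (Pop k) \<Rightarrow> 1 \<le> k \<and> k \<le> n
     | Op q' (Push k \<gamma>) \<Rightarrow> 1 \<le> k \<and> k \<le> n)"

definition valid_config :: "nat \<Rightarrow> ('q, 'g) config \<Rightarrow> bool" where
  "valid_config n c \<longleftrightarrow> wf_stack n n (snd c) \<and> nonempty_stack (snd c)"

definition step :: "nat \<Rightarrow> ('q \<Rightarrow> 'g \<Rightarrow> ('q, 'a, 'g) transition) \<Rightarrow>
    ('q, 'g) config \<Rightarrow> ('q, 'g) config \<Rightarrow> bool" where
  "step n \<delta> c c' \<longleftrightarrow> (case \<delta> (fst c) (topsym (snd c)) of
       Read f \<Rightarrow> (\<exists>a. c' = (f a, snd c))
     | Op q (Pop k) \<Rightarrow> fst c' = q \<and> stk_pop n k (snd c) = Some (snd c')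
     | Op q (Push k \<gamma>) \<Rightarrow> c' = (q, stk_push n k \<gamma> (snd c)))"

text \<open>Letters read by a single step (the read letter is determined since the map is injective).\<close>
definition step_letters :: "('q \<Rightarrow> 'g \<Rightarrow> ('q, 'a, 'g) transition) \<Rightarrow>
    ('q, 'g) config \<Rightarrow> ('q, 'g) config \<Rightarrow> 'a list" where
  "step_letters \<delta> c c' = (case \<delta> (fst c) (topsym (snd c)) of
       Read f \<Rightarrow> [SOME a. f a = fst c']
     | Op q op \<Rightarrow> [])"

definition is_run :: "nat \<Rightarrow> ('q \<Rightarrow> 'g \<Rightarrow> ('q, 'a, 'g) transition) \<Rightarrow>
    ('q, 'g) config list \<Rightarrow> bool" where
  "is_run n \<delta> R \<longleftrightarrow> R \<noteq> [] \<and> (\<forall>c\<in>set R. valid_config n c) \<and>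
     (\<forall>i. Suc i < length R \<longrightarrow> step n \<delta> (R ! i) (R ! Suc i))"

definition run_word :: "('q \<Rightarrow> 'g \<Rightarrow> ('q, 'a, 'g) transition) \<Rightarrow>
    ('q, 'g) config list \<Rightarrow> 'a list" where
  "run_word \<delta> R = concat (map (\<lambda>i. step_letters \<delta> (R ! i) (R ! Suc i)) [0..<length R - 1])"

text \<open>History of a 0-stack, identified by its position (positions are unique in a stack).
  hist_rev works on the reversed run.\<close>
fun hist_rev :: "nat \<Rightarrow> ('q \<Rightarrow> 'g \<Rightarrow> ('q, 'a, 'g) transition) \<Rightarrow>
    ('q, 'g) config list \<Rightarrow> nat list \<Rightarrow> nat list" where
  "hist_rev n \<delta> (c # c' # rest) x =
     hist_rev n \<delta> (c' # rest)
       (case \<delta> (fst c') (topsym (snd c')) of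
          Op q (Push r \<gamma>) \<Rightarrow>
            (if x \<in> positions (ktop n (r - 1) (snd c)) then x[n - r := x ! (n - r) - 1] else x)
        | _ \<Rightarrow> x)"
| "hist_rev n \<delta> _ x = x"

definition hist :: "nat \<Rightarrow> ('q \<Rightarrow> 'g \<Rightarrow> ('q, 'a, 'g) transition) \<Rightarrow>
    ('q, 'g) config list \<Rightarrow> nat list \<Rightarrow> nat list" where
  "hist n \<delta> R x = hist_rev n \<delta> (rev R) x"

definition hist_is :: "nat \<Rightarrow> ('q \<Rightarrow> 'g \<Rightarrow> ('q, 'a, 'g) transition) \<Rightarrow>
    ('q, 'g) config list \<Rightarrow> nat \<Rightarrow> 'g stack \<Rightarrow> 'g stack \<Rightarrow> bool" where
  "hist_is n \<delta> R k t u \<longleftrightarrow> u \<in> substacks (n - k) (snd (hd R)) \<and>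
     (\<forall>x\<in>positions t. hist n \<delta> R x \<in> positions u)"

definition kupper :: "nat \<Rightarrow> ('q \<Rightarrow> 'g \<Rightarrow> ('q, 'a, 'g) transition) \<Rightarrow>
    nat \<Rightarrow> ('q, 'g) config list \<Rightarrow> bool" where
  "kupper n \<delta> k R \<longleftrightarrow>
     hist_is n \<delta> R k (ktop n k (snd (last R))) (ktop n k (snd (hd R)))"

definition milestone :: "nat \<Rightarrow> ('q \<Rightarrow> 'g \<Rightarrow> ('q, 'a, 'g) transition) \<Rightarrow> 'a \<Rightarrow>
    ('q, 'g) config \<Rightarrow> bool" where
  "milestone n \<delta> star c \<longleftrightarrow> valid_config n c \<and>
     (\<exists>\<rho> :: nat \<Rightarrow> ('q, 'g) config. \<exists>I :: nat set.
        \<rho> 0 = c \<and>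
        (\<forall>i. valid_config n (\<rho> i) \<and> step n \<delta> (\<rho> i) (\<rho> (Suc i)) \<and>
             set (step_letters \<delta> (\<rho> i) (\<rho> (Suc i))) \<subseteq> {star}) \<and>
        infinite I \<and> 0 \<in> I \<and>
        (\<forall>i\<in>I. \<forall>j\<in>I. i \<le> j \<longrightarrow> kupper n \<delta> 0 (map \<rho> [i..<Suc j])))"

inductive kdecomp :: "nat \<Rightarrow> ('q \<Rightarrow> 'g \<Rightarrow> ('q, 'a, 'g) transition) \<Rightarrow> nat \<Rightarrow>
    ('q, 'g) config list \<Rightarrow> ('q, 'g) config list list \<Rightarrow> bool"
  for n \<delta> k where
  empty: "length R = 1 \<Longrightarrow> kdecomp n \<delta> k R []"
| cut: "\<lbrakk> j + 1 < length R; kupper n \<delta> k (drop j R);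
          \<forall>j'. j < j' \<and> j' + 1 < length R \<longrightarrow> \<not> kupper n \<delta> k (drop j' R);
          kdecomp n \<delta> k (take (Suc j) R) Rs \<rbrakk>
        \<Longrightarrow> kdecomp n \<delta> k R (Rs @ [drop j R])"

definition parallel :: "nat \<Rightarrow> ('q \<Rightarrow> 'g \<Rightarrow> ('q, 'a, 'g) transition) \<Rightarrow>
    ('a list \<Rightarrow> 'm) \<Rightarrow> nat \<Rightarrow> ('q, 'g) config list \<Rightarrow> ('q, 'g) config list \<Rightarrow> bool" where
  "parallel n \<delta> \<phi> k R S \<longleftrightarrow> kupper n \<delta> k R \<and> kupper n \<delta> k S \<and>
     (\<exists>Rs Ss. kdecomp n \<delta> k R Rs \<and> kdecomp n \<delta> k S Ss \<and> length Rs = length Ss \<and>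
        (\<forall>i<length Rs. \<phi> (run_word \<delta> (Rs ! i)) = \<phi> (run_word \<delta> (Ss ! i)) \<and>
            stack_cong (ktop n k (snd (hd (Rs ! i)))) (ktop n k (snd (hd (Ss ! i))))) \<and>
        stack_cong (ktop n k (snd (last R))) (ktop n k (snd (last S))))"

definition monoid_morphism :: "('a list \<Rightarrow> 'm::monoid_mult) \<Rightarrow> bool" where
  "monoid_morphism \<phi> \<longleftrightarrow> \<phi> [] = 1 \<and> (\<forall>u v. \<phi> (u @ v) = \<phi> u * \<phi> v)"

end

theory Submission
  imports Defs "HOL-Library.FSet"
begin

text \<open>The positions of a well-formed stack are determined by its shape. A configuration is therefore
  represented by a flat one: its state, its top symbol and, for each level, the list of stacks below
  the topmost one. Histories act on the paths of such stacks.

  A run returns to a component of its first configuration if it ends by exposing a copy of that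
  component, and no earlier suffix leads back to the same place. The first step of such a run splits it
  into shorter returns. Following this recursion, every stack gets a finite type: a set of tokens, each
  saying that in a context of given types and in a given state there is a return to a given component,
  leaving a context of given types, in a given state and with a given value in the monoid. Types of a
  level only mention types of higher levels, whence finiteness. Replacing components by components of
  larger types preserves returns, and since a k-upper run consists of single steps and of loops formed
  by a push and a return to the pushed copy, it also preserves k-upper runs up to parallelism.

  Along the run of a milestone, choose indices such that each one determines finitely many components
  and the next one is, with respect to these, of a kind that occurs infinitely often. For a run R that
  follows the milestone long enough, trace back the leaf from which the final top is copied. If R
  exposes the component containing this leaf before the next index, the level of the component
  increases, because two leaves can only be separated at higher and higher levels. So the component is
  exposed after some next index, which can be replaced by a later one of the same kind; the
  rest of the run is then simulated.\<close>

text \<open>The obstacle is that a return depends on components of unbounded size and may itself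
  change those beyond the one it exposes. A token therefore behaves like an intersection type of a
  function: it takes types of a context before the return to types of the context after it. A run
  can leave the milestone run only by reading a letter other than the star, so a run beginning with
  many stars shares a long prefix with it. When an index is exchanged for a later one, the state,
  the monoid value and the exposed stack must be reproduced exactly, whereas everything beyond that
  stack only has to get larger types. The exposed stack is a component of the configuration at the
  preceding index and thus one of finitely many; this is why the kind of an index is taken relative
  to the preceding one. Levels lie below n, so a chain of n+1 indices leaves no room for the level
  to increase at every one of them. That R is not (k-1)-upper makes the exposed stack have order at
  least k, so that the topmost k-stack from which R' starts can be kept literally.\<close>

type_synonym ('q, 'g) flat = "'q \<times> 'g \<times> 'g stack list list"

section \<open>Position-free stacks and their decomposition along the top\<close>

fun shape :: "nat \<Rightarrow> 'g stack \<Rightarrow> bool" where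
  "shape 0 (Leaf g x) = (x = [])"
| "shape (Suc k) (Node ss) = (ss \<noteq> [] \<and> (\<forall>t\<in>set ss. shape k t))"
| "shape 0 (Node ss) = False"
| "shape (Suc k) (Leaf g x) = False"

text \<open>Rebuilds the positions that \<open>strip_pos\<close> deletes, from the prefix of the
  enclosing stack. The prefix is bound by an inner lambda so that the recursion can pass through
  \<open>map lab ss\<close>; the usable equation is \<open>lab_Node\<close>.\<close>

primrec lab :: "'g stack \<Rightarrow> nat list \<Rightarrow> 'g stack" where
  "lab (Leaf g x) = (\<lambda>pre. Leaf g pre)"
| "lab (Node ss) = (\<lambda>pre. Node (map2 (\<lambda>i f. f (pre @ [i])) [1..<Suc (length ss)] (map lab ss)))"

primrec paths :: "'g stack \<Rightarrow> nat list set" where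
  "paths (Leaf g x) = {[]}"
| "paths (Node ss) = (\<Union>i<length ss. Cons (Suc i) ` (map paths ss ! i))"

text \<open>A zipper listed from the inside outwards: entry d holds the d-stacks below the topmost
  d-stack, so it may be empty, and each entry receives the part built so far as its last child. A
  configuration has n entries around its top symbol.\<close>

fun plug :: "'g stack \<Rightarrow> 'g stack list list \<Rightarrow> 'g stack" where
  "plug s [] = s"
| "plug s (x # xs) = plug (Node (x @ [s])) xs"

abbreviation stk :: "'g \<Rightarrow> 'g stack list list \<Rightarrow> 'g stack" where
  "stk g \<equiv> plug (Leaf g [])"

definition toppath :: "'g stack list list \<Rightarrow> nat list" where
  "toppath xs = rev (map (\<lambda>x. Suc (length x)) xs)"

lemma toppath_simps [simp]:
  "toppath [] = []"
  "toppath (xs @ ys) = toppath ys @ toppath xs"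
  "toppath (x # xs) = toppath xs @ [Suc (length x)]"
  by (simp_all add: toppath_def)

lemma length_toppath [simp]: "length (toppath xs) = length xs"
  by (simp add: toppath_def)

lemma plug_append [simp]: "plug s (xs @ ys) = plug (plug s xs) ys"
  by (induction xs arbitrary: s) auto

lemma lab_Node: "lab (Node ss) pre =
    Node (map (\<lambda>i. lab (ss ! i) (pre @ [Suc i])) [0..<length ss])"
  by (auto intro!: nth_equalityI simp del: upt_Suc)

lemma lab_Node_snoc: "lab (Node (b @ [t])) pre =
    Node (children (lab (Node b) pre) @ [lab t (pre @ [Suc (length b)])])"
  by (simp del: lab.simps add: lab_Node) (auto simp: nth_append)

lemma length_children_lab [simp]: "length (children (lab (Node b) pre)) = length b"
  by (simp del: lab.simps add: lab_Node)

lemma paths_Node_snoc: "paths (Node (b @ [t])) = paths (Node b) \<union> Cons (Suc (length b)) ` paths t"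
  by (auto simp: nth_append less_Suc_eq split: if_splits)

lemma positions_lab: "positions (lab s pre) = (\<lambda>p. pre @ p) ` paths s"
proof (induction s arbitrary: pre)
  case (Leaf g x)
  then show ?case by simp
next
  case (Node ss)
  have "positions (lab (Node ss) pre) = (\<Union>i<length ss. positions (lab (ss ! i) (pre @ [Suc i])))"
    by (simp del: lab.simps add: lab_Node) (auto simp: Bex_def)
  also have "\<dots> = (\<Union>i<length ss. (\<lambda>p. (pre @ [Suc i]) @ p) ` paths (ss ! i))"
    using Node by auto
  also have "\<dots> = (\<lambda>p. pre @ p) ` paths (Node ss)"
    by (auto simp: image_UN image_image)
  finally show ?case .
qed

lemma paths_length: "shape k s \<Longrightarrow> p \<in> paths s \<Longrightarrow> length p = k"
proof (induction k s arbitrary: p rule: shape.induct)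
  case (2 k ss)
  then show ?case by (fastforce simp: in_set_conv_nth)
qed auto

lemma strip_shape: "shape k s \<Longrightarrow> strip_pos s = s"
  by (induction k s rule: shape.induct) (auto intro!: map_idI)

lemma strip_lab [simp]: "strip_pos (lab s pre) = strip_pos s"
proof (induction s arbitrary: pre)
  case (Node ss)
  then show ?case
    by (simp del: lab.simps add: lab_Node) (auto intro!: nth_equalityI)
qed auto

lemma nonempty_lab: "shape k s \<Longrightarrow> nonempty_stack (lab s pre)"
  by (cases s; cases k) (auto simp: Suc_le_eq)

lemma wf_lab:
  assumes "shape k s" "k \<le> n" "length pre = n - k" "\<forall>c\<in>set pre. 0 < c"
  shows "wf_stack n k (lab s pre)"
  using assms
proof (induction k s arbitrary: pre rule: shape.induct)
  case (2 k ss)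
  have 1: "wf_stack n k (lab (ss ! i) (pre @ [Suc i]))" if "i < length ss" for i
    using 2 that by auto
  have 2: "nonempty_stack (lab (ss ! i) (pre @ [Suc i]))" if "i < length ss" for i
    using 2 that by (intro nonempty_lab[of k]) auto
  have 3: "take (n - Suc k) p = pre \<and> p ! (n - Suc k) = Suc i"
    if "i < length ss" "p \<in> positions (lab (ss ! i) (pre @ [Suc i]))" for i p
    using that \<open>length pre = n - Suc k\<close> unfolding positions_lab by (auto simp: nth_append)
  show ?case
    using 1 2 3 by (auto simp: lab_Node simp del: lab.simps)
qed auto

text \<open>Each descent fixes one more coordinate: the child at index i has \<open>Suc i\<close>
  there, so the known prefix grows by one entry until all n coordinates are known. The common
  prefix, which \<open>wf_stack\<close> only asserts to exist, is a parameter here for the sake of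
  the induction.\<close>

lemma wf_is_lab:
  assumes "wf_stack n k s" "nonempty_stack s" "k \<le> n" "length pre = n - k"
    "\<forall>p\<in>positions s. take (n - k) p = pre"
  shows "shape k (strip_pos s) \<and> s = lab (strip_pos s) pre"
  using assms
proof (induction n k s arbitrary: pre rule: wf_stack.induct)
  case (2 n k ss)
  obtain pr where pr: "\<And>i p. i < length ss \<Longrightarrow> p \<in> positions (ss ! i) \<Longrightarrow>
      take (n - Suc k) p = pr \<and> p ! (n - Suc k) = Suc i" using 2(2) by auto
  have len: "length p = n" if "wf_stack n k t" "p \<in> positions t" for t p k
    using that by (induction n k t arbitrary: p rule: wf_stack.induct) auto
  have *: "shape k (strip_pos (ss ! i)) \<and> ss ! i = lab (strip_pos (ss ! i)) (pre @ [Suc i])"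
    if i: "i < length ss" for i
  proof (rule 2(1))
    show "ss ! i \<in> set ss" "wf_stack n k (ss ! i)" "nonempty_stack (ss ! i)" using 2(2) i by auto
    show "k \<le> n" "length (pre @ [Suc i]) = n - k" using 2(4,5) by auto
    show "\<forall>p\<in>positions (ss ! i). take (n - k) p = pre @ [Suc i]"
    proof
      fix p assume p: "p \<in> positions (ss ! i)"
      have "wf_stack n k (ss ! i)" using 2(2) i by auto
      then have "length p = n" using len p by blast
      moreover have "n - k = Suc (n - Suc k)" using 2(4) by auto
      moreover have "take (n - Suc k) p = pre" using 2(6) i p by auto
      ultimately show "take (n - k) p = pre @ [Suc i]"
        using pr[OF i p] 2(4) by (simp add: take_Suc_conv_app_nth)
    qed
  qed
  have "Node ss = lab (strip_pos (Node ss)) pre"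
    using * by (auto simp: lab_Node simp del: lab.simps intro!: nth_equalityI)
  moreover have "shape (Suc k) (strip_pos (Node ss))"
    using 2(3) * by (auto simp: in_set_conv_nth)
  ultimately show ?case by blast
qed auto

definition comps_ok :: "'g stack list list \<Rightarrow> bool" where
  "comps_ok xs \<longleftrightarrow> (\<forall>i<length xs. \<forall>t\<in>set (xs ! i). shape i t)"

lemma comps_ok_Nil [simp]: "comps_ok []" by (simp add: comps_ok_def)

lemma comps_ok_snoc [simp]:
  "comps_ok (xs @ [x]) \<longleftrightarrow> comps_ok xs \<and> (\<forall>t\<in>set x. shape (length xs) t)"
  by (auto simp: comps_ok_def nth_append less_Suc_eq)

lemma comps_okD: "comps_ok (ys @ x # vs) \<Longrightarrow> t \<in> set x \<Longrightarrow> shape (length ys) t"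
  by (auto simp: comps_ok_def nth_append dest!: spec[of _ "length ys"])

lemma comps_ok_take: "comps_ok xs \<Longrightarrow> comps_ok (take k xs)"
  by (auto simp: comps_ok_def)

lemma comps_ok_appendD: "comps_ok (ys @ vs) \<Longrightarrow> comps_ok ys"
  using comps_ok_take[of "ys @ vs" "length ys"] by simp

lemma comps_ok_replace:
  assumes "comps_ok (ys @ vs)" "comps_ok zs" "length zs = length ys"
  shows "comps_ok (zs @ vs)"
  using assms by (auto simp: comps_ok_def nth_append)

lemma shape_plug: "shape (length xs) (stk g xs) \<longleftrightarrow> comps_ok xs"
proof (induction xs rule: rev_induct)
  case (snoc x xs)
  then show ?case by auto
qed simp

lemma shape_decompose: "shape k s \<Longrightarrow> \<exists>g xs. s = stk g xs \<and> length xs = k"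
proof (induction k s rule: shape.induct)
  case (2 k ss)
  then obtain g xs where "last ss = stk g xs" "length xs = k"
    by (metis last_in_set shape.simps(2))
  then show ?case using 2(2)
    by (intro exI[of _ g] exI[of _ "xs @ [butlast ss]"]) (auto, metis append_butlast_last_id)
qed auto

lemma plug_inject:
  "length xs = length ys \<Longrightarrow> stk g xs = stk h ys \<longleftrightarrow> g = h \<and> xs = ys"
proof (induction xs arbitrary: ys rule: rev_induct)
  case Nil
  then show ?case by auto
next
  case (snoc x xs)
  then obtain y ys' where "ys = ys' @ [y]" by (cases ys rule: rev_cases) auto
  then show ?case using snoc by auto
qed

text \<open>The leaves of \<open>plug s xs\<close> outside the hole. They depend on
  \<open>xs\<close> alone, so they survive any replacement of \<open>s\<close>.\<close>

fun outer :: "'g stack list list \<Rightarrow> nat list set" where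
  "outer [] = {}"
| "outer (x # xs) = outer xs \<union> (\<lambda>p. toppath xs @ p) ` paths (Node x)"

lemma paths_plug: "paths (plug s xs) = outer xs \<union> (\<lambda>p. toppath xs @ p) ` paths s"
proof (induction xs arbitrary: s)
  case (Cons x xs)
  have "paths (plug s (x # xs)) = outer xs \<union> (\<lambda>p. toppath xs @ p) ` paths (Node (x @ [s]))"
    using Cons by simp
  then show ?case
    unfolding paths_Node_snoc by (simp add: image_Un image_image Un_assoc del: paths.simps)
qed simp

lemma outer_cases:
  "p \<in> outer xs \<Longrightarrow> \<exists>ys x vs i \<pi>. xs = ys @ x # vs \<and> i < length x \<and> \<pi> \<in> paths (x ! i) \<and>
     p = toppath vs @ Suc i # \<pi>"
proof (induction xs)
  case (Cons x xs)
  show ?case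
  proof (cases "p \<in> outer xs")
    case True
    then obtain ys y vs i \<pi> where "xs = ys @ y # vs \<and> i < length y \<and> \<pi> \<in> paths (y ! i) \<and>
     p = toppath vs @ Suc i # \<pi>" using Cons by blast
    then show ?thesis by (metis append_Cons)
  next
    case False
    then obtain i \<pi> where "i < length x" "\<pi> \<in> paths (x ! i)" "p = toppath xs @ Suc i # \<pi>"
      using Cons(2) by auto
    then show ?thesis by (metis append_Nil)
  qed
qed simp

lemma outer_not_prefix: "p \<in> outer xs \<Longrightarrow> take (length xs) p \<noteq> toppath xs"
  by (drule outer_cases) auto

lemma descend_plug: "descend (length xs) (lab (plug s xs) pre) = lab s (pre @ toppath xs)"
proof (induction xs arbitrary: pre rule: rev_induct)
  case (snoc x xs)
  obtain t ts where *: "children (lab (Node x) pre) @ [lab (plug s xs) (pre @ [Suc (length x)])] = t # ts"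
    by (metis append_is_Nil_conv list.exhaust not_Cons_self2)
  have "descend (length (xs @ [x])) (lab (plug s (xs @ [x])) pre) = 
     descend (Suc (length xs)) (Node (t # ts))" 
    by (simp del: lab.simps add: lab_Node_snoc *)
  also have "\<dots> = descend (length xs) (lab (plug s xs) (pre @ [Suc (length x)]))"
    using * by (metis descend.simps(3) last_snoc)
  finally show ?case using snoc by simp
qed simp

lemma modify_top_plug:
  assumes "f (lab s (pre @ toppath xs)) = lab s' (pre @ toppath xs)"
  shows "modify_top (length xs) f (lab (plug s xs) pre) = lab (plug s' xs) pre"
  using assms
proof (induction xs arbitrary: pre rule: rev_induct)
  case (snoc x xs)
  obtain t ts where *: "children (lab (Node x) pre) @ [lab (plug s xs) (pre @ [Suc (length x)])] = t # ts"
    by (metis append_is_Nil_conv list.exhaust not_Cons_self2)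
  have "modify_top (length (xs @ [x])) f (lab (plug s (xs @ [x])) pre) = 
     modify_top (Suc (length xs)) f (Node (t # ts))" 
    by (simp del: lab.simps add: lab_Node_snoc *)
  also have "\<dots> = Node (butlast (t # ts) @ [modify_top (length xs) f (last (t # ts))])"
    by simp
  also have "\<dots> = Node (children (lab (Node x) pre) @
      [modify_top (length xs) f (lab (plug s xs) (pre @ [Suc (length x)]))])"
    unfolding *[symmetric] by simp
  also have "\<dots> = lab (plug s' (xs @ [x])) pre"
    using snoc by (simp del: lab.simps add: lab_Node_snoc)
  finally show ?case .
qed simp

lemma set_topsym_snoc: "set_topsym \<gamma> (Node (ss @ [t])) = Node (ss @ [set_topsym \<gamma> t])"
proof -
  obtain u us where *: "ss @ [t] = u # us" by (cases "ss @ [t]") auto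
  have "set_topsym \<gamma> (Node (u # us)) = Node (butlast (u # us) @ [set_topsym \<gamma> (last (u # us))])"
    by simp
  then show ?thesis unfolding *[symmetric] by simp
qed

lemma topsym_snoc: "topsym (Node (ss @ [t])) = topsym t"
proof -
  obtain u us where *: "ss @ [t] = u # us" by (cases "ss @ [t]") auto
  have "topsym (Node (u # us)) = topsym (last (u # us))" by simp
  then show ?thesis unfolding *[symmetric] by simp
qed

lemma set_topsym_plug:
  "set_topsym \<gamma> (lab (stk g xs) pre) = lab (stk \<gamma> xs) pre"
  by (induction xs arbitrary: pre rule: rev_induct)
    (simp_all del: lab.simps(2) add: lab_Node_snoc set_topsym_snoc)

lemma topsym_plug: "topsym (lab (stk g xs) pre) = g"
  by (induction xs arbitrary: pre rule: rev_induct)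
    (simp_all del: lab.simps(2) add: lab_Node_snoc topsym_snoc)

text \<open>Raising one coordinate of all positions amounts to labelling with another prefix, so the
  copy made by a push is the same shape, relabelled.\<close>

lemma incr_coord_lab:
  "incr_coord (length pre) (lab s (pre @ i # rest)) = lab s (pre @ Suc i # rest)"
proof (induction s arbitrary: rest)
  case (Node ss)
  then show ?case by (simp del: lab.simps add: lab_Node)
qed simp

text \<open>The topmost k-stack consists of \<open>x\<close> and one stack on top of it, so the
  demand for two children becomes x \<noteq> [].\<close>

lemma stk_pop_plug:
  assumes "length vs = n - k" "k \<le> n" "1 \<le> k" "length ys = k - 1"
  shows "stk_pop n k (lab (stk g (ys @ x # vs)) []) =
     (if x = [] then None else Some (lab (plug (Node x) vs) []))"
proof -
  have 1: "stk g (ys @ x # vs) = plug (Node (x @ [stk g ys])) vs" by simp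
  have 2: "ktop n k (lab (stk g (ys @ x # vs)) []) = 
      lab (Node (x @ [stk g ys])) (toppath vs)"
    unfolding 1 ktop_def assms(1)[symmetric] descend_plug by simp
  have 3: "length (children (ktop n k (lab (stk g (ys @ x # vs)) []))) = Suc (length x)"
    unfolding 2 by (simp del: lab.simps)
  have "Node (children (lab (Node x) pre)) = lab (Node x) pre" for pre
    by (simp add: lab_Node del: lab.simps)
  then have 4: "modify_top (n - k) (\<lambda>t. Node (butlast (children t))) (lab (stk g (ys @ x # vs)) [])
    = lab (plug (Node x) vs) []"
    unfolding 1 assms(1)[symmetric]
    by (intro modify_top_plug) (simp del: lab.simps add: lab_Node_snoc)
  show ?thesis unfolding stk_pop_def 3 4 by (cases x) auto
qed

lemma stk_push_plug:
  assumes "length vs = n - k" "k \<le> n" "1 \<le> k" "length ys = k - 1"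
  shows "stk_push n k \<gamma> (lab (stk g (ys @ x # vs)) []) =
     lab (stk \<gamma> (ys @ (x @ [stk g ys]) # vs)) []"
proof -
  let ?t = "stk g ys" and ?t' = "stk \<gamma> ys"
  have 1: "stk g (ys @ x # vs) = plug (Node (x @ [?t])) vs" by simp
  have l: "length (toppath vs) = n - k" using assms by simp
  have "incr_coord (n - k) (lab ?t' (toppath vs @ [Suc (length x)])) = 
     lab ?t' (toppath vs @ [Suc (Suc (length x))])"
    unfolding l[symmetric] by (rule incr_coord_lab)
  then have "stk_push n k \<gamma> (lab (stk g (ys @ x # vs)) []) =
    lab (plug (Node ((x @ [?t]) @ [?t'])) vs) []"
    unfolding 1 stk_push_def assms(1)[symmetric]
    by (intro modify_top_plug)
      (simp del: lab.simps append_assoc add: lab_Node_snoc[of "x @ [?t]"], simp del: lab.simps add: lab_Node_snoc set_topsym_plug assms(1))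
  then show ?thesis by simp
qed

section \<open>Flat configurations and histories\<close>

abbreviation state :: "('q, 'g) flat \<Rightarrow> 'q" where "state c \<equiv> fst c"
abbreviation symb :: "('q, 'g) flat \<Rightarrow> 'g" where "symb c \<equiv> fst (snd c)"
abbreviation comps :: "('q, 'g) flat \<Rightarrow> 'g stack list list" where "comps c \<equiv> snd (snd c)"

definition conf :: "('q, 'g) flat \<Rightarrow> ('q, 'g) config" where
  "conf c = (state c, lab (stk (symb c) (comps c)) [])"

definition leafpaths :: "('q, 'g) flat \<Rightarrow> nat list set" where
  "leafpaths c = paths (stk (symb c) (comps c))"

definition topc :: "('q, 'g) flat \<Rightarrow> nat list" where
  "topc c = toppath (comps c)"

lemma top_simps [simp]: "topc (q, g, xs) = toppath xs"
  by (simp add: topc_def)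

lemma take_toppath: "take (length xs - k) (toppath xs) = toppath (drop k xs)"
  by (cases "k \<le> length xs") (simp_all add: toppath_def take_rev drop_map)

lemma conf_simps [simp]:
  "fst (conf c) = state c" "topsym (snd (conf c)) = symb c"
  by (simp_all add: conf_def topsym_plug)

lemma hist_rev_snoc: "hist_rev n \<delta> (L @ [c', c]) x =
   (let y = hist_rev n \<delta> (L @ [c']) x in
       case \<delta> (fst c) (topsym (snd c)) of
          Op q (Push r \<gamma>) \<Rightarrow>
            (if y \<in> positions (ktop n (r - 1) (snd c')) then y[n - r := y ! (n - r) - 1] else y)
        | _ \<Rightarrow> y)"
proof (induction L arbitrary: x)
  case Nil
  show ?case unfolding append_Nil hist_rev.simps Let_def ..
next
  case (Cons d L)
  show ?case 
  proof (cases L)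
    case Nil
    show ?thesis unfolding Nil append_Nil append_Cons hist_rev.simps Let_def ..
  next
    case (Cons e L')
    show ?thesis unfolding Cons append_Cons hist_rev.simps(1)
      by (rule Cons.IH[unfolded Cons append_Cons])
  qed
qed

text \<open>\<open>hist_rev\<close> undoes the last step first. Splitting off the first step, which
  acts last on the leaf, matches the recursion of \<open>trace\<close> and all inductions on runs
  below.\<close>

lemma hist_Cons: "hist n \<delta> (c # c' # R) x =
   (let y = hist n \<delta> (c' # R) x in
       case \<delta> (fst c) (topsym (snd c)) of
          Op q (Push r \<gamma>) \<Rightarrow>
            (if y \<in> positions (ktop n (r - 1) (snd c')) then y[n - r := y ! (n - r) - 1] else y)
        | _ \<Rightarrow> y)"
  using hist_rev_snoc[of n \<delta> "rev R" c' c x] by (simp add: hist_def)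

locale dpda =
  fixes n :: nat and \<delta> :: "'q \<Rightarrow> 'g \<Rightarrow> ('q, 'a, 'g) transition"
  assumes is_dpda: "is_dpda n \<delta>"
begin

definition flat_ok :: "('q, 'g) flat \<Rightarrow> bool" where
  "flat_ok c \<longleftrightarrow> length (comps c) = n \<and> comps_ok (comps c)"

text \<open>An operation of order j+1 acts on the component with index j. A pop unpacks the last
  stack of this component into a symbol and j components. A push packs the old top
  \<open>stk g ys\<close> into it; the copy on top has the same components \<open>ys\<close> and
  only a new symbol.\<close>

inductive fstep :: "('q, 'g) flat \<Rightarrow> ('q, 'g) flat \<Rightarrow> bool" where
  read: "\<delta> q g = Read f \<Longrightarrow> fstep (q, g, xs) (f a, g, xs)"
| pop: "\<delta> q g = Op q' (Pop (Suc j)) \<Longrightarrow> length ys = j \<Longrightarrow> length zs = j \<Longrightarrow>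
    fstep (q, g, ys @ (b @ [stk g' zs]) # vs) (q', g', zs @ b # vs)"
| push: "\<delta> q g = Op q' (Push (Suc j) g') \<Longrightarrow> length ys = j \<Longrightarrow>
    fstep (q, g, ys @ b # vs) (q', g', ys @ (b @ [stk g ys]) # vs)"

lemma dpda_trans: "case \<delta> q g of
       Read f \<Rightarrow> inj f
     | Op q' (Pop k) \<Rightarrow> 1 \<le> k \<and> k \<le> n
     | Op q' (Push k \<gamma>) \<Rightarrow> 1 \<le> k \<and> k \<le> n"
  using is_dpda unfolding is_dpda_def by blast

lemma popD: "\<delta> q g = Op q' (Pop k) \<Longrightarrow> 1 \<le> k \<and> k \<le> n"
  using dpda_trans[of q g] by simp

lemma pushD: "\<delta> q g = Op q' (Push k g') \<Longrightarrow> 1 \<le> k \<and> k \<le> n"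
  using dpda_trans[of q g] by simp

lemma readD: "\<delta> q g = Read f \<Longrightarrow> inj f"
  using dpda_trans[of q g] by simp

lemma valid_conf:
  assumes "flat_ok c" shows "valid_config n (conf c)"
proof -
  have "shape n (stk (symb c) (comps c))"
    using assms shape_plug[of "comps c" "symb c"] unfolding flat_ok_def by auto
  then show ?thesis unfolding valid_config_def conf_def
    using wf_lab[of n "stk (symb c) (comps c)" n "[]"]
      nonempty_lab[of n "stk (symb c) (comps c)" "[]"] by simp
qed

lemma valid_flat:
  assumes "valid_config n c" shows "\<exists>d. flat_ok d \<and> c = conf d"
proof -
  have *: "shape n (strip_pos (snd c)) \<and> snd c = lab (strip_pos (snd c)) []"
    using assms unfolding valid_config_def by (intro wf_is_lab) auto
  then obtain g xs where "strip_pos (snd c) = stk g xs" "length xs = n"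
    using shape_decompose by blast
  then have "flat_ok (fst c, g, xs) \<and> c = conf (fst c, g, xs)"
    using * shape_plug[of xs g] by (auto simp: flat_ok_def conf_def prod_eq_iff)
  then show ?thesis by blast
qed

lemma conf_inject:
  assumes "flat_ok c" "flat_ok d" "conf c = conf d" shows "c = d"
proof -
  let ?p = "\<lambda>c :: ('q, 'g) flat. stk (symb c) (comps c)"
  have "shape n (?p c)" "shape n (?p d)" 
    using assms shape_plug[of "comps c" "symb c"] shape_plug[of "comps d" "symb d"]
    unfolding flat_ok_def by auto
  moreover have "strip_pos (?p c) = strip_pos (?p d)"
    using arg_cong[OF assms(3), of "\<lambda>c. strip_pos (snd c)"] by (simp add: conf_def)
  ultimately have "?p c = ?p d" by (simp add: strip_shape)
  moreover have "length (comps c) = length (comps d)" using assms(1,2) by (simp add: flat_ok_def)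
  ultimately have "symb c = symb d \<and> comps c = comps d" by (simp only: plug_inject)
  then show ?thesis using assms(3) by (simp add: conf_def prod_eq_iff)
qed

lemma fstep_ok:
  assumes "fstep c d" "flat_ok c" shows "flat_ok d"
  using assms(1)
proof cases
  case (read q g f xs a)
  then show ?thesis using assms(2) by (simp add: flat_ok_def)
next
  case (pop q g q' j ys zs b g' vs)
  let ?t = "stk g' zs"
  have c: "comps_ok (ys @ (b @ [?t]) # vs)" 
    using assms(2) pop(1) by (simp add: flat_ok_def)
  have sh: "shape j t" if "t \<in> set (b @ [?t])" for t
    using comps_okD[OF c that] pop(4) by simp
  have "comps_ok zs" using sh[of ?t] shape_plug[of zs g'] pop(5) by simp
  then have "comps_ok (zs @ [b])" using sh pop(5) by simp
  moreover have "comps_ok ((ys @ [b @ [?t]]) @ vs)" using c by simp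
  moreover have "length (zs @ [b]) = length (ys @ [b @ [?t]])" using pop(4,5) by simp
  ultimately have "comps_ok ((zs @ [b]) @ vs)" using comps_ok_replace by blast
  then show ?thesis using assms(2) pop(1,2,4,5) by (simp add: flat_ok_def)
next
  case (push q g q' j g' ys b vs)
  let ?t = "stk g ys"
  have c: "comps_ok (ys @ b # vs)" using assms(2) push(1) by (simp add: flat_ok_def)
  then have ys: "comps_ok ys" using comps_ok_appendD by blast
  have "shape j t" if "t \<in> set (b @ [?t])" for t
    using comps_okD[OF c] that shape_plug[of ys g] push(4) ys by auto
  then have "comps_ok (ys @ [b @ [?t]])" using ys push(4) by simp
  moreover have "comps_ok ((ys @ [b]) @ vs)" using c by simp
  moreover have "length (ys @ [b @ [?t]]) = length (ys @ [b])" by simp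
  ultimately have "comps_ok ((ys @ [b @ [?t]]) @ vs)" using comps_ok_replace by blast
  then show ?thesis using assms(2) push(1,2) by (simp add: flat_ok_def)
qed

lemma split_comps: "j < length xs \<Longrightarrow> \<exists>ys x vs. xs = ys @ x # vs \<and> length ys = j"
  by (intro exI[of _ "take j xs"] exI[of _ "xs ! j"] exI[of _ "drop (Suc j) xs"])
    (simp add: id_take_nth_drop[symmetric])

text \<open>Together with \<open>valid_flat\<close> and \<open>conf_inject\<close> this makes
  \<open>conf\<close> an isomorphism from the flat transition system onto the valid
  configurations.\<close>

lemma step_conf:
  assumes ok: "flat_ok c"
  shows "step n \<delta> (conf c) d \<longleftrightarrow> (\<exists>c'. fstep c c' \<and> d = conf c')"
proof -
  obtain q g xs where c: "c = (q, g, xs)" by (cases c) auto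
  have len: "length xs = n" and cok: "comps_ok xs" using ok by (auto simp: flat_ok_def c)
  show ?thesis
  proof (cases "\<delta> q g")
    case (Read f)
    have "step n \<delta> (conf c) d \<longleftrightarrow> (\<exists>a. d = conf (f a, g, xs))"
      unfolding step_def by (simp add: c Read) (simp add: conf_def)
    also have "\<dots> \<longleftrightarrow> (\<exists>c'. fstep c c' \<and> d = conf c')"
      using Read by (auto simp: c elim!: fstep.cases intro: fstep.read)
    finally show ?thesis .
  next
    case (Op q' op)
    show ?thesis
    proof (cases op)
      case (Pop k)
      then have k: "1 \<le> k" "k \<le> n" using popD Op by auto
      obtain ys x vs where xs: "xs = ys @ x # vs" "length ys = k - 1"
        using split_comps[of "k - 1" xs] k len by fastforce
      have pop: "stk_pop n k (lab (stk g (ys @ x # vs)) []) =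
        (if x = [] then None else Some (lab (plug (Node x) vs) []))"
        using k len xs by (intro stk_pop_plug) auto
      have "step n \<delta> (conf c) d \<longleftrightarrow> x \<noteq> [] \<and> d = (q', lab (plug (Node x) vs) [])"
        unfolding step_def conf_simps
        by (simp add: c Op Pop, simp add: conf_def xs(1) pop[simplified] prod_eq_iff) auto
      also have "\<dots> \<longleftrightarrow> (\<exists>c'. fstep c c' \<and> d = conf c')"
      proof
        assume a: "x \<noteq> [] \<and> d = (q', lab (plug (Node x) vs) [])"
        then obtain b t where x: "x = b @ [t]" by (cases x rule: rev_cases) auto
        have "shape (k - 1) t" using comps_okD[of ys x vs t] cok xs x by auto
        then obtain g' zs where t: "t = stk g' zs" "length zs = k - 1"
          using shape_decompose by metis
        have "fstep c (q', g', zs @ b # vs)"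
          using fstep.pop[of q g q' "k - 1" ys zs b g' vs] Op Pop k xs t x by (simp add: c)
        moreover have "d = conf (q', g', zs @ b # vs)"
          using a x t by (simp add: conf_def)
        ultimately show "\<exists>c'. fstep c c' \<and> d = conf c'" by blast
      next
        assume "\<exists>c'. fstep c c' \<and> d = conf c'"
        then obtain c' where "fstep c c'" "d = conf c'" by blast
        then show "x \<noteq> [] \<and> d = (q', lab (plug (Node x) vs) [])"
        proof (cases)
          case (pop q2 g2 q2' j ys2 zs b g' vs2)
          then show ?thesis using c Op Pop xs k \<open>d = conf c'\<close> by (auto simp: conf_def)
        qed (use c Op Pop in auto)
      qed
      finally show ?thesis .
    next
      case (Push k g')
      then have k: "1 \<le> k" "k \<le> n" using pushD Op by auto
      obtain ys x vs where xs: "xs = ys @ x # vs" "length ys = k - 1"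
        using split_comps[of "k - 1" xs] k len by fastforce
      have push: "stk_push n k g' (lab (stk g (ys @ x # vs)) []) =
         lab (stk g' (ys @ (x @ [stk g ys]) # vs)) []"
        using k len xs by (intro stk_push_plug) auto
      have "step n \<delta> (conf c) d \<longleftrightarrow> d = conf (q', g', ys @ (x @ [stk g ys]) # vs)"
        unfolding step_def conf_simps
        by (simp add: c Op Push, simp add: conf_def xs(1) push[simplified])
      also have "\<dots> \<longleftrightarrow> (\<exists>c'. fstep c c' \<and> d = conf c')"
      proof
        assume "d = conf (q', g', ys @ (x @ [stk g ys]) # vs)"
        moreover have "fstep c (q', g', ys @ (x @ [stk g ys]) # vs)"
          using fstep.push[of q g q' "k - 1" g' ys x vs] Op Push k xs by (simp add: c)
        ultimately show "\<exists>c'. fstep c c' \<and> d = conf c'" by blast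
      next
        assume "\<exists>c'. fstep c c' \<and> d = conf c'"
        then obtain c' where "fstep c c'" "d = conf c'" by blast
        then show "d = conf (q', g', ys @ (x @ [stk g ys]) # vs)"
        proof (cases)
          case (push q2 g2 q2' j g2' ys2 b vs2)
          then show ?thesis using c Op Push xs k \<open>d = conf c'\<close> by auto
        qed (use c Op Push in auto)
      qed
      finally show ?thesis .
    qed
  qed
qed

definition frun :: "('q, 'g) flat list \<Rightarrow> bool" where
  "frun P \<longleftrightarrow> P \<noteq> [] \<and> flat_ok (hd P) \<and> successively fstep P"

lemma frun_singleton [simp]: "frun [c] \<longleftrightarrow> flat_ok c"
  by (simp add: frun_def)

lemma frun_Cons: "frun (c # c' # P) \<longleftrightarrow> flat_ok c \<and> fstep c c' \<and> frun (c' # P)"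
  using fstep_ok by (simp add: frun_def) blast

lemma frun_all_ok: "frun P \<Longrightarrow> c \<in> set P \<Longrightarrow> flat_ok c"
proof (induction P)
  case (Cons d P)
  then show ?case by (cases P) (auto simp: frun_Cons)
qed simp

lemma frun_ne: "frun P \<Longrightarrow> P \<noteq> []" by (simp add: frun_def)

lemma frun_append: "frun (P @ c # Q) \<longleftrightarrow> frun (P @ [c]) \<and> frun (c # Q)"
proof (induction P)
  case Nil
  then show ?case by (cases Q) (auto simp: frun_Cons)
next
  case (Cons d P)
  then show ?case by (cases P) (auto simp: frun_Cons)
qed

lemma frun_drop: "frun P \<Longrightarrow> i < length P \<Longrightarrow> frun (drop i P)"
  using frun_append[of "take i P" "P ! i" "drop (Suc i) P"] by (simp add: Cons_nth_drop_Suc)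

lemma frun_take: "frun P \<Longrightarrow> i < length P \<Longrightarrow> frun (take (Suc i) P)"
  using frun_append[of "take i P" "P ! i" "drop (Suc i) P"]
  by (simp add: Cons_nth_drop_Suc take_Suc_conv_app_nth)

lemma frun_is_run: "frun P \<Longrightarrow> is_run n \<delta> (map conf P)"
proof -
  assume P: "frun P"
  have "step n \<delta> (conf (P ! i)) (conf (P ! Suc i))" if "Suc i < length P" for i
  proof -
    have "flat_ok (P ! i)" using frun_all_ok[OF P] that by simp
    moreover have "fstep (P ! i) (P ! Suc i)"
      using P that by (simp add: frun_def successively_conv_nth)
    ultimately show ?thesis using step_conf by blast
  qed
  moreover have "\<forall>c\<in>set P. valid_config n (conf c)" using frun_all_ok[OF P] valid_conf by blast
  ultimately show ?thesis using frun_ne[OF P] by (simp add: is_run_def)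
qed

lemma is_run_frun:
  assumes "is_run n \<delta> R" shows "\<exists>P. frun P \<and> R = map conf P"
  using assms
proof (induction R)
  case Nil
  then show ?case by (simp add: is_run_def)
next
  case (Cons c R)
  obtain d where d: "flat_ok d" "c = conf d"
    using valid_flat[of c] Cons(2) unfolding is_run_def by (meson list.set_intros(1))
  show ?case
  proof (cases R)
    case Nil
    then show ?thesis using d by (intro exI[of _ "[d]"]) simp
  next
    case (Cons c' R')
    have "step n \<delta> (R ! i) (R ! Suc i)" if "Suc i < length R" for i
    proof -
      have "step n \<delta> ((c # R) ! Suc i) ((c # R) ! Suc (Suc i))"
        using Cons.prems that unfolding is_run_def by (metis Suc_less_eq length_Cons)
      then show ?thesis by simp
    qed
    then have "is_run n \<delta> R" using Cons.prems Cons by (simp add: is_run_def)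
    then obtain P where P: "frun P" "R = map conf P" using Cons.IH by blast
    obtain e P' where e: "P = e # P'" using P Cons by auto
    have "\<forall>i. Suc i < length (c # R) \<longrightarrow> step n \<delta> ((c # R) ! i) ((c # R) ! Suc i)"
      using Cons.prems by (simp add: is_run_def)
    from this[rule_format, of 0] have "step n \<delta> (conf d) (conf e)" using d P e by simp
    then obtain e' where e': "fstep d e'" "conf e = conf e'" using step_conf d by blast
    have "flat_ok e" using P(1) e by (simp add: frun_def)
    moreover have "flat_ok e'" using e'(1) d(1) by (rule fstep_ok)
    ultimately have "e = e'" using e'(2) by (rule conf_inject)
    then have "frun (d # P)" using d P e e' by (simp add: frun_Cons)
    then show ?thesis using d P by (intro exI[of _ "d # P"]) simp
  qed
qed

section \<open>Histories as traces of leaf paths\<close>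

definition hist1 :: "('q, 'g) flat \<Rightarrow> ('q, 'g) flat \<Rightarrow> nat list \<Rightarrow> nat list" where
  "hist1 c c' p = (case \<delta> (state c) (symb c) of
      Op q (Push r g) \<Rightarrow> (if take (Suc n - r) p = take (Suc n - r) (topc c')
          then p[n - r := p ! (n - r) - 1] else p)
    | _ \<Rightarrow> p)"

fun trace :: "('q, 'g) flat list \<Rightarrow> nat list \<Rightarrow> nat list" where
  "trace (c # c' # P) p = hist1 c c' (trace (c' # P) p)"
| "trace _ p = p"

lemma hist1_simps:
  "\<delta> q g = Read f \<Longrightarrow> hist1 (q, g, xs) c p = p"
  "\<delta> q g = Op q' (Pop k) \<Longrightarrow> hist1 (q, g, xs) c p = p"
  by (simp_all add: hist1_def)

text \<open>The stacks of \<open>b\<close> have indices up to \<open>length b\<close>, the old top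
  has the next one and the copy has \<open>length b + 2\<close>. A leaf of the copy goes to the same
  place in the old top. Being in the copy concerns only the first n-j coordinates, so the case
  distinction is on a prefix.\<close>

lemma hist1_push:
  assumes "\<delta> q g = Op q' (Push (Suc j) g')" "length ys = j" "length (ys @ b # vs) = n"
    "length p = n"
  shows "hist1 (q, g, ys @ b # vs) (q', g', ys @ (b @ [t]) # vs) p =
    (if take (n - j) p = toppath vs @ [length b + 2]
     then toppath vs @ Suc (length b) # drop (n - j) p else p)"
proof -
  have *: "n - j = Suc (length vs)" "n - Suc j = length vs" using assms by auto
  have top: "take (n - j) (toppath (ys @ (b @ [t]) # vs)) = toppath vs @ [length b + 2]"
    unfolding * by simp
  show ?thesis
  proof (cases "take (n - j) p = toppath vs @ [length b + 2]")
    case True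
    then have "p = toppath vs @ (length b + 2) # drop (n - j) p"
      by (metis append_Cons append_Nil append_assoc append_take_drop_id)
    then have "p[n - Suc j := p ! (n - Suc j) - 1] = toppath vs @ Suc (length b) # drop (n - j) p"
      unfolding *(2) by (metis add_2_eq_Suc' diff_Suc_1 length_toppath list_update_length nth_append_length)
    then show ?thesis using True top assms by (simp add: hist1_def *)
  next
    case False
    then show ?thesis using top assms by (simp add: hist1_def)
  qed
qed

lemma leafpaths_length: "flat_ok c \<Longrightarrow> p \<in> leafpaths c \<Longrightarrow> length p = n"
  using paths_length shape_plug unfolding leafpaths_def flat_ok_def by metis

lemma top_leafpath: "topc c \<in> leafpaths c"
  by (simp add: topc_def leafpaths_def paths_plug)

text \<open>Only a push moves leaves. The leaf is outside the stack pushed on, or in it below the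
  copy, or in the copy; in the last case the old top and the copy differ only in a symbol and have
  the same paths.\<close>

lemma hist1_leafpaths:
  assumes "fstep c c'" "flat_ok c" "p \<in> leafpaths c'"
  shows "hist1 c c' p \<in> leafpaths c"
  using assms(1)
proof cases
  case (read q g f xs a)
  then show ?thesis using assms(3) by (simp add: hist1_simps leafpaths_def paths_plug)
next
  case (pop q g q' j ys zs b g' vs)
  have "leafpaths c' = paths (plug (Node (b @ [stk g' zs])) vs)"
    using pop by (simp add: leafpaths_def)
  moreover have "leafpaths c =
      paths (plug (Node ((b @ [stk g' zs]) @ [stk g ys])) vs)"
    using pop by (simp add: leafpaths_def)
  ultimately have "leafpaths c' \<subseteq> leafpaths c"
    unfolding paths_plug[of _ vs] paths_Node_snoc[of "b @ [stk g' zs]"] by blast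
  then show ?thesis using assms(3) pop by (auto simp: hist1_simps)
next
  case (push q g q' j g' ys b vs)
  have l: "length p = n" using leafpaths_length fstep_ok assms by blast
  have l2: "length (ys @ b # vs) = n" using assms(2) push by (simp add: flat_ok_def)
  have *: "n - j = Suc (length vs)" using push l2 by auto
  let ?t = "stk g ys" and ?t' = "stk g' ys"
  have t: "paths ?t = paths ?t'" by (simp add: paths_plug)
  have hp: "hist1 c c' p = (if take (n - j) p = toppath vs @ [length b + 2]
     then toppath vs @ Suc (length b) # drop (n - j) p else p)"
    using hist1_push[OF push(3,4) l2 l, of ?t] push(1,2) by simp
  have c: "leafpaths c = outer vs \<union> (\<lambda>p. toppath vs @ p) ` paths (Node (b @ [?t]))"
    using paths_plug[of "Node (b @ [?t])" vs] push(1) by (simp add: leafpaths_def)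
  have "leafpaths c' = outer vs \<union> (\<lambda>p. toppath vs @ p) ` paths (Node ((b @ [?t]) @ [?t']))"
    using paths_plug[of "Node ((b @ [?t]) @ [?t'])" vs] push(2) by (simp add: leafpaths_def)
  then consider "p \<in> outer vs" | \<pi> where "p = toppath vs @ \<pi>" "\<pi> \<in> paths (Node (b @ [?t]))"
    | \<pi> where "p = toppath vs @ (length b + 2) # \<pi>" "\<pi> \<in> paths ?t'"
    using assms(3) unfolding paths_Node_snoc[of _ ?t'] by auto
  then show ?thesis
  proof cases
    case 1
    have "take (n - j) p \<noteq> toppath vs @ [length b + 2]"
    proof
      assume "take (n - j) p = toppath vs @ [length b + 2]"
      then have "take (length vs) (take (n - j) p) = toppath vs" by simp
      then show False using outer_not_prefix[OF 1] by (simp add: * min_def)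
    qed
    then show ?thesis using 1 by (simp add: c hp)
  next
    case 2
    have "hd \<pi> \<noteq> length b + 2" "\<pi> \<noteq> []"
      using 2(2) unfolding paths_Node_snoc by auto
    then have "take (n - j) p \<noteq> toppath vs @ [length b + 2]"
      unfolding * 2(1) by (cases \<pi>) auto
    then have "hist1 c c' p = p" by (simp add: hp)
    then show ?thesis unfolding c 2(1) using 2(2) by blast
  next
    case 3
    then have "hist1 c c' p = toppath vs @ Suc (length b) # \<pi>" unfolding hp * by simp
    moreover have "Suc (length b) # \<pi> \<in> paths (Node (b @ [?t]))"
      unfolding paths_Node_snoc using 3 t by blast
    ultimately show ?thesis unfolding c by blast
  qed
qed

text \<open>A push looks at the coordinates up to index \<open>length vs\<close> and alters only
  that one. A prefix ending before it is unaffected, and a prefix containing it is treated alike for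
  both leaves. This is what gives a whole k-stack a history.\<close>

lemma take_hist1:
  assumes "fstep c c'" "flat_ok c" "length p = n" "length p' = n" "take a p = take a p'"
  shows "take a (hist1 c c' p) = take a (hist1 c c' p')"
  using assms(1)
proof cases
  case (push q g q' j g' ys b vs)
  have l2: "length (ys @ b # vs) = n" using assms(2) push by (simp add: flat_ok_def)
  have *: "n - j = Suc (length vs)" using push l2 by auto
  note bs = hist1_push[OF push(3,4) l2 assms(3)] hist1_push[OF push(3,4) l2 assms(4)]
  show ?thesis
  proof (cases "n - j \<le> a")
    case True
    have "take (n - j) p = take (n - j) (take a p)" for p :: "nat list"
      using True by (simp add: min_def)
    then have 1: "take (n - j) p = take (n - j) p'" using assms(5) by metis
    have "take a (toppath vs @ Suc (length b) # drop (n - j) p) =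
       toppath vs @ Suc (length b) # take (a - (n - j)) (drop (n - j) p)" for p
    proof -
      have "take a ((toppath vs @ [Suc (length b)]) @ drop (n - j) p) = (toppath vs @ [Suc (length b)]) @ take (a - (n - j)) (drop (n - j) p)"
        unfolding take_append using True * by simp
      then show ?thesis by simp
    qed
    moreover have "take (a - (n - j)) (drop (n - j) p) = take (a - (n - j)) (drop (n - j) p')"
      unfolding drop_take[symmetric] assms(5) ..
    ultimately show ?thesis using 1 assms(5) push(1,2) bs by simp
  next
    case False
    have "take a (hist1 c c' p) = take a p" if "length p = n" for p
    proof (cases "take (n - j) p = toppath vs @ [length b + 2]")
      case True
      have "take a p = take a (take (n - j) p)" using False by (simp add: min_def)
      also have "\<dots> = take a (toppath vs)" unfolding True using False * by simp
      finally have "take a p = take a (toppath vs)" .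
      moreover have "take a (toppath vs @ Suc (length b) # drop (n - j) p) = take a (toppath vs)"
        using False * by simp
      ultimately show ?thesis using True hist1_push[OF push(3,4) l2 that] push(1,2) by simp
    next
      case False
      then show ?thesis using hist1_push[OF push(3,4) l2 that] push(1,2) by simp
    qed
    then show ?thesis using assms by simp
  qed
qed (use assms in \<open>simp_all add: hist1_simps\<close>)

lemma trace_leafpaths: "frun P \<Longrightarrow> p \<in> leafpaths (last P) \<Longrightarrow> trace P p \<in> leafpaths (hd P)"
proof (induction P p rule: trace.induct)
  case (1 c c' P p)
  then have "trace (c' # P) p \<in> leafpaths c'" by (simp add: frun_Cons)
  then have "hist1 c c' (trace (c' # P) p) \<in> leafpaths c"
    using 1(2) by (intro hist1_leafpaths) (simp_all add: frun_Cons)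
  then show ?case by simp
qed (simp_all add: frun_def)

lemma trace_length: 
  assumes "frun P" "p \<in> leafpaths (last P)" shows "length (trace P p) = n"
proof (rule leafpaths_length)
  show "flat_ok (hd P)" using assms(1) by (simp add: frun_def)
  show "trace P p \<in> leafpaths (hd P)" using assms by (rule trace_leafpaths)
qed

lemma take_trace:
  "frun P \<Longrightarrow> p \<in> leafpaths (last P) \<Longrightarrow> p' \<in> leafpaths (last P) \<Longrightarrow> take a p = take a p' \<Longrightarrow>
   take a (trace P p) = take a (trace P p')"
proof (induction P p rule: trace.induct)
  case (1 c c' P p)
  have f: "frun (c' # P)" "flat_ok c" "fstep c c'" using 1(2) by (simp_all add: frun_Cons)
  have l: "last (c # c' # P) = last (c' # P)" by simp
  have "take a (trace (c' # P) p) = take a (trace (c' # P) p')"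
    using 1(1)[OF f(1)] 1(3-5) unfolding l by blast
  moreover have "length (trace (c' # P) p) = n" "length (trace (c' # P) p') = n"
    using trace_length[OF f(1)] 1(3,4) unfolding l by blast+
  ultimately show ?case unfolding trace.simps by (intro take_hist1[OF f(3,2)])
qed simp_all

lemma trace_append: "trace (P @ c # Q) p = trace (P @ [c]) (trace (c # Q) p)"
proof (induction P)
  case (Cons d P)
  then show ?case by (cases P) auto
qed simp

lemma trace_split: "i < length P \<Longrightarrow> trace P p = trace (take (Suc i) P) (trace (drop i P) p)"
  using trace_append[of "take i P" "P ! i" "drop (Suc i) P"]
  by (simp add: Cons_nth_drop_Suc take_Suc_conv_app_nth)

lemma ktop_conf:
  assumes "flat_ok c"
  shows "ktop n k (snd (conf c)) = 
    lab (stk (symb c) (take k (comps c))) (toppath (drop k (comps c)))"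
proof -
  have "descend (length (drop k (comps c))) (lab (plug (stk (symb c) (take k (comps c))) (drop k (comps c))) []) =
     lab (stk (symb c) (take k (comps c))) (toppath (drop k (comps c)))"
    unfolding descend_plug by simp
  moreover have "length (drop k (comps c)) = n - k" using assms by (simp add: flat_ok_def)
  ultimately show ?thesis unfolding ktop_def conf_def plug_append[symmetric] by simp
qed

lemma positions_ktop:
  assumes "flat_ok c"
  shows "positions (ktop n k (snd (conf c))) =
    {p \<in> leafpaths c. take (n - k) p = take (n - k) (topc c)}"
proof -
  let ?u = "stk (symb c) (take k (comps c))" and ?v = "drop k (comps c)"
  have l: "length ?v = n - k" and t: "take (n - k) (topc c) = toppath ?v"
    using assms take_toppath[of "comps c" k] by (auto simp: flat_ok_def topc_def)
  have "leafpaths c = paths (plug ?u ?v)"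
    unfolding leafpaths_def plug_append[symmetric] by simp
  then have "leafpaths c = outer ?v \<union> (\<lambda>p. toppath ?v @ p) ` paths ?u" by (simp add: paths_plug)
  moreover have "take (n - k) p \<noteq> toppath ?v" if "p \<in> outer ?v" for p
    using outer_not_prefix[OF that] l by simp
  moreover have "take (n - k) p = toppath ?v" if "p \<in> (\<lambda>p. toppath ?v @ p) ` paths ?u" for p
    using that l by auto
  ultimately show ?thesis unfolding ktop_conf[OF assms] positions_lab t by blast
qed

text \<open>The traced path stays a leaf of each configuration (\<open>trace_leafpaths\<close>), so
  by \<open>positions_ktop\<close> the test for membership in a topmost stack becomes a comparison
  of prefixes.\<close>

lemma hist_trace:
  "frun P \<Longrightarrow> p \<in> leafpaths (last P) \<Longrightarrow> hist n \<delta> (map conf P) p = trace P p"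
proof (induction P p rule: trace.induct)
  case (1 c c' P p)
  have f: "frun (c' # P)" "flat_ok c" "flat_ok c'" "fstep c c'"
    using 1(2) by (simp_all add: frun_Cons) (simp add: frun_def)
  have y: "hist n \<delta> (map conf (c' # P)) p = trace (c' # P) p" using 1 f by auto
  have "trace (c' # P) p \<in> leafpaths c'" using trace_leafpaths 1(3) f(1) by fastforce
  then show ?case using y
    unfolding list.map hist_Cons hist1_def trace.simps
    by (auto simp: positions_ktop[OF f(3)] Let_def Suc_diff_le dest!: pushD 
        split: transition.split stack_op.split)
qed (auto simp: frun_def hist_def)

lemma ktop_substack: "flat_ok c \<Longrightarrow> ktop n k (snd (conf c)) \<in> substacks (n - k) (snd (conf c))"
proof -
  assume ok: "flat_ok c"
  have "lab s (pre @ toppath xs) \<in> substacks (length xs) (lab (plug s xs) pre)"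
    for s :: "'g stack" and xs pre
  proof (induction xs arbitrary: pre rule: rev_induct)
    case (snoc x xs)
    then show ?case using snoc[of "pre @ [Suc (length x)]"]
      by (simp del: lab.simps add: lab_Node_snoc)
  qed simp
  from this[of _ "[]" "drop k (comps c)"] show ?thesis
    unfolding ktop_conf[OF ok] using ok
    by (metis append_Nil append_take_drop_id conf_def flat_ok_def length_drop plug_append snd_conv)
qed

definition upper :: "nat \<Rightarrow> ('q, 'g) flat list \<Rightarrow> bool" where
  "upper k P \<longleftrightarrow> take (n - k) (trace P (topc (last P))) = take (n - k) (topc (hd P))"

text \<open>By \<open>take_trace\<close> all leaves of the final topmost k-stack have histories with
  the same first n-k coordinates, so the top leaf decides.\<close>

lemma kupper_iff:
  assumes "frun P" shows "kupper n \<delta> k (map conf P) \<longleftrightarrow> upper k P"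
proof -
  have ok: "flat_ok (hd P)" "flat_ok (last P)" "P \<noteq> []" using assms frun_all_ok frun_ne by auto
  have "kupper n \<delta> k (map conf P) \<longleftrightarrow> (\<forall>x\<in>leafpaths (last P). 
      take (n - k) x = take (n - k) (topc (last P)) \<longrightarrow>
      take (n - k) (trace P x) = take (n - k) (topc (hd P)))"
    unfolding kupper_def hist_is_def
    using ok ktop_substack[OF ok(1)] hist_trace[OF assms] trace_leafpaths[OF assms]
    by (auto simp: hd_map last_map positions_ktop)
  also have "\<dots> \<longleftrightarrow> upper k P"
    unfolding upper_def using take_trace[OF assms] top_leafpath by metis
  finally show ?thesis .
qed

section \<open>Returns\<close>

text \<open>Component \<open>d\<close> has order \<open>d + 1\<close>. In the rule \<open>push_pop\<close> the traced component lies inside the stack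
  left behind by the push, hence the run first returns to that stack, with the old top on it.\<close>

inductive ret :: "('q, 'g) flat list \<Rightarrow> nat \<Rightarrow> bool" where
  read: "\<delta> q g = Read f \<Longrightarrow> ret P d \<Longrightarrow> hd P = (f a, g, xs) \<Longrightarrow> ret ((q, g, xs) # P) d"
| pop_last: "\<delta> q g = Op q' (Pop (Suc d)) \<Longrightarrow> length ys = d \<Longrightarrow> length zs = d \<Longrightarrow>
    ret [(q, g, ys @ (b @ [stk g' zs]) # vs), (q', g', zs @ b # vs)] d"
| pop: "\<delta> q g = Op q' (Pop (Suc j)) \<Longrightarrow> length ys = j \<Longrightarrow> length zs = j \<Longrightarrow> j < d \<Longrightarrow>
    ret P d \<Longrightarrow> hd P = (q', g', zs @ b # vs) \<Longrightarrow>
    ret ((q, g, ys @ (b @ [stk g' zs]) # vs) # P) d"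
| push: "\<delta> q g = Op q' (Push (Suc j) g') \<Longrightarrow> length ys = j \<Longrightarrow> d \<noteq> j \<Longrightarrow>
    ret P d \<Longrightarrow> hd P = (q', g', ys @ (b @ [stk g ys]) # vs) \<Longrightarrow>
    ret ((q, g, ys @ b # vs) # P) d"
| push_pop: "\<delta> q g = Op q' (Push (Suc j) g') \<Longrightarrow> length ys = j \<Longrightarrow> d \<le> j \<Longrightarrow>
    ret (P @ [c]) j \<Longrightarrow> hd (P @ [c]) = (q', g', ys @ (b @ [stk g ys]) # vs) \<Longrightarrow>
    ret (c # Q) d \<Longrightarrow> ret ((q, g, ys @ b # vs) # P @ c # Q) d"

text \<open>Records minimality: at no configuration but the last, which is exempt, does the traced
  leaf lie in the topmost stack of order n-m. If \<open>p\<close> is the final top and m \<le> n, no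
  suffix with at least one step is (n-m)-upper.\<close>

fun avoids :: "nat \<Rightarrow> ('q, 'g) flat list \<Rightarrow> nat list \<Rightarrow> bool" where
  "avoids m (c # c' # P) p \<longleftrightarrow>
     take m (trace (c # c' # P) p) \<noteq> take m (topc c) \<and> avoids m (c' # P) p"
| "avoids m _ p \<longleftrightarrow> True"

lemma avoids_append:
  "avoids m (P @ c # Q) p \<longleftrightarrow> avoids m (P @ [c]) (trace (c # Q) p) \<and> avoids m (c # Q) p"
proof (induction P)
  case (Cons d P)
  show ?case
  proof (cases P)
    case Nil
    then show ?thesis using Cons by simp
  next
    case P: (Cons e P')
    have "trace (d # P @ c # Q) p = trace (d # P @ [c]) (trace (c # Q) p)"
      using trace_append[of "d # P" c Q p] by simp
    then show ?thesis using Cons P by simp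
  qed
qed simp

lemma avoids_mono: "avoids m P p \<Longrightarrow> m \<le> m' \<Longrightarrow> avoids m' P p"
proof (induction m P p rule: avoids.induct)
  case (1 m c c' P p)
  have "take m' u \<noteq> take m' v" if "take m u \<noteq> take m v" for u v :: "nat list"
    using that 1(3) by (metis min.absorb1 take_take)
  then show ?case using 1 by simp
qed simp_all

lemma avoids_drop: "avoids m P p \<Longrightarrow> Suc s < length P \<Longrightarrow>
   take m (trace (drop s P) p) \<noteq> take m (topc (P ! s))"
proof (induction m P p arbitrary: s rule: avoids.induct)
  case (1 m c c' P p)
  then show ?case by (cases s) simp_all
qed simp_all

lemma ret_Cons2: "ret P d \<Longrightarrow> \<exists>c c' P'. P = c # c' # P'"
proof (induction rule: ret.induct)
  case (push_pop q g q' j g' ys d P c b vs Q)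
  then show ?case by (cases P) auto
qed auto

lemma ret_frun: "ret P d \<Longrightarrow> flat_ok (hd P) \<Longrightarrow> frun P"
proof (induction rule: ret.induct)
  case (read q g f P d a xs)
  have s: "fstep (q, g, xs) (hd P)" using read fstep.read by simp
  then have "frun P" using read fstep_ok by simp
  then show ?case using s read(5) ret_Cons2[OF read(2)] by (auto simp: frun_Cons)
next
  case (pop_last q g q' d ys zs b g' vs)
  show ?case using fstep.pop[OF pop_last(1-3), of b g' vs] pop_last(4) fstep_ok
    by (simp add: frun_Cons)
next
  case (pop q g q' j ys zs d P g' b vs)
  have s: "fstep (q, g, ys @ (b @ [stk g' zs]) # vs) (hd P)"
    using fstep.pop[OF pop(1-3), of b g' vs] pop(6) by simp
  then have "frun P" using pop fstep_ok by simp
  then show ?case using s pop(8) ret_Cons2[OF pop(5)] by (auto simp: frun_Cons)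
next
  case (push q g q' j g' ys d P b vs)
  have s: "fstep (q, g, ys @ b # vs) (hd P)"
    using fstep.push[OF push(1-2), of b vs] push(5) by simp
  then have "frun P" using push fstep_ok by simp
  then show ?case using s push(7) ret_Cons2[OF push(4)] by (auto simp: frun_Cons)
next
  case (push_pop q g q' j g' ys d P c b vs Q)
  have s: "fstep (q, g, ys @ b # vs) (hd (P @ [c]))"
    using fstep.push[OF push_pop(1-2), of b vs] push_pop(5) by simp
  have f1: "frun (P @ [c])" using push_pop(7) s push_pop(9) fstep_ok by simp
  then have "flat_ok c" using frun_all_ok[OF f1, of c] by simp
  then have "frun (c # Q)" using push_pop(8) by simp
  with f1 have "frun (P @ c # Q)" using frun_append by blast
  moreover obtain e P' where "P = e # P'" using ret_Cons2[OF push_pop(4)] by (cases P) auto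
  ultimately show ?case using s push_pop(9) by (simp add: frun_Cons)
qed

lemma paths_Node_Cons: "\<pi> \<in> paths (Node x) \<Longrightarrow> \<exists>i \<pi>'. \<pi> = Suc i # \<pi>' \<and> i < length x"
  by auto

text \<open>The meaning of \<open>ret\<close>: the topmost (d+1)-stack without its topmost d-stack,
  \<open>Node x\<close>, has become the topmost (d+1)-stack, with the same relative paths. The
  components beyond it may have changed from \<open>vs\<close> to \<open>vs'\<close>; only their
  number is kept. For n components \<open>Suc (length vs)\<close> is n-d, so before the end the
  traced leaves are never in the topmost d-stack.\<close>

definition returns :: "('q, 'g) flat list \<Rightarrow> nat \<Rightarrow> bool" where
  "returns P d \<longleftrightarrow> (\<forall>ys x vs. comps (hd P) = ys @ x # vs \<longrightarrow> length ys = d \<longrightarrow>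
     (\<exists>zs vs'. comps (last P) = zs @ vs' \<and> length zs = Suc d \<and> length vs' = length vs \<and>
        stk (symb (last P)) zs = Node x \<and>
        (\<forall>\<pi>\<in>paths (Node x). trace P (toppath vs' @ \<pi>) = toppath vs @ \<pi> \<and>
           avoids (Suc (length vs)) P (toppath vs' @ \<pi>))))"

lemma returnsI:
  assumes "\<And>ys x vs. comps (hd P) = ys @ x # vs \<Longrightarrow> length ys = d \<Longrightarrow>
    \<exists>zs vs'. comps (last P) = zs @ vs' \<and> length zs = Suc d \<and> length vs' = length vs \<and>
        stk (symb (last P)) zs = Node x \<and>
        (\<forall>\<pi>\<in>paths (Node x). trace P (toppath vs' @ \<pi>) = toppath vs @ \<pi> \<and>
           avoids (Suc (length vs)) P (toppath vs' @ \<pi>))"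
  shows "returns P d"
  using assms unfolding returns_def by blast

lemma returnsD:
  assumes "returns P d" "comps (hd P) = ys @ x # vs" "length ys = d"
  shows "\<exists>zs vs'. comps (last P) = zs @ vs' \<and> length zs = Suc d \<and> length vs' = length vs \<and>
        stk (symb (last P)) zs = Node x \<and>
        (\<forall>\<pi>\<in>paths (Node x). trace P (toppath vs' @ \<pi>) = toppath vs @ \<pi> \<and>
           avoids (Suc (length vs)) P (toppath vs' @ \<pi>))"
  using assms unfolding returns_def by blast

lemma not_top_prefix:
  assumes "\<pi> \<in> paths (Node x)"
  shows "take (Suc (length vs)) (toppath vs @ \<pi>) \<noteq> take (Suc (length vs)) (toppath (ys @ x # vs))"
  using paths_Node_Cons[OF assms] by auto

text \<open>Common to all rules that put one configuration in front of a return: component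
  \<open>x\<close> survives the step, and the step sends its leaves back to it. Avoidance at the new
  head holds because leaves of a component are outside the topmost d-stack
  (\<open>not_top_prefix\<close>).\<close>

lemma returns_step:
  assumes "returns P d" "P \<noteq> []" "comps (hd P) = ys' @ x # vs1" "length ys' = d"
    "comps c = ys @ x # vs" "length vs = length vs1"
    "\<And>\<pi>. \<pi> \<in> paths (Node x) \<Longrightarrow> hist1 c (hd P) (toppath vs1 @ \<pi>) = toppath vs @ \<pi>"
  shows "\<exists>zs vs'. comps (last (c # P)) = zs @ vs' \<and> length zs = Suc d \<and> length vs' = length vs \<and>
        stk (symb (last (c # P))) zs = Node x \<and>
        (\<forall>\<pi>\<in>paths (Node x). trace (c # P) (toppath vs' @ \<pi>) = toppath vs @ \<pi> \<and>
           avoids (Suc (length vs)) (c # P) (toppath vs' @ \<pi>))"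
proof -
  obtain e Q where P: "P = e # Q" using assms(2) by (cases P) auto
  obtain zs vs' where r: "comps (last P) = zs @ vs'" "length zs = Suc d" "length vs' = length vs1"
    "stk (symb (last P)) zs = Node x"
    and r2: "\<forall>\<pi>\<in>paths (Node x). trace P (toppath vs' @ \<pi>) = toppath vs1 @ \<pi> \<and>
      avoids (Suc (length vs1)) P (toppath vs' @ \<pi>)"
    using returnsD[OF assms(1,3,4)] by blast
  have t: "trace (c # P) (toppath vs' @ \<pi>) = toppath vs @ \<pi>" if "\<pi> \<in> paths (Node x)" for \<pi>
    using bspec[OF r2 that] assms(7)[OF that] P by simp
  moreover have "avoids (Suc (length vs)) (c # P) (toppath vs' @ \<pi>)" if "\<pi> \<in> paths (Node x)" for \<pi>
    using bspec[OF r2 that] t[OF that] not_top_prefix[OF that, of vs ys] assms(5,6) 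
    unfolding P avoids.simps topc_def by simp
  moreover have "last (c # P) = last P" "length vs' = length vs" using assms(2,6) r(3) by simp_all
  ultimately show ?thesis using r(1,2,4) by (intro exI[of _ zs] exI[of _ vs']) simp
qed

lemma split_less:
  assumes "ys0 @ B # vs0 = ys @ x # vs" "length ys0 < length ys"
  obtains ys1 where "ys = ys0 @ B # ys1" "vs0 = ys1 @ x # vs"
proof -
  from assms obtain us where us: "ys = ys0 @ us" "us @ x # vs = B # vs0"
    by (auto simp: append_eq_append_conv2)
  then obtain ys1 where "us = B # ys1" using assms(2) by (cases us) auto
  then show ?thesis using us that by simp
qed

lemma hist1_push_above:
  assumes "\<delta> q g = Op q' (Push (Suc j) g')" "length ys = j" "length (ys @ b # vs) = n"
    "length p = n" "take (length vs) p \<noteq> toppath vs"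
  shows "hist1 (q, g, ys @ b # vs) (q', g', ys @ (b @ [t]) # vs) p = p"
proof -
  have nj: "n - j = Suc (length vs)" using assms(2,3) by simp
  have "take (n - j) p \<noteq> toppath vs @ [length b + 2]"
  proof
    assume "take (n - j) p = toppath vs @ [length b + 2]"
    then have "take (length vs) (take (n - j) p) = toppath vs" by simp
    then show False using assms(5) unfolding nj take_take by simp
  qed
  then show ?thesis using hist1_push[OF assms(1-4), of t] by simp
qed

lemma hist1_push_copy:
  assumes "\<delta> q g = Op q' (Push (Suc j) g')" "length ys = j" "length (ys @ b # vs) = n"
    "length \<pi> = j"
  shows "hist1 (q, g, ys @ b # vs) (q', g', ys @ (b @ [t]) # vs) (toppath vs @ (length b + 2) # \<pi>)
     = toppath vs @ Suc (length b) # \<pi>"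
proof -
  have "n - j = Suc (length vs)" using assms(2,3) by simp
  then show ?thesis using hist1_push[OF assms(1-3), of "toppath vs @ (length b + 2) # \<pi>" t]
    assms by simp
qed

lemma hist1_push_below:
  assumes "\<delta> q g = Op q' (Push (Suc j) g')" "length ys = j" "length (ys @ b # vs) = n"
    "length \<pi> = j" "i \<noteq> length b + 2"
  shows "hist1 (q, g, ys @ b # vs) (q', g', ys @ (b @ [t]) # vs) (toppath vs @ i # \<pi>)
     = toppath vs @ i # \<pi>"
proof -
  have "n - j = Suc (length vs)" using assms(2,3) by simp
  then show ?thesis using hist1_push[OF assms(1-3), of "toppath vs @ i # \<pi>" t]
    assms by simp
qed

lemma paths_comp_length:
  assumes "comps_ok (ys @ x # vs)" "\<pi> \<in> paths (Node x)"
  shows "length \<pi> = Suc (length ys)"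
proof -
  obtain i \<pi>' where "i < length x" "\<pi> = Suc i # \<pi>'" "\<pi>' \<in> paths (x ! i)"
    using assms(2) by auto
  moreover have "shape (length ys) (x ! i)" using comps_okD[OF assms(1)] calculation by simp
  ultimately show ?thesis using paths_length by fastforce
qed

text \<open>\<open>us v\<close> is the context of component \<open>x\<close> when the components
  beyond \<open>b\<close> are \<open>v\<close>. It is a function because the return to the pushed
  stack may replace \<open>vs\<close>, while \<open>ys\<close> and \<open>b\<close> come back
  intact. As \<open>i\<close> is not the index of the copy, the push does not move these
  leaves.\<close>

lemma split_above:
  assumes e: "ys @ b # vs = ys' @ x # vs'" and le: "length ys' \<le> length ys"
  shows "\<exists>us. (\<forall>v. ys @ b # v = ys' @ x # us v) \<and> us vs = vs' \<and>
    (\<forall>\<pi>\<in>paths (Node x). \<exists>i \<rho>. i # \<rho> \<in> paths (Node (b @ [stk g ys])) \<and>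
      i \<noteq> length b + 2 \<and> (\<forall>v. toppath (us v) @ \<pi> = toppath v @ i # \<rho>))"
proof (cases "length ys' = length ys")
  case True
  then have y: "ys' = ys" "x = b" "vs' = vs" using e by simp_all
  have "\<exists>i \<rho>. i # \<rho> \<in> paths (Node (b @ [stk g ys])) \<and>
      i \<noteq> length b + 2 \<and> (\<forall>v. toppath v @ \<pi> = toppath v @ i # \<rho>)" if pi: "\<pi> \<in> paths (Node x)" for \<pi>
  proof -
    obtain i \<rho> where i: "\<pi> = Suc i # \<rho>" "i < length x" using paths_Node_Cons[OF pi] by blast
    have "\<pi> \<in> paths (Node (b @ [stk g ys]))"
      unfolding paths_Node_snoc using pi y(2) by blast
    then show ?thesis using i y(2) by (intro exI[of _ "Suc i"] exI[of _ \<rho>]) (simp del: paths.simps)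
  qed
  then show ?thesis using y by (intro exI[of _ "\<lambda>v. v"]) (simp del: paths.simps)
next
  case False
  then have "length ys' < length ys" using le by simp
  then obtain ys1 where y: "ys = ys' @ x # ys1" "vs' = ys1 @ b # vs"
    using split_less[OF e[symmetric]] by metis
  have "Suc (length b) # toppath ys1 @ \<pi> \<in> paths (Node (b @ [stk g ys]))"
    if pi: "\<pi> \<in> paths (Node x)" for \<pi>
  proof -
    have p: "stk g ys = plug (Node (x @ [stk g ys'])) ys1" using y by simp
    have "toppath ys1 @ \<pi> \<in> paths (stk g ys)" using pi
      unfolding p paths_plug[of "Node (x @ [stk g ys'])" ys1] paths_Node_snoc[of x]
      by (simp del: paths.simps)
    then show ?thesis unfolding paths_Node_snoc by blast
  qed
  then have "\<exists>i \<rho>. i # \<rho> \<in> paths (Node (b @ [stk g ys])) \<and>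
      i \<noteq> length b + 2 \<and> (\<forall>v. toppath (ys1 @ b # v) @ \<pi> = toppath v @ i # \<rho>)" if pi: "\<pi> \<in> paths (Node x)" for \<pi>
    using pi by (intro exI[of _ "Suc (length b)"] exI[of _ "toppath ys1 @ \<pi>"]) (simp del: paths.simps)
  then show ?thesis using y by (intro exI[of _ "\<lambda>v. ys1 @ b # v"]) (simp del: paths.simps)
qed

text \<open>In rule \<open>push\<close>, a component with d > j lies outside the stack pushed on,
  and for d < j the run exposes its duplicate inside the copy. Rule \<open>push_pop\<close> composes
  two returns: the first restores the old top, the second starts from it.\<close>

lemma ret_returns: "ret P d \<Longrightarrow> flat_ok (hd P) \<Longrightarrow> returns P d"
proof (induction rule: ret.induct)
  case (read q g f P d a xs)
  have s: "fstep (q, g, xs) (hd P)" using read fstep.read by simp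
  then have P: "returns P d" using read(4,5) fstep_ok by simp
  have ne: "P \<noteq> []" using ret_Cons2[OF read(2)] by auto
  show ?case
  proof (rule returnsI)
    fix ys x vs assume a: "comps (hd ((q, g, xs) # P)) = ys @ x # vs" "length ys = d"
    show "\<exists>zs vs'. comps (last ((q, g, xs) # P)) = zs @ vs' \<and> length zs = Suc d \<and> length vs' = length vs \<and>
        stk (symb (last ((q, g, xs) # P))) zs = Node x \<and>
        (\<forall>\<pi>\<in>paths (Node x). trace ((q, g, xs) # P) (toppath vs' @ \<pi>) = toppath vs @ \<pi> \<and>
           avoids (Suc (length vs)) ((q, g, xs) # P) (toppath vs' @ \<pi>))"
      using P ne a read(1,3) by (intro returns_step[of P d ys _ vs]) (simp_all add: hist1_simps)
  qed
next
  case (pop_last q g q' d ys zs b g' vs)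
  show ?case
  proof (rule returnsI, goal_cases)
    case (1 ys' x vs')
    then have *: "ys' = ys" "x = b @ [stk g' zs]" "vs' = vs" using pop_last by auto
    have "stk g' (zs @ [b]) = Node x" using * by simp
    moreover have "trace [(q, g, ys @ x # vs), (q', g', zs @ b # vs)] p = p" for p
      using pop_last(1) by (simp add: hist1_simps)
    ultimately show ?case using * not_top_prefix[of _ x vs ys] pop_last(3)
      by (intro exI[of _ "zs @ [b]"] exI[of _ vs]) (simp del: paths.simps)
  qed
next
  case (pop q g q' j ys zs d P g' b vs)
  let ?c = "(q, g, ys @ (b @ [stk g' zs]) # vs)"
  have s: "fstep ?c (hd P)" using fstep.pop[OF pop(1-3), of b g' vs] pop(6) by simp
  have P: "returns P d" using pop(7,8) s fstep_ok by simp
  have ne: "P \<noteq> []" using ret_Cons2[OF pop(5)] by auto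
  show ?case
  proof (rule returnsI, goal_cases)
    case (1 ys' x vs')
    then have "ys @ (b @ [stk g' zs]) # vs = ys' @ x # vs'" "length ys < length ys'" using pop by auto
    then obtain ys1 where "ys' = ys @ (b @ [stk g' zs]) # ys1" "vs = ys1 @ x # vs'"
      by (rule split_less)
    then show ?case using P ne 1 pop(1,2,3,6)
      by (intro returns_step[of P d "zs @ b # ys1" _ vs']) (simp_all add: hist1_simps)
  qed
next
  case (push q g q' j g' ys d P b vs)
  let ?t = "stk g ys"
  have s: "fstep (q, g, ys @ b # vs) (hd P)" using fstep.push[OF push(1-2), of b vs] push(5) by simp
  have P: "returns P d" using push(6,7) s fstep_ok by simp
  have ne: "P \<noteq> []" using ret_Cons2[OF push(4)] by auto
  have n: "length (ys @ b # vs) = n" "comps_ok (ys @ b # vs)" using push(7) by (simp_all add: flat_ok_def)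
  show ?case
  proof (rule returnsI, goal_cases)
    case (1 ys' x vs')
    then have e: "ys @ b # vs = ys' @ x # vs'" by simp
    have l: "length \<pi> = Suc d" if "\<pi> \<in> paths (Node x)" for \<pi>
      using paths_comp_length[OF n(2)[unfolded e] that] 1(2) by simp
    have l2: "length vs' + Suc d = n" using n(1) 1(2) unfolding e by simp
    show ?case
    proof (cases "j < d")
      case True
      then have "length ys < length ys'" using 1 push by simp
      then obtain ys1 where y: "ys' = ys @ b # ys1" "vs = ys1 @ x # vs'"
        using split_less[OF e] by metis
      have "hist1 (q, g, ys @ b # vs) (q', g', ys @ (b @ [?t]) # vs) (toppath vs' @ \<pi>) = toppath vs' @ \<pi>"
        if pi: "\<pi> \<in> paths (Node x)" for \<pi>
      proof (rule hist1_push_above[OF push(1,2) n(1)])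
        show "length (toppath vs' @ \<pi>) = n" using l[OF pi] l2 by simp
        show "take (length vs) (toppath vs' @ \<pi>) \<noteq> toppath vs"
          using paths_Node_Cons[OF pi] y by auto
      qed
      then show ?thesis using P ne 1 push(5) y
        by (intro returns_step[of P d "ys @ (b @ [?t]) # ys1" _ vs']) simp_all
    next
      case False
      then have "length ys' < length ys" using 1 push by simp
      then obtain ys1 where y: "ys = ys' @ x # ys1" "vs' = ys1 @ b # vs"
        using split_less[OF e[symmetric]] by metis
      have "hist1 (q, g, ys @ b # vs) (q', g', ys @ (b @ [?t]) # vs) 
          (toppath vs @ (length b + 2) # (toppath ys1 @ \<pi>)) = toppath vs @ Suc (length b) # (toppath ys1 @ \<pi>)"
        if pi: "\<pi> \<in> paths (Node x)" for \<pi>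
        using hist1_push_copy[OF push(1,2) n(1)] l[OF pi] y push(2) 1(2) by simp
      then show ?thesis using P ne 1 push(5) y
        by (intro returns_step[of P d ys' _ "ys1 @ (b @ [?t]) # vs"]) (simp_all del: paths.simps)
    qed
  qed
next
  case (push_pop q g q' j g' ys d P c b vs Q)
  let ?t = "stk g ys"
  have s: "fstep (q, g, ys @ b # vs) (hd (P @ [c]))"
    using fstep.push[OF push_pop(1-2), of b vs] push_pop(5) by simp
  have ok1: "flat_ok (hd (P @ [c]))" using s push_pop(9) fstep_ok by simp
  then have R1: "returns (P @ [c]) j" using push_pop(7) by simp
  have "frun (P @ [c])" using ret_frun push_pop(4) ok1 by blast
  then have okc: "flat_ok c" using frun_all_ok[of "P @ [c]" c] by simp
  then have R2: "returns (c # Q) d" using push_pop(8) by simp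
  have n: "length (ys @ b # vs) = n" "comps_ok (ys @ b # vs)" using push_pop(9) by (simp_all add: flat_ok_def)
  obtain e P' where P: "P = e # P'" using ret_Cons2[OF push_pop(4)] by (cases P) simp_all
  have ce: "comps (hd (P @ [c])) = ys @ (b @ [?t]) # vs" using push_pop(5) by simp
  obtain zs vs2 where r: "comps (last (P @ [c])) = zs @ vs2" "length zs = Suc j" "length vs2 = length vs"
    "stk (symb (last (P @ [c]))) zs = Node (b @ [?t])"
    and r2: "\<forall>\<pi>\<in>paths (Node (b @ [?t])). trace (P @ [c]) (toppath vs2 @ \<pi>) = toppath vs @ \<pi> \<and>
      avoids (Suc (length vs)) (P @ [c]) (toppath vs2 @ \<pi>)"
    using returnsD[OF R1 ce push_pop(2)] by blast
  \<comment> \<open>The exposed stack ends with the old top, and decompositions along the top are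
    unique. So \<open>g\<close>, \<open>ys\<close> and \<open>b\<close> are back, and only the part
    beyond may differ.\<close>
  have "zs = ys @ [b] \<and> symb c = g"
    using r(2,4) plug_inject[of zs "ys @ [b]" "symb c" g] push_pop(2) by simp
  then have cc: "comps c = ys @ b # vs2" using r(1) by simp
  show ?case
  proof (rule returnsI, goal_cases)
    case (1 ys' x vs')
    then have e: "ys @ b # vs = ys' @ x # vs'" by simp
    have l2: "length vs' + Suc d = n" using n(1) 1(2) unfolding e by simp
    obtain f where f: "\<forall>v. ys @ b # v = ys' @ x # f v" "f vs = vs'"
       "\<forall>\<pi>\<in>paths (Node x). \<exists>i \<rho>. i # \<rho> \<in> paths (Node (b @ [?t])) \<and> i \<noteq> length b + 2 \<and>
          (\<forall>v. toppath (f v) @ \<pi> = toppath v @ i # \<rho>)"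
    proof -
      have "length ys' \<le> length ys" using 1(2) push_pop(2,3) by simp
      from split_above[OF e this, of g] show ?thesis using that by (elim exE conjE)
    qed
    have fl: "length (f vs2) = length vs'" 
      using arg_cong[OF spec[OF f(1), of vs2], of length] arg_cong[OF e, of length] r(3) by simp
    have "comps (hd (c # Q)) = ys' @ x # f vs2" using f(1) cc by simp
    then obtain zs' vs3 where r': "comps (last (c # Q)) = zs' @ vs3" "length zs' = Suc d" "length vs3 = length (f vs2)"
      "stk (symb (last (c # Q))) zs' = Node x"
      and r2': "\<forall>\<pi>\<in>paths (Node x). trace (c # Q) (toppath vs3 @ \<pi>) = toppath (f vs2) @ \<pi> \<and>
        avoids (Suc (length (f vs2))) (c # Q) (toppath vs3 @ \<pi>)"
      using returnsD[OF R2 _ 1(2)] by blast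
    \<comment> \<open>The first return avoids topmost j-stacks; as d \<le> j it also avoids the
      smaller topmost d-stacks.\<close>
    have le: "Suc (length vs) \<le> Suc (length vs')" using l2 n(1) push_pop(2,3) by simp
    have main: "trace ((q, g, ys @ b # vs) # P @ c # Q) (toppath vs3 @ \<pi>) = toppath vs' @ \<pi> \<and>
      avoids (Suc (length vs')) ((q, g, ys @ b # vs) # P @ c # Q) (toppath vs3 @ \<pi>)" 
      if pi: "\<pi> \<in> paths (Node x)" for \<pi>
    proof -
      obtain i \<rho> where p: "i # \<rho> \<in> paths (Node (b @ [?t]))" "i \<noteq> length b + 2"
        "\<forall>v. toppath (f v) @ \<pi> = toppath v @ i # \<rho>"
        using bspec[OF f(3) pi] by blast
      have "comps_ok (ys @ (b @ [?t]) # vs)" using ok1 ce by (simp add: flat_ok_def)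
      from paths_comp_length[OF this p(1)] have pl: "length \<rho> = j" using push_pop(2) by simp
      have t0: "trace (c # Q) (toppath vs3 @ \<pi>) = toppath vs2 @ i # \<rho>"
        using bspec[OF r2' pi] p(3) by simp
      have t1: "trace (P @ c # Q) (toppath vs3 @ \<pi>) = toppath vs @ i # \<rho>"
        unfolding trace_append[of P c Q] t0 using bspec[OF r2 p(1)] by simp
      have t2: "hist1 (q, g, ys @ b # vs) e (toppath vs @ i # \<rho>) = toppath vs @ i # \<rho>"
        using hist1_push_below[OF push_pop(1,2) n(1) pl p(2), of ?t] push_pop(5) P by simp
      have t3: "trace ((q, g, ys @ b # vs) # P @ c # Q) (toppath vs3 @ \<pi>) = toppath vs' @ \<pi>"
        using t1 t2 spec[OF p(3), of vs] f(2) P by simp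
      have "avoids (Suc (length vs)) (P @ [c]) (toppath vs2 @ i # \<rho>)" using bspec[OF r2 p(1)] by simp
      then have "avoids (Suc (length vs')) (P @ [c]) (toppath vs2 @ i # \<rho>)"
        using le by (rule avoids_mono)
      moreover have "avoids (Suc (length vs')) (c # Q) (toppath vs3 @ \<pi>)"
        using bspec[OF r2' pi] fl by simp
      ultimately have "avoids (Suc (length vs')) (P @ c # Q) (toppath vs3 @ \<pi>)"
        unfolding avoids_append[of _ P c Q] t0 by simp
      moreover have "take (Suc (length vs')) (toppath vs' @ \<pi>) \<noteq> take (Suc (length vs')) (topc (q, g, ys @ b # vs))"
        unfolding top_simps e using not_top_prefix[OF pi] .
      ultimately show ?thesis using t3 P by simp
    qed
    have "last ((q, g, ys @ b # vs) # P @ c # Q) = last (c # Q)" by simp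
    then show ?case using r' fl main by (intro exI[of _ zs'] exI[of _ vs3]) (simp del: last.simps paths.simps)
  qed
qed

text \<open>Reads \<open>returns\<close> backwards: a leaf of the topmost (d+1)-stack after the
  return has a relative path in \<open>Node x\<close>, which determines its history through the
  return.\<close>

lemma return_position:
  assumes "frun (P1 @ c # P2)" "ret (P1 @ [c]) (length ys)" "comps (hd (P1 @ [c])) = ys @ x # vs"
    "t \<in> leafpaths (last (c # P2))"
    "take (length vs) (trace (c # P2) t) = take (length vs) (topc c)"
  shows "\<exists>zs vs' \<pi>. comps c = zs @ vs' \<and> length zs = Suc (length ys) \<and> length vs' = length vs \<and>
    stk (symb c) zs = Node x \<and> \<pi> \<in> paths (Node x) \<and>
    trace (c # P2) t = toppath vs' @ \<pi> \<and> trace (P1 @ c # P2) t = toppath vs @ \<pi>"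
proof -
  have f: "frun (P1 @ [c])" "frun (c # P2)" using assms(1) frun_append[of P1] by blast+
  have "flat_ok (hd (P1 @ [c]))" using f(1) unfolding frun_def by blast
  then have "returns (P1 @ [c]) (length ys)" using ret_returns assms(2) by blast
  from returnsD[OF this assms(3) refl] obtain zs vs' where
    r: "comps (last (P1 @ [c])) = zs @ vs'" "length zs = Suc (length ys)" "length vs' = length vs"
      "stk (symb (last (P1 @ [c]))) zs = Node x"
    and r2: "\<forall>\<pi>\<in>paths (Node x). trace (P1 @ [c]) (toppath vs' @ \<pi>) = toppath vs @ \<pi>" by blast
  have c: "comps c = zs @ vs'" "stk (symb c) zs = Node x" using r by simp_all
  have "trace (c # P2) t \<in> leafpaths c" using trace_leafpaths[OF f(2) assms(4)] by simp
  then have "trace (c # P2) t \<in> paths (plug (Node x) vs')" using c by (simp add: leafpaths_def)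
  moreover have "take (length vs') (topc c) = toppath vs'" using c(1) by (simp add: topc_def)
  then have "take (length vs') (trace (c # P2) t) = toppath vs'" using assms(5) r(3) by simp
  then have "trace (c # P2) t \<notin> outer vs'" using outer_not_prefix by blast
  ultimately obtain \<pi> where pi: "\<pi> \<in> paths (Node x)" "trace (c # P2) t = toppath vs' @ \<pi>"
    unfolding paths_plug by blast
  have "trace (P1 @ c # P2) t = toppath vs @ \<pi>"
    unfolding trace_append[of P1 c P2] pi(2) using r2 pi(1) by blast
  then show ?thesis using c r(2,3) pi by blast
qed

text \<open>The induction is on the length because the case of a leaf below a pushed copy uses the
  hypothesis twice: for the return to the component just pushed on, and for the rest of the run from
  the restored old top.\<close>

lemma return_exists:
  assumes "frun P" "comps (hd P) = ys @ x # vs" "\<pi> \<in> paths (Node x)"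
    "trace P (topc (last P)) = toppath vs @ \<pi>"
  shows "\<exists>P1 c P2. P = P1 @ c # P2 \<and> ret (P1 @ [c]) (length ys) \<and>
    take (length vs) (trace (c # P2) (topc (last P))) = take (length vs) (topc c)"
  using assms
proof (induction "length P" arbitrary: P ys x vs \<pi> rule: less_induct)
  case less
  obtain i \<rho> where i: "\<pi> = Suc i # \<rho>" "i < length x" using paths_Node_Cons[OF less(4)] by blast
  obtain c P0 where P0: "P = c # P0" using less(2) by (cases P) (simp_all add: frun_def)
  have "P0 \<noteq> []"
  proof
    assume "P0 = []"
    then have "toppath (ys @ x # vs) = toppath vs @ \<pi>" using less(3,5) P0 by (simp add: topc_def)
    then show False using i by simp
  qed
  then obtain c1 P2 where P: "P = c # c1 # P2" using P0 by (cases P0) auto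
  let ?t = "topc (last P)"
  have s: "fstep c c1" "flat_ok c" and f1: "frun (c1 # P2)" using less(2) by (simp_all add: P frun_Cons)
  have ok1: "flat_ok c1" using s fstep_ok by blast
  have l1: "last P = last (c1 # P2)" by (simp add: P)
  have t1: "?t \<in> leafpaths (last (c1 # P2))" unfolding l1 by (rule top_leafpath)
  have cc: "comps c = ys @ x # vs" using less(3) by (simp add: P)
  have n: "length (ys @ x # vs) = n" "comps_ok (ys @ x # vs)" using s(2) cc by (simp_all add: flat_ok_def)
  define p1 where "p1 = trace (c1 # P2) ?t"
  have p1: "p1 \<in> leafpaths c1" "length p1 = n"
    using trace_leafpaths[OF f1 t1] trace_length[OF f1 t1] by (simp_all add: p1_def)
  have p: "hist1 c c1 p1 = toppath vs @ \<pi>" using less(5) by (simp add: P p1_def)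
  have step: "\<exists>Q1 c' Q2. c1 # P2 = Q1 @ c' # Q2 \<and> ret (Q1 @ [c']) (length ys1) \<and>
      take (length vs1) (trace (c' # Q2) ?t) = take (length vs1) (topc c')"
    if "comps c1 = ys1 @ y # vs1" "\<rho> \<in> paths (Node y)" "p1 = toppath vs1 @ \<rho>" for ys1 y vs1 \<rho>
    using less(1)[of "c1 # P2" ys1 y vs1 \<rho>] that f1 by (simp add: P p1_def)
  have fin: ?case if "ret (Q1 @ [c']) (length ys1) \<Longrightarrow> ret (c # Q1 @ [c']) (length ys)"
      "ret (Q1 @ [c']) (length ys1)" "c1 # P2 = Q1 @ c' # Q2"
      "take (length vs) (trace (c' # Q2) ?t) = take (length vs) (topc c')" for Q1 c' Q2 ys1
    using that by (intro exI[of _ "c # Q1"] exI[of _ c'] exI[of _ Q2]) (simp add: P)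
  have hdQ: "hd (Q1 @ [c']) = c1" if "c1 # P2 = Q1 @ c' # Q2" for Q1 c' Q2
    using that by (cases Q1) auto
  from s(1) show ?case
  proof cases
    case (read q g f xs a)
    have "comps c1 = ys @ x # vs" "p1 = toppath vs @ \<pi>"
      using cc p read by (simp_all add: hist1_simps)
    from step[OF this(1) less(4) this(2)] obtain Q1 c' Q2 where
      Q: "c1 # P2 = Q1 @ c' # Q2" "ret (Q1 @ [c']) (length ys)"
        "take (length vs) (trace (c' # Q2) ?t) = take (length vs) (topc c')" by blast
    have "ret (c # Q1 @ [c']) (length ys)" unfolding read(1)
      by (rule ret.read[OF read(3) Q(2)]) (use hdQ[OF Q(1)] read(2) in simp)
    then show ?thesis using fin Q by blast
  next
    case (pop q g q' j ys0 zs0 b g' vs0)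
    let ?B = "b @ [stk g' zs0]"
    have e: "ys0 @ ?B # vs0 = ys @ x # vs" using cc pop(1) by simp
    have pp: "p1 = toppath vs @ \<pi>" using p pop(1,3) by (simp add: hist1_simps)
    consider "j < length ys" | "j = length ys" | "length ys < j" by linarith
    then show ?thesis
    proof cases
      case 1
      then obtain ys1 where y: "ys = ys0 @ ?B # ys1" "vs0 = ys1 @ x # vs"
        using split_less[OF e] pop(4) by metis
      have "comps c1 = (zs0 @ b # ys1) @ x # vs" using pop(2) y by simp
      from step[OF this less(4) pp] obtain Q1 c' Q2 where
        Q: "c1 # P2 = Q1 @ c' # Q2" "ret (Q1 @ [c']) (length (zs0 @ b # ys1))"
          "take (length vs) (trace (c' # Q2) ?t) = take (length vs) (topc c')" by blast
      have l: "length (zs0 @ b # ys1) = length ys" using y pop(4,5) by simp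
      have "ret (c # Q1 @ [c']) (length ys)" unfolding pop(1)
        by (rule ret.pop[OF pop(3,4,5) 1 Q(2)[unfolded l]]) (use hdQ[OF Q(1)] pop(2) in simp)
      then show ?thesis using fin Q by blast
    next
      case 2
      then have y: "ys = ys0" "x = ?B" "vs = vs0" using e pop(4) by simp_all
      have "ret [c, c1] (length ys)" unfolding pop(1,2) using pop(3) 2
        by (intro ret.pop_last) (simp_all add: pop(4,5))
      moreover have "take (length vs) (trace (c1 # P2) ?t) = take (length vs) (topc c1)"
        using pp pop(2) y unfolding p1_def[symmetric] by simp
      ultimately show ?thesis by (intro exI[of _ "[c]"] exI[of _ c1] exI[of _ P2]) (simp add: P)
    next
      case 3
      then obtain ys1 where y: "ys0 = ys @ x # ys1" "vs = ys1 @ ?B # vs0"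
        using split_less[OF e[symmetric]] pop(4) by metis
      \<comment> \<open>A pop of order j+1 discards the topmost j-stack and component
        \<open>x\<close> within it. The path would use the index of the discarded stack, which no
        longer exists.\<close>
      have "p1 = toppath vs0 @ Suc (length ?B) # toppath ys1 @ \<pi>" using pp y by simp
      moreover have "stk g' (zs0 @ b # vs0) = plug (Node ?B) vs0" by simp
      then have "p1 \<in> outer vs0 \<union> (\<lambda>p. toppath vs0 @ p) ` paths (Node ?B)"
        using p1(1) pop(2) paths_plug[of "Node ?B" vs0] by (simp add: leafpaths_def)
      ultimately have "Suc (length ?B) # toppath ys1 @ \<pi> \<in> paths (Node ?B)"
        using outer_not_prefix[of p1 vs0] by auto
      from paths_Node_Cons[OF this] show ?thesis by auto
    qed
  next
    case (push q g q' j g' ys0 b vs0)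
    let ?T = "stk g ys0"
    have e: "ys0 @ b # vs0 = ys @ x # vs" using cc push(1) by simp
    have n0: "length (ys0 @ b # vs0) = n" using n(1) e by simp
    have nj: "n - j = Suc (length vs0)" using n0 push(4) by simp
    show ?thesis
    proof (cases "take (n - j) p1 = toppath vs0 @ [length b + 2]")
      case True
      then have h: "toppath vs @ \<pi> = toppath vs0 @ Suc (length b) # drop (n - j) p1"
        using hist1_push[OF push(3,4) n0 p1(2), of ?T] p push(1,2) by simp
      \<comment> \<open>The history of a leaf of the copy lies in the old topmost j-stack, hence in
        no component of index j or more.\<close>
      have "length ys < j"
      proof (rule ccontr)
        assume "\<not> length ys < j"
        then have le: "length ys0 \<le> length ys" using push(4) by simp
        have "take (Suc (length vs)) (toppath vs0 @ Suc (length b) # R) =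
           take (Suc (length vs)) (toppath (ys @ x # vs))" for R
        proof (cases "length ys0 = length ys")
          case True
          then show ?thesis using e by simp
        next
          case False
          then have "length ys0 < length ys" using le by simp
          then obtain ys1 where "vs0 = ys1 @ x # vs" using split_less[OF e] by metis
          then show ?thesis by simp
        qed
        then show False using not_top_prefix[OF less(4), of vs ys] unfolding h by metis
      qed
      then obtain ys1 where y: "ys0 = ys @ x # ys1" "vs = ys1 @ b # vs0"
        using split_less[OF e[symmetric]] push(4) by metis
      then have "drop (n - j) p1 = toppath ys1 @ \<pi>" using h by simp
      then have "p1 = (toppath vs0 @ [length b + 2]) @ toppath ys1 @ \<pi>"
        using True by (metis append_take_drop_id)
      then have pp: "p1 = toppath (ys1 @ (b @ [?T]) # vs0) @ \<pi>" by simp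
      have "comps c1 = ys @ x # (ys1 @ (b @ [?T]) # vs0)" using push(2) y by simp
      from step[OF this less(4) pp] obtain Q1 c' Q2 where
        Q: "c1 # P2 = Q1 @ c' # Q2" "ret (Q1 @ [c']) (length ys)"
          "take (length vs) (trace (c' # Q2) ?t) = take (length vs) (topc c')" using y by auto
      have "ret (c # Q1 @ [c']) (length ys)" unfolding push(1)
        by (rule ret.push[OF push(3,4) _ Q(2)]) (use hdQ[OF Q(1)] push(2) \<open>length ys < j\<close> in simp_all)
      then show ?thesis using fin Q by blast
    next
      case False
      then have pp: "p1 = toppath vs @ \<pi>"
        using hist1_push[OF push(3,4) n0 p1(2), of ?T] p push(1,2) by simp
      show ?thesis
      proof (cases "j < length ys")
        case True
        then obtain ys1 where y: "ys = ys0 @ b # ys1" "vs0 = ys1 @ x # vs"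
          using split_less[OF e] push(4) by metis
        have "comps c1 = (ys0 @ (b @ [?T]) # ys1) @ x # vs" using push(2) y by simp
        from step[OF this less(4) pp] obtain Q1 c' Q2 where
          Q: "c1 # P2 = Q1 @ c' # Q2" "ret (Q1 @ [c']) (length ys)"
            "take (length vs) (trace (c' # Q2) ?t) = take (length vs) (topc c')" using y by auto
        have "ret (c # Q1 @ [c']) (length ys)" unfolding push(1)
          by (rule ret.push[OF push(3,4) _ Q(2)]) (use hdQ[OF Q(1)] push(2) True in simp_all)
        then show ?thesis using fin Q by blast
      next
        case le: False
        \<comment> \<open>The leaf lies below the copy, so the stack below the copy has to be
          exposed before component \<open>x\<close> can be.\<close>
        then have "length ys \<le> length ys0" using push(4) by simp
        from split_above[OF e this, of g] obtain us where us:
          "\<forall>v. ys0 @ b # v = ys @ x # us v" "us vs0 = vs"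
          "\<forall>\<pi>\<in>paths (Node x). \<exists>i \<rho>. i # \<rho> \<in> paths (Node (b @ [?T])) \<and>
            i \<noteq> length b + 2 \<and> (\<forall>v. toppath (us v) @ \<pi> = toppath v @ i # \<rho>)"
          by (elim exE conjE)
        obtain m \<sigma> where m: "m # \<sigma> \<in> paths (Node (b @ [?T]))"
            "\<forall>v. toppath (us v) @ \<pi> = toppath v @ m # \<sigma>"
          using bspec[OF us(3) less(4)] by blast
        have c1: "comps c1 = ys0 @ (b @ [?T]) # vs0" using push(2) by simp
        have "p1 = toppath vs0 @ m # \<sigma>" using pp m(2) us(2) by metis
        from step[OF c1 m(1) this] obtain Q1 c' Q2 where
          Q: "c1 # P2 = Q1 @ c' # Q2" "ret (Q1 @ [c']) (length ys0)"
            "take (length vs0) (trace (c' # Q2) ?t) = take (length vs0) (topc c')" by blast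
        have f2: "frun (Q1 @ c' # Q2)" using f1 Q(1) by simp
        then have f3: "frun (c' # Q2)" using frun_append by blast
        have l2: "last P = last (c' # Q2)" using l1 Q(1) by simp
        have t2: "?t \<in> leafpaths (last (c' # Q2))" unfolding l2 by (rule top_leafpath)
        have c1': "comps (hd (Q1 @ [c'])) = ys0 @ (b @ [?T]) # vs0" using c1 hdQ[OF Q(1)] by simp
        from return_position[OF f2 Q(2) c1' t2 Q(3)] obtain zs vs' \<pi>' where
          r: "comps c' = zs @ vs'" "length zs = Suc (length ys0)" "length vs' = length vs0"
            "stk (symb c') zs = Node (b @ [?T])" "\<pi>' \<in> paths (Node (b @ [?T]))"
            "trace (c' # Q2) ?t = toppath vs' @ \<pi>'" "trace (Q1 @ c' # Q2) ?t = toppath vs0 @ \<pi>'"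
          by (elim exE conjE)
        have "toppath vs0 @ \<pi>' = toppath vs0 @ m # \<sigma>"
          using r(7) \<open>p1 = toppath vs0 @ m # \<sigma>\<close> Q(1) by (simp add: p1_def)
        then have pi': "\<pi>' = m # \<sigma>" by simp
        have "zs = ys0 @ [b] \<and> symb c' = g"
          using r(2,4) plug_inject[of zs "ys0 @ [b]" "symb c'" g] by simp
        then have c': "comps c' = ys @ x # us vs'" using r(1) spec[OF us(1), of vs'] by simp
        have tr: "trace (c' # Q2) (topc (last (c' # Q2))) = toppath (us vs') @ \<pi>"
          using r(6) m(2) pi' l2 by simp
        have Q1ne: "Q1 \<noteq> []" using ret_Cons2[OF Q(2)] by auto
        have less2: "length (c' # Q2) < length P" 
          using arg_cong[OF Q(1), of length] by (simp add: P)
        have "comps (hd (c' # Q2)) = ys @ x # us vs'" using c' by simp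
        from less(1)[OF less2 f3 this less(4) tr] obtain R1 d R2 where
          R: "c' # Q2 = R1 @ d # R2" "ret (R1 @ [d]) (length ys)" 
            "take (length (us vs')) (trace (d # R2) (topc (last (c' # Q2)))) = take (length (us vs')) (topc d)"
          by blast
        have ul: "length (us vs') = length vs" 
          using c' flat_ok_def[of c'] frun_all_ok[OF f3, of c'] n(1) by simp
        obtain R1' where R1': "R1 = c' # R1'" using ret_Cons2[OF R(2)] R(1) by (cases R1) auto
        have "ret ((q, g, ys0 @ b # vs0) # Q1 @ c' # (R1' @ [d])) (length ys)"
        proof (rule ret.push_pop[OF push(3,4)])
          show "length ys \<le> j" using le by simp
          show "ret (Q1 @ [c']) j" using Q(2) push(4) by simp
          show "hd (Q1 @ [c']) = (q', g', ys0 @ (b @ [?T]) # vs0)" using hdQ[OF Q(1)] push(2) by simp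
          show "ret (c' # R1' @ [d]) (length ys)" using R(2) R1' by simp
        qed
        moreover have "P = (c # Q1 @ R1) @ d # R2" using P Q(1) R(1) by simp
        ultimately show ?thesis using R(3) ul l2 push(1) R1'
          by (intro exI[of _ "c # Q1 @ R1"] exI[of _ d] exI[of _ R2]) simp
      qed
    qed
  qed
qed

end

section \<open>Types\<close>

text \<open>In \<open>Tok As q d Ds q' m\<close> the list \<open>As\<close> constrains the components above the level of the typed
  stack, lowest level first, and \<open>d\<close> is an index into it; \<open>Ds\<close> constrains the components beyond \<open>d\<close>
  after the return. \<open>Ne\<close> marks nonempty components: a pop must not empty a stack.\<close>

datatype ('q, 'm) tok = Ne | Tok "('q, 'm) tok fset list" 'q nat "('q, 'm) tok fset list" 'q 'm

text \<open>\<open>N\<close> is the number of components in the context, that is n-k-1 for the type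
  of component k. Tokens in \<open>As ! i\<close> see only the components after that one, and this
  decrease bounds the nesting.\<close>

inductive okt :: "nat \<Rightarrow> ('q, 'm) tok \<Rightarrow> bool" where
  okt_Ne: "okt N Ne"
| okt_Tok: "length As = N \<Longrightarrow> (\<forall>i<N. \<forall>\<tau>. \<tau> |\<in>| As ! i \<longrightarrow> okt (N - Suc i) \<tau>) \<Longrightarrow> d < N \<Longrightarrow>
    length Ds = N - Suc d \<Longrightarrow> (\<forall>i<N - Suc d. \<forall>\<tau>. \<tau> |\<in>| Ds ! i \<longrightarrow> okt (N - Suc d - Suc i) \<tau>) \<Longrightarrow>
    okt N (Tok As q d Ds q' m)"

definition okl :: "nat \<Rightarrow> ('q, 'm) tok fset list \<Rightarrow> bool" where
  "okl N As \<longleftrightarrow> length As = N \<and> (\<forall>i<N. \<forall>\<tau>. \<tau> |\<in>| As ! i \<longrightarrow> okt (N - Suc i) \<tau>)"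

lemma okt_Tok_iff:
  "okt N (Tok As q d Ds q' m) \<longleftrightarrow> okl N As \<and> d < N \<and> okl (N - Suc d) Ds"
  by (auto simp: okl_def elim: okt.cases intro: okt_Tok)

lemma okl_append: 
  assumes "okl N (As @ Cs)" shows "okl (N - length As) Cs"
proof -
  have "okt (N - length As - Suc i) \<tau>" if "i < N - length As" "\<tau> |\<in>| Cs ! i" for i \<tau>
  proof -
    have "length As + i < N" "\<tau> |\<in>| (As @ Cs) ! (length As + i)" using that by simp_all
    then have "okt (N - Suc (length As + i)) \<tau>" using assms unfolding okl_def by blast
    then show ?thesis by simp
  qed
  moreover have "length Cs = N - length As" using assms unfolding okl_def by auto
  ultimately show ?thesis by (simp add: okl_def)
qed

lemma finite_fset_subsets: "finite S \<Longrightarrow> finite {A. fset A \<subseteq> S}"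
proof -
  assume "finite S"
  then have "finite (fset -` Pow S)" by (intro finite_vimageI) (auto simp: inj_def fset_inject)
  moreover have "fset -` Pow S = {A. fset A \<subseteq> S}" by auto
  ultimately show ?thesis by simp
qed

text \<open>Lists for N contain only tokens for smaller numbers, and tokens for N are built from
  lists for N or fewer components, states, an index and a monoid element; strong induction on N
  gives both claims.\<close>

lemma finite_okt: "finite {\<tau> :: ('q::finite, 'm::finite) tok. okt N \<tau>}"
  and finite_okl: "finite {As :: ('q::finite, 'm::finite) tok fset list. okl N As}"
proof -
  let ?T = "\<lambda>N. {\<tau> :: ('q::finite, 'm::finite) tok. okt N \<tau>}"
  let ?L = "\<lambda>N. {As :: ('q::finite, 'm::finite) tok fset list. okl N As}"
  have L: "finite (?L N)" if "\<And>M. M < N \<Longrightarrow> finite (?T M)" for N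
  proof -
    let ?S = "\<Union>i<N. {A. fset A \<subseteq> ?T (N - Suc i)}"
    have "finite ?S" using that by (intro finite_UN_I finite_fset_subsets) auto
    then have "finite {As. set As \<subseteq> ?S \<and> length As = N}" by (rule finite_lists_length_eq)
    moreover have "?L N \<subseteq> {As. set As \<subseteq> ?S \<and> length As = N}"
      by (fastforce simp: okl_def in_set_conv_nth)
    ultimately show ?thesis by (rule finite_subset[rotated])
  qed
  have T: "finite (?T N)" for N
  proof (induction N rule: less_induct)
    case (less N)
    have fl: "finite (?L M)" if "M \<le> N" for M using less that by (intro L) auto
    let ?X = "?L N \<times> (UNIV :: 'q set) \<times> {..<N} \<times> (\<Union>d<N. ?L (N - Suc d)) \<times> (UNIV :: 'q set) \<times> (UNIV :: 'm set)"
    have "finite ?X" using fl by (intro finite_cartesian_product finite_UN_I) auto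
    then have "finite (insert Ne ((\<lambda>(As, q, d, Ds, q', m). Tok As q d Ds q' m) ` ?X))" by simp
    moreover have "?T N \<subseteq> insert Ne ((\<lambda>(As, q, d, Ds, q', m). Tok As q d Ds q' m) ` ?X)"
    proof
      fix \<tau> :: "('q, 'm) tok" assume t: "\<tau> \<in> ?T N"
      show "\<tau> \<in> insert Ne ((\<lambda>(As, q, d, Ds, q', m). Tok As q d Ds q' m) ` ?X)"
      proof (cases \<tau>)
        case (Tok As q d Ds q' m)
        then have "(As, q, d, Ds, q', m) \<in> ?X" using t by (auto simp: okt_Tok_iff)
        then show ?thesis unfolding Tok by (intro insertI2 image_eqI[of _ _ "(As, q, d, Ds, q', m)"]) auto
      qed simp
    qed
    ultimately show ?case by (rule finite_subset[rotated])
  qed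
  show "finite (?T N)" by (rule T)
  show "finite (?L N)" using T by (intro L)
qed

lemma run_word_single [simp]: "run_word \<delta> [c] = []"
  by (simp add: run_word_def)

lemma run_word_Cons: "run_word \<delta> (c # c' # R) = step_letters \<delta> c c' @ run_word \<delta> (c' # R)"
proof -
  have "[0..<Suc (length R)] = 0 # map Suc [0..<length R]"
    by (simp add: map_Suc_upt upt_conv_Cons del: upt_Suc)
  then show ?thesis by (simp add: run_word_def o_def del: upt_Suc)
qed

lemma run_word_append:
  "run_word \<delta> (P @ c # Q) = run_word \<delta> (P @ [c]) @ run_word \<delta> (c # Q)"
proof (induction P)
  case (Cons d P)
  then show ?case by (cases P) (simp_all add: run_word_Cons)
qed simp

lemma step_letters_read:
  "\<delta> q g = Read f \<Longrightarrow> inj f \<Longrightarrow> step_letters \<delta> (conf (q, g, xs)) (conf (f a, g', ys)) = [a]"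
  unfolding step_letters_def by (simp add: conf_def topsym_plug inj_eq)

lemma step_letters_op:
  "\<delta> q g = Op q' op \<Longrightarrow> step_letters \<delta> (conf (q, g, xs)) c = []"
  unfolding step_letters_def by (simp add: conf_def topsym_plug)

section \<open>Derivable tokens and the types of stacks\<close>

locale dpda_monoid = dpda n \<delta>
  for n :: nat and \<delta> :: "'q \<Rightarrow> 'g \<Rightarrow> ('q, 'a, 'g) transition" +
  fixes \<phi> :: "'a list \<Rightarrow> 'm::monoid_mult"
  assumes mor: "monoid_morphism \<phi>"
begin

definition val :: "('q, 'g) flat list \<Rightarrow> 'm" where
  "val P = \<phi> (run_word \<delta> (map conf P))"

lemma phi_Nil [simp]: "\<phi> [] = 1" and phi_append: "\<phi> (u @ v) = \<phi> u * \<phi> v"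
  using mor by (simp_all add: monoid_morphism_def)

lemma val_single [simp]: "val [c] = 1" by (simp add: val_def)

lemma val_append: "val (P @ c # Q) = val (P @ [c]) * val (c # Q)"
  using run_word_append[of \<delta> "map conf P" "conf c" "map conf Q"] by (simp add: val_def phi_append)

lemma val_read: 
  assumes "\<delta> q g = Read f" "hd P = (f a, g', ys)" "P \<noteq> []"
  shows "val ((q, g, xs) # P) = \<phi> [a] * val P"
proof -
  obtain Q where P: "P = (f a, g', ys) # Q" using assms by (cases P) auto
  then show ?thesis using step_letters_read[of \<delta> q g f xs a g' ys, OF assms(1) readD[OF assms(1)]]
    by (simp add: val_def run_word_Cons phi_append[symmetric])
qed

lemma val_op: 
  assumes "\<delta> q g = Op q' op" "P \<noteq> []"
  shows "val ((q, g, xs) # P) = val P"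
proof -
  obtain c Q where P: "P = c # Q" using assms by (cases P) auto
  then show ?thesis using step_letters_op[of \<delta>, OF assms(1)]
    by (simp add: val_def run_word_Cons)
qed

text \<open>\<open>B\<close> is a guess for the type of the component that a push enlarges. The last
  stack of this component is the old top together with its components, so every token of
  \<open>B\<close> must be derivable from the first j+1 types; \<open>As'\<close> permits using only
  a part of them. The parameter \<open>P\<close> is instantiated with \<open>T\<close>, whose push
  rules need this condition recursively.\<close>

abbreviation pushed where
  "pushed P g As j B \<equiv> \<forall>\<tau>. \<tau> |\<in>| B \<longrightarrow> \<tau> = Ne \<or> (\<exists>Cs q2 d2 Ds2 q3 m3 As'. \<tau> = Tok Cs q2 d2 Ds2 q3 m3 \<and>
     list_all2 (|\<subseteq>|) As' (take (Suc j) As) \<and> P g (As' @ Cs) q2 (Suc j + d2) Ds2 q3 m3)"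

text \<open>The rules follow those of \<open>ret\<close>, with types in place of stacks.
  \<open>As\<close> has an entry for each of the n components, all of which form the context of a
  single symbol. In \<open>T_push_pop\<close> the first return restores the old top, so the first
  j+1 types are again those of \<open>As\<close>, and only the types \<open>Es\<close> beyond them
  are new.\<close>

inductive T :: "'g \<Rightarrow> ('q, 'm) tok fset list \<Rightarrow> 'q \<Rightarrow> nat \<Rightarrow> ('q, 'm) tok fset list \<Rightarrow> 'q \<Rightarrow> 'm \<Rightarrow> bool"
where
  T_read: "\<delta> q g = Read f \<Longrightarrow> T g As (f a) d Ds q' m \<Longrightarrow> T g As q d Ds q' (\<phi> [a] * m)"
| T_pop_last: "\<delta> q g = Op q' (Pop (Suc j)) \<Longrightarrow> okl n As \<Longrightarrow> Ne |\<in>| As ! j \<Longrightarrow>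
    T g As q j (drop (Suc j) As) q' 1"
| T_pop: "\<delta> q g = Op q1 (Pop (Suc j)) \<Longrightarrow> okl n As \<Longrightarrow>
    Tok (drop (Suc j) As) q1 d Ds q' m |\<in>| As ! j \<Longrightarrow> T g As q (Suc j + d) Ds q' m"
| T_push: "\<delta> q g = Op q1 (Push (Suc j) g1) \<Longrightarrow> okl n As \<Longrightarrow>
    pushed T g As j B \<Longrightarrow>
    T g1 (As[j := B]) q1 d Ds q' m \<Longrightarrow> d \<noteq> j \<Longrightarrow> T g As q d Ds q' m"
| T_push_pop: "\<delta> q g = Op q1 (Push (Suc j) g1) \<Longrightarrow> okl n As \<Longrightarrow>
    pushed T g As j B \<Longrightarrow>
    T g1 (As[j := B]) q1 j Es q2 m1 \<Longrightarrow> T g (take (Suc j) As @ Es) q2 d Ds q' m2 \<Longrightarrow> d \<le> j \<Longrightarrow>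
    T g As q d Ds q' (m1 * m2)"

text \<open>Application as in intersection type systems: \<open>A0\<close> is the hypothesis about
  the nearest component, discharged by the type \<open>A\<close> of the component being enclosed.
  Only indices \<open>Suc d\<close> survive, since a return to the enclosed component is internal to
  the new stack.\<close>

definition abst :: "('q, 'm) tok set \<Rightarrow> ('q, 'm) tok set \<Rightarrow> ('q, 'm) tok set" where
  "abst A B = {Tok Cs q d Ds q' m |Cs q d Ds q' m. \<exists>A0. fset A0 \<subseteq> A \<and> Tok (A0 # Cs) q (Suc d) Ds q' m \<in> B}"

text \<open>Folding from the left lets a stack see the stacks below it as its nearest component,
  which is \<open>tyl_snoc\<close>. The empty component gets the empty type, without
  \<open>Ne\<close>.\<close>

primrec tys :: "'g stack \<Rightarrow> ('q, 'm) tok set" where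
  "tys (Leaf g x) = {Tok As q d Ds q' m |As q d Ds q' m. T g As q d Ds q' m}"
| "tys (Node ss) = foldl (\<lambda>A B. insert Ne (abst A B)) {} (map tys ss)"

abbreviation tyl :: "'g stack list \<Rightarrow> ('q, 'm) tok set" where "tyl x \<equiv> tys (Node x)"

abbreviation fits :: "('q, 'm) tok fset list \<Rightarrow> 'g stack list list \<Rightarrow> bool" where
  "fits \<equiv> list_all2 (\<lambda>A x. fset A \<subseteq> tyl x)"

abbreviation tyle :: "'g stack list list \<Rightarrow> 'g stack list list \<Rightarrow> bool" where
  "tyle \<equiv> list_all2 (\<lambda>x y. tyl x \<subseteq> tyl y)"

lemma tyl_snoc: "tyl (b @ [t]) = insert Ne (abst (tyl b) (tys t))" by simp

lemma Ne_tyl: "Ne \<in> tyl x \<longleftrightarrow> x \<noteq> []"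
proof (cases x rule: rev_cases)
  case (snoc b t)
  then show ?thesis unfolding snoc tyl_snoc by simp
qed simp

text \<open>Collects the hypotheses of the nested \<open>abst\<close> into one list
  \<open>As\<close>, so that membership of a token becomes a statement about \<open>T\<close> at the
  top symbol.\<close>

lemma Tok_tys_plug:
  "Tok Cs q d Ds q' m \<in> tys (stk g xs) \<longleftrightarrow>
   (\<exists>As. fits As xs \<and> T g (As @ Cs) q (length xs + d) Ds q' m)"
proof (induction xs arbitrary: Cs d rule: rev_induct)
  case Nil
  then show ?case by simp
next
  case (snoc x xs)
  have "Tok Cs q d Ds q' m \<in> tys (stk g (xs @ [x])) \<longleftrightarrow>
     Tok Cs q d Ds q' m \<in> tyl (x @ [stk g xs])" by simp
  also have "\<dots> \<longleftrightarrow> (\<exists>A0. fset A0 \<subseteq> tyl x \<and> Tok (A0 # Cs) q (Suc d) Ds q' m \<in> tys (stk g xs))"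
    unfolding tyl_snoc by (simp add: abst_def)
  also have "\<dots> \<longleftrightarrow> (\<exists>A0 As. fset A0 \<subseteq> tyl x \<and> fits As xs \<and>
       T g (As @ A0 # Cs) q (length xs + Suc d) Ds q' m)"
    unfolding snoc by blast
  also have "\<dots> \<longleftrightarrow> (\<exists>As. fits As (xs @ [x]) \<and>
       T g (As @ Cs) q (length (xs @ [x]) + d) Ds q' m)"
  proof (intro iffI)
    assume "\<exists>A0 As. fset A0 \<subseteq> tyl x \<and> fits As xs \<and>
       T g (As @ A0 # Cs) q (length xs + Suc d) Ds q' m"
    then obtain A0 As where a: "fset A0 \<subseteq> tyl x" "fits As xs"
       "T g (As @ A0 # Cs) q (length xs + Suc d) Ds q' m" by blast
    have "fits (As @ [A0]) (xs @ [x])"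
      using a(1,2) by (simp add: list_all2_appendI del: tys.simps)
    then show "\<exists>As. fits As (xs @ [x]) \<and>
       T g (As @ Cs) q (length (xs @ [x]) + d) Ds q' m" using a(3)
      by (intro exI[of _ "As @ [A0]"]) (simp del: tys.simps)
  next
    assume "\<exists>As. fits As (xs @ [x]) \<and>
       T g (As @ Cs) q (length (xs @ [x]) + d) Ds q' m"
    then obtain As where a: "fits As (xs @ [x])"
       "T g (As @ Cs) q (length (xs @ [x]) + d) Ds q' m" by blast
    obtain As' A0 where As: "As = As' @ [A0]"
      using list_all2_lengthD[OF a(1)] by (cases As rule: rev_cases) simp_all
    have "length As' = length xs" using list_all2_lengthD[OF a(1)] As by simp
    then have "fits As' xs \<and> fset A0 \<subseteq> tyl x"
      using a(1) unfolding As by (simp add: list_all2_append del: tys.simps)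
    then show "\<exists>A0 As. fset A0 \<subseteq> tyl x \<and> fits As xs \<and>
       T g (As @ A0 # Cs) q (length xs + Suc d) Ds q' m"
      using a(2) As by (intro exI[of _ A0] exI[of _ As']) (simp del: tys.simps)
  qed
  finally show ?case .
qed

text \<open>Larger component types discharge the same hypotheses \<open>As\<close>.\<close>

lemma tyl_plug_mono:
  assumes "tyle (ys @ [b]) (ys' @ [b'])"
  shows "tyl (b @ [stk g ys]) \<subseteq> tyl (b' @ [stk g ys'])"
proof
  fix \<tau> assume t: "\<tau> \<in> tyl (b @ [stk g ys])"
  show "\<tau> \<in> tyl (b' @ [stk g ys'])"
  proof (cases \<tau>)
    case Ne
    then show ?thesis using Ne_tyl by blast
  next
    case (Tok Cs q d Ds q' m)
    have "\<tau> \<in> tys (stk g (ys @ [b]))" using t by simp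
    then obtain As where As: "fits As (ys @ [b])"
      "T g (As @ Cs) q (length (ys @ [b]) + d) Ds q' m" unfolding Tok Tok_tys_plug by blast
    have "fits As (ys' @ [b'])"
      by (rule list_all2_trans[OF _ As(1) assms]) blast
    moreover have "length (ys' @ [b']) = length (ys @ [b])" using list_all2_lengthD[OF assms] by simp
    ultimately have "\<tau> \<in> tys (stk g (ys' @ [b']))"
      using As(2) unfolding Tok Tok_tys_plug by metis
    then show ?thesis by simp
  qed
qed

lemma T_ok: "T g As q d Ds q' m \<Longrightarrow> okl n As \<and> d < n \<and> okl (n - Suc d) Ds"
proof (induction rule: T.induct)
  case (T_pop_last q g q' j As)
  have "j < n" using popD[OF T_pop_last(1)] by simp
  moreover have "okl (n - Suc j) (drop (Suc j) As)"
    using okl_append[of n "take (Suc j) As" "drop (Suc j) As"] T_pop_last(2) calculation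
    by (simp add: okl_def[of n])
  ultimately show ?case using T_pop_last by blast
next
  case (T_pop q g q1 j As d Ds q' m)
  have "j < n" using popD[OF T_pop(1)] by simp
  then have "okt (n - Suc j) (Tok (drop (Suc j) As) q1 d Ds q' m)"
    using T_pop(2,3) unfolding okl_def by blast
  then have "d < n - Suc j" "okl (n - Suc j - Suc d) Ds" unfolding okt_Tok_iff by blast+
  moreover have "n - Suc j - Suc d = n - Suc (Suc j + d)" by simp
  ultimately show ?case using T_pop(2) by simp
qed blast+

text \<open>Confines the type of a component to a finite set, so that it can occur inside
  tokens.\<close>

lemma okt_tyl:
  assumes "\<forall>t\<in>set x. shape k t" "\<tau> \<in> tyl x"
  shows "okt (n - Suc k) \<tau>"
proof (cases \<tau>)
  case Ne
  then show ?thesis by (simp add: okt_Ne)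
next
  case (Tok Cs q d Ds q' m)
  have "x \<noteq> []"
  proof
    assume "x = []"
    then show False using assms(2) by simp
  qed
  then obtain b t where x: "x = b @ [t]" by (cases x rule: rev_cases) simp_all
  then have "shape k t" using assms(1) by simp
  then obtain g ys where t: "t = stk g ys" "length ys = k"
    using shape_decompose by blast
  have "\<tau> \<in> tys (stk g (ys @ [b]))" using assms(2) x t by simp
  then obtain As where As: "fits As (ys @ [b])"
      "T g (As @ Cs) q (length (ys @ [b]) + d) Ds q' m" unfolding Tok Tok_tys_plug by blast
  have l: "length As = Suc k" using list_all2_lengthD[OF As(1)] t by simp
  have "okl n (As @ Cs) \<and> Suc k + d < n \<and> okl (n - Suc (Suc k + d)) Ds"
    using T_ok[OF As(2)] t by simp
  moreover have "n - Suc (Suc k + d) = n - Suc k - Suc d" by simp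
  ultimately show ?thesis unfolding Tok okt_Tok_iff using okl_append[of n As Cs] l by (simp add: less_diff_conv)
qed

end

context dpda
begin

lemma ret_component:
  assumes "ret P d" "flat_ok (hd P)" "comps (hd P) = ys @ (b @ [stk g zs]) # vs"
    "length ys = d" "length zs = d"
  shows "\<exists>vs'. comps (last P) = zs @ b # vs' \<and> symb (last P) = g \<and> length vs' = length vs"
proof -
  from returnsD[OF ret_returns[OF assms(1,2)] assms(3,4)] obtain us vs' where
    r: "comps (last P) = us @ vs'" "length us = Suc d" "length vs' = length vs"
      "stk (symb (last P)) us = Node (b @ [stk g zs])" by blast
  have "us = zs @ [b] \<and> symb (last P) = g"
    using r(2,4) plug_inject[of us "zs @ [b]" "symb (last P)" g] assms(5) by simp
  then show ?thesis using r by simp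
qed

end

section \<open>Completeness: every return is described by a derivable token\<close>

locale dpda_fin = dpda_monoid n \<delta> \<phi>
  for n :: nat and \<delta> :: "'q::finite \<Rightarrow> 'g \<Rightarrow> ('q, 'a, 'g) transition"
    and \<phi> :: "'a list \<Rightarrow> 'm::{monoid_mult, finite}"
begin

text \<open>Tokens contain finite sets, so types have to be converted; by \<open>fset_tyf\<close>
  nothing is lost for lists of stacks of one order.\<close>

definition tyf :: "'g stack list \<Rightarrow> ('q, 'm) tok fset" where
  "tyf x = Abs_fset (tyl x)"

lemma fset_tyf: "\<forall>t\<in>set x. shape k t \<Longrightarrow> fset (tyf x) = tyl x"
proof -
  assume "\<forall>t\<in>set x. shape k t"
  then have "tyl x \<subseteq> {\<tau>. okt (n - Suc k) \<tau>}" using okt_tyl by blast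
  then have "finite (tyl x)" using finite_okt finite_subset by blast
  then show ?thesis unfolding tyf_def by (simp add: Abs_fset_inverse)
qed

lemma fset_tyf_comps: "comps_ok xs \<Longrightarrow> i < length xs \<Longrightarrow> fset (tyf (xs ! i)) = tyl (xs ! i)"
  by (rule fset_tyf[of _ i]) (simp add: comps_ok_def)

lemma okl_tyf: "comps_ok xs \<Longrightarrow> length xs = n \<Longrightarrow> okl n (map tyf xs)"
  unfolding okl_def using okt_tyl fset_tyf_comps by (auto simp: comps_ok_def simp del: tys.simps)

lemma list_all2_tyf:
  assumes "fits As xs" "comps_ok xs"
  shows "list_all2 (|\<subseteq>|) As (map tyf xs)"
proof (rule list_all2_all_nthI)
  show l: "length As = length (map tyf xs)" using list_all2_lengthD[OF assms(1)] by simp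
  fix i assume i: "i < length As"
  then have "fset (As ! i) \<subseteq> fset (tyf (xs ! i))"
    using list_all2_nthD[OF assms(1) i] fset_tyf_comps[OF assms(2), of i] l by simp
  then show "As ! i |\<subseteq>| map tyf xs ! i" using i l by (simp add: less_eq_fset.rep_eq)
qed

lemma list_all2_tyf_refl:
  assumes "comps_ok xs" shows "fits (map tyf xs) xs"
  using fset_tyf_comps[OF assms] by (auto intro!: list_all2_all_nthI simp del: tys.simps)

text \<open>The guess in the push rules may be the exact type of the enlarged component: by
  \<open>Tok_tys_plug\<close> each of its tokens comes from a derivation that uses subsets of the
  present types.\<close>

lemma tyl_pushed_derivable:
  assumes "comps_ok (ys @ b # vs)" "length ys = j"
  shows "\<forall>\<tau>. \<tau> |\<in>| tyf (b @ [stk g ys]) \<longrightarrow> \<tau> = Ne \<or> (\<exists>Cs q2 d2 Ds2 q3 m3 As'. \<tau> = Tok Cs q2 d2 Ds2 q3 m3 \<and>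
       list_all2 (|\<subseteq>|) As' (take (Suc j) (map tyf (ys @ b # vs))) \<and> T g (As' @ Cs) q2 (Suc j + d2) Ds2 q3 m3)"
proof (intro allI impI)
  fix \<tau> assume "\<tau> |\<in>| tyf (b @ [stk g ys])"
  moreover have ys: "comps_ok ys" using comps_ok_appendD[OF assms(1)] .
  then have "\<forall>t\<in>set (b @ [stk g ys]). shape j t"
    using comps_okD[OF assms(1)] shape_plug[of ys g] assms(2) by auto
  ultimately have t: "\<tau> \<in> tyl (b @ [stk g ys])" using fset_tyf by blast
  show "\<tau> = Ne \<or> (\<exists>Cs q2 d2 Ds2 q3 m3 As'. \<tau> = Tok Cs q2 d2 Ds2 q3 m3 \<and>
       list_all2 (|\<subseteq>|) As' (take (Suc j) (map tyf (ys @ b # vs))) \<and> T g (As' @ Cs) q2 (Suc j + d2) Ds2 q3 m3)"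
  proof (cases \<tau>)
    case (Tok Cs q d Ds q' m)
    have "\<tau> \<in> tys (stk g (ys @ [b]))" using t by simp
    then obtain As where As: "fits As (ys @ [b])"
      "T g (As @ Cs) q (length (ys @ [b]) + d) Ds q' m" unfolding Tok Tok_tys_plug by blast
    have "comps_ok (ys @ [b])" using comps_ok_appendD[of "ys @ [b]" vs] assms(1) by simp
    then have "list_all2 (|\<subseteq>|) As (map tyf (ys @ [b]))" using list_all2_tyf[OF As(1)] by blast
    moreover have "take (Suc j) (map tyf (ys @ b # vs)) = map tyf (ys @ [b])" using assms(2) by simp
    ultimately show ?thesis using As(2) assms(2) Tok
      by (intro disjI2 exI[of _ Cs] exI[of _ q] exI[of _ d] exI[of _ Ds] exI[of _ q'] exI[of _ m] exI[of _ As]) simp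
  qed simp
qed

text \<open>The exact types serve as hypotheses. The case that explains the notion of type is
  \<open>pop\<close>: the derivation for the remaining run is abstracted to a token of the exposed
  stack, and this token is in the type of the component from which that stack came.\<close>

theorem T_complete:
  "ret P d \<Longrightarrow> flat_ok (hd P) \<Longrightarrow>
   T (symb (hd P)) (map tyf (comps (hd P))) (state (hd P)) d
     (map tyf (drop (Suc d) (comps (last P)))) (state (last P)) (val P)"
proof (induction rule: ret.induct)
  case (read q g f P d a xs)
  have ne: "P \<noteq> []" using ret_Cons2[OF read(2)] by auto
  have s: "fstep (q, g, xs) (hd P)" using read fstep.read by simp
  then have "flat_ok (hd P)" using read(5) fstep_ok by simp
  then have "T g (map tyf xs) (f a) d (map tyf (drop (Suc d) (comps (last P)))) (state (last P)) (val P)"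
    using read(3,4) by simp
  from T_read[OF read(1) this] show ?case using val_read[OF read(1,3) ne] ne by simp
next
  case (pop_last q g q' d ys zs b g' vs)
  let ?xs = "ys @ (b @ [stk g' zs]) # vs"
  have ok: "comps_ok ?xs" "length ?xs = n" using pop_last(4) by (simp_all add: flat_ok_def)
  have "fset (tyf (?xs ! d)) = tyl (?xs ! d)" using fset_tyf_comps[OF ok(1), of d] pop_last(2) by simp
  moreover have nd: "?xs ! d = b @ [stk g' zs]" "d < length ?xs"
    using pop_last(2) by auto
  ultimately have "Ne |\<in>| tyf (?xs ! d)"
    using Ne_tyl[of "?xs ! d"] by (simp only: nd) simp
  then have "Ne |\<in>| map tyf ?xs ! d" by (simp only: nth_map[OF nd(2)])
  from T_pop_last[OF pop_last(1) okl_tyf[OF ok] this] show ?case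
    using pop_last(2,3) val_op[OF pop_last(1), of "[(q', g', zs @ b # vs)]" ?xs] by simp
next
  case (pop q g q' j ys zs d P g' b vs)
  let ?xs = "ys @ (b @ [stk g' zs]) # vs"
  have ne: "P \<noteq> []" using ret_Cons2[OF pop(5)] by auto
  have s: "fstep (q, g, ?xs) (hd P)" using fstep.pop[OF pop(1-3), of b g' vs] pop(6) by simp
  have ok: "comps_ok ?xs" "length ?xs = n" using pop(8) by (simp_all add: flat_ok_def)
  have okP: "flat_ok (hd P)" using s pop(8) fstep_ok by simp
  define Ds where "Ds = map tyf (drop (Suc d) (comps (last P)))"
  obtain e where d: "d = Suc j + e" using pop(4) less_iff_Suc_add by auto
  have IH: "T g' (map tyf (zs @ b # vs)) q' d Ds (state (last P)) (val P)"
    using pop(7)[OF okP] pop(6) by (simp add: Ds_def)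
  have "comps_ok (zs @ [b])" using okP pop(6) comps_ok_appendD[of "zs @ [b]" vs] by (simp add: flat_ok_def)
  from list_all2_tyf_refl[OF this]
  have "\<exists>As. fits As (zs @ [b]) \<and> T g' (As @ map tyf vs) q' (length (zs @ [b]) + e) Ds (state (last P)) (val P)"
    using IH d pop(3) by (intro exI[of _ "map tyf (zs @ [b])"]) (simp del: tys.simps)
  then have "Tok (map tyf vs) q' e Ds (state (last P)) (val P) \<in> tys (stk g' (zs @ [b]))"
    unfolding Tok_tys_plug .
  then have "Tok (map tyf vs) q' e Ds (state (last P)) (val P) \<in> tyl (b @ [stk g' zs])" by simp
  moreover have nj: "?xs ! j = b @ [stk g' zs]" "j < length ?xs" using pop(2) by auto
  moreover have "fset (tyf (?xs ! j)) = tyl (?xs ! j)" by (rule fset_tyf_comps[OF ok(1) nj(2)])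
  ultimately have "Tok (map tyf vs) q' e Ds (state (last P)) (val P) |\<in>| map tyf ?xs ! j"
    by (simp only: nth_map[OF nj(2)])
  moreover have "map tyf vs = drop (Suc j) (map tyf ?xs)" using pop(2) by simp
  ultimately have "T g (map tyf ?xs) q (Suc j + e) Ds (state (last P)) (val P)"
    using T_pop[OF pop(1) okl_tyf[OF ok]] by metis
  then show ?case using d val_op[OF pop(1) ne, of ?xs] ne unfolding Ds_def by simp
next
  case (push q g q' j g' ys d P b vs)
  let ?xs = "ys @ b # vs" and ?X = "b @ [stk g ys]"
  have ne: "P \<noteq> []" using ret_Cons2[OF push(4)] by auto
  have s: "fstep (q, g, ?xs) (hd P)" using fstep.push[OF push(1-2), of b vs] push(5) by simp
  have ok: "comps_ok ?xs" "length ?xs = n" using push(7) by (simp_all add: flat_ok_def)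
  have "flat_ok (hd P)" using s push(7) fstep_ok by simp
  then have "T g' (map tyf (ys @ ?X # vs)) q' d (map tyf (drop (Suc d) (comps (last P)))) (state (last P)) (val P)"
    using push(5,6) by simp
  moreover have "map tyf (ys @ ?X # vs) = (map tyf ?xs)[j := tyf ?X]" using push(2) by (simp add: list_update_append)
  ultimately have "T g (map tyf ?xs) q d (map tyf (drop (Suc d) (comps (last P)))) (state (last P)) (val P)"
    using T_push[OF push(1) okl_tyf[OF ok] tyl_pushed_derivable[OF ok(1) push(2)] _ push(3)] by metis
  then show ?case using val_op[OF push(1) ne, of ?xs] ne by simp
next
  case (push_pop q g q' j g' ys d P c b vs Q)
  let ?xs = "ys @ b # vs" and ?X = "b @ [stk g ys]"
  have ne: "P \<noteq> []" using ret_Cons2[OF push_pop(4)] by auto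
  have s: "fstep (q, g, ?xs) (hd (P @ [c]))" using fstep.push[OF push_pop(1-2), of b vs] push_pop(5) by simp
  have ok: "comps_ok ?xs" "length ?xs = n" using push_pop(9) by (simp_all add: flat_ok_def)
  have ok1: "flat_ok (hd (P @ [c]))" using fstep_ok[OF s] push_pop(9) by simp
  have "frun (P @ [c])" using ret_frun push_pop(4) ok1 by blast
  then have okc: "flat_ok c" using frun_all_ok[of "P @ [c]" c] by simp
  have "comps (hd (P @ [c])) = ys @ ?X # vs" using push_pop(5) by simp
  from ret_component[OF push_pop(4) ok1 this push_pop(2,2)] obtain vs' where
    c: "comps c = ys @ b # vs'" "symb c = g" by auto
  have 1: "T g' (map tyf (ys @ ?X # vs)) q' j (map tyf vs') (state c) (val (P @ [c]))"
    using push_pop(7)[OF ok1] push_pop(5) c push_pop(2) by simp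
  have X: "map tyf (ys @ ?X # vs) = (map tyf ?xs)[j := tyf ?X]" using push_pop(2) by (simp add: list_update_append)
  have 2: "T g (take (Suc j) (map tyf ?xs) @ map tyf vs') (state c) d
     (map tyf (drop (Suc d) (comps (last (c # Q))))) (state (last (c # Q))) (val (c # Q))"
    using push_pop(8) okc c push_pop(2) by simp
  have "T g (map tyf ?xs) q d (map tyf (drop (Suc d) (comps (last (c # Q))))) (state (last (c # Q)))
     (val (P @ [c]) * val (c # Q))"
    by (rule T_push_pop[OF push_pop(1) okl_tyf[OF ok] tyl_pushed_derivable[OF ok(1) push_pop(2)]
       1[unfolded X] 2 push_pop(3)])
  moreover have "val ((q, g, ?xs) # P @ c # Q) = val (P @ [c]) * val (c # Q)"
    using val_op[OF push_pop(1), of "P @ c # Q" ?xs] val_append[of P c Q] by simp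
  moreover have "last ((q, g, ?xs) # P @ c # Q) = last (c # Q)" by simp
  ultimately show ?case by (simp del: last.simps)
qed

end

lemma nth_mid: "length ys = j \<Longrightarrow> (ys @ x # vs) ! j = x"
  by auto

section \<open>Soundness: every token of a stack is realized by a return\<close>

context dpda_monoid
begin

text \<open>Soundness needs a logical relation: the rule \<open>T_pop\<close> uses tokens of the context, about which
  induction on the derivation says nothing.\<close>

fun real :: "nat \<Rightarrow> ('q, 'm) tok \<Rightarrow> 'g stack list \<Rightarrow> bool" where
  "real N Ne x = (x \<noteq> [])"
| "real N (Tok As q d Ds q' m) x = (Tok As q d Ds q' m \<in> tyl x \<and>
    (\<forall>vs b g zs. x = b @ [stk g zs] \<longrightarrow> length zs = n - Suc N \<longrightarrow> N < n \<longrightarrow>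
       flat_ok (q, g, zs @ b # vs) \<longrightarrow>
       (\<forall>i. i < N \<longrightarrow> (\<forall>\<tau>. \<tau> |\<in>| As ! i \<longrightarrow> real (N - Suc i) \<tau> (vs ! i))) \<longrightarrow>
       (\<exists>P. ret P (n - N + d) \<and> hd P = (q, g, zs @ b # vs) \<and> state (last P) = q' \<and> val P = m \<and>
         (\<forall>i. i < N - Suc d \<longrightarrow> (\<forall>\<tau>. \<tau> |\<in>| Ds ! i \<longrightarrow>
            real (N - Suc d - Suc i) \<tau> (comps (last P) ! (n - N + Suc d + i)))))))"

declare real.simps(2) [simp del]

lemma real_tyl: "real N \<tau> x \<Longrightarrow> \<tau> \<in> tyl x"
  by (cases \<tau>) (simp_all add: Ne_tyl real.simps(2) del: tys.simps)

definition realizes :: "('q, 'm) tok fset list \<Rightarrow> 'g stack list list \<Rightarrow> nat \<Rightarrow> bool" where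
  "realizes As xs k \<longleftrightarrow> (\<forall>i<n - k. \<forall>\<tau>. \<tau> |\<in>| As ! i \<longrightarrow> real (n - k - Suc i) \<tau> (xs ! (k + i)))"

definition sound :: "'g \<Rightarrow> ('q, 'm) tok fset list \<Rightarrow> 'q \<Rightarrow> nat \<Rightarrow> ('q, 'm) tok fset list \<Rightarrow> 'q \<Rightarrow> 'm \<Rightarrow> bool"
where "sound g As q d Ds q' m \<longleftrightarrow> (\<forall>xs. flat_ok (q, g, xs) \<longrightarrow> realizes As xs 0 \<longrightarrow>
   (\<exists>P. ret P d \<and> hd P = (q, g, xs) \<and> state (last P) = q' \<and> val P = m \<and> realizes Ds (comps (last P)) (Suc d)))"

lemma soundD: "sound g As q d Ds q' m \<Longrightarrow> flat_ok (q, g, xs) \<Longrightarrow> realizes As xs 0 \<Longrightarrow>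
  \<exists>P. ret P d \<and> hd P = (q, g, xs) \<and> state (last P) = q' \<and> val P = m \<and> realizes Ds (comps (last P)) (Suc d)"
  unfolding sound_def by blast

text \<open>\<open>real\<close> counts the components of the context, as this number decreases in
  its recursion. The proofs speak of the index k of the component instead, with N = n-k-1.\<close>

lemma real_Tok_iff:
  assumes "k < n"
  shows "real (n - Suc k) (Tok As q d Ds q' m) x \<longleftrightarrow> Tok As q d Ds q' m \<in> tyl x \<and>
    (\<forall>vs b g zs. x = b @ [stk g zs] \<longrightarrow> length zs = k \<longrightarrow> flat_ok (q, g, zs @ b # vs) \<longrightarrow>
       realizes As (zs @ b # vs) (Suc k) \<longrightarrow>
       (\<exists>P. ret P (Suc k + d) \<and> hd P = (q, g, zs @ b # vs) \<and> state (last P) = q' \<and> val P = m \<and>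
         realizes Ds (comps (last P)) (Suc (Suc k + d))))"
proof -
  have a: "n - Suc (n - Suc k) = k" "n - (n - Suc k) = Suc k" "n - Suc k < n"
    "n - Suc k - Suc d = n - Suc (Suc k + d)" "Suc k + Suc d = Suc (Suc k + d)" using assms by simp_all
  have b: "(zs @ b # vs) ! (Suc k + i) = vs ! i" if "length zs = k" for zs vs :: "'g stack list list" and b i
    using that by (simp add: nth_append)
  show ?thesis unfolding real.simps(2) a realizes_def by (simp only: b simp_thms a cong: imp_cong)
qed

lemma realizesD: "realizes As xs 0 \<Longrightarrow> i < n \<Longrightarrow> \<tau> |\<in>| As ! i \<Longrightarrow> real (n - Suc i) \<tau> (xs ! i)"
  by (simp add: realizes_def)

lemma realizes_sub:
  assumes "realizes As xs 0" "list_all2 (|\<subseteq>|) As' (take k As)" "i < k" "k \<le> length As" "k \<le> n"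
    "\<tau> |\<in>| As' ! i"
  shows "real (n - Suc i) \<tau> (xs ! i)"
proof -
  have "length As' = k" using list_all2_lengthD[OF assms(2)] assms(4) by simp
  then have "As' ! i |\<subseteq>| As ! i" using list_all2_nthD[OF assms(2), of i] assms(3) by simp
  then have "\<tau> |\<in>| As ! i" using assms(6) by blast
  then show ?thesis using assms(1,3,5) unfolding realizes_def
    by (auto dest: spec[of _ i])
qed

lemma realizes_append:
  assumes "\<And>i \<tau>. i < length As' \<Longrightarrow> \<tau> |\<in>| As' ! i \<Longrightarrow> real (n - Suc i) \<tau> (xs ! i)"
    "realizes Cs xs (length As')"
  shows "realizes (As' @ Cs) xs 0"
  unfolding realizes_def
proof (intro allI impI)
  fix i \<tau> assume i: "i < n - 0" "\<tau> |\<in>| (As' @ Cs) ! i"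
  show "real (n - 0 - Suc i) \<tau> (xs ! (0 + i))"
  proof (cases "i < length As'")
    case True
    then show ?thesis using i assms(1)[of i \<tau>] by (simp add: nth_append)
  next
    case False
    then obtain e where e: "i = length As' + e" using le_iff_add by (metis not_less)
    then have "\<tau> |\<in>| Cs ! e" "e < n - length As'" using i by auto
    then have "real (n - length As' - Suc e) \<tau> (xs ! (length As' + e))"
      using assms(2) unfolding realizes_def by blast
    then show ?thesis using e by simp
  qed
qed

lemma realizes_dropI:
  assumes "realizes As xs 0" "length As = n" "\<And>i. k \<le> i \<Longrightarrow> i < n \<Longrightarrow> xs ! i = xs' ! i"
  shows "realizes (drop k As) xs' k"
  unfolding realizes_def
proof (intro allI impI)
  fix i \<tau> assume i: "i < n - k" "\<tau> |\<in>| drop k As ! i"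
  then have "k + i < n" "\<tau> |\<in>| As ! (k + i)" using assms(2) by simp_all
  then have "real (n - 0 - Suc (k + i)) \<tau> (xs ! (0 + (k + i)))" 
    using assms(1) unfolding realizes_def by (metis minus_nat.diff_0)
  then show "real (n - k - Suc i) \<tau> (xs' ! (k + i))" using assms(3)[of "k + i"] \<open>k + i < n\<close> by simp
qed

text \<open>A token of the pushed component must be realized in every later context, not only in the
  present one. Its derivation assumes types of \<open>ys\<close> and \<open>b\<close>, which stay
  realized because \<open>real\<close> speaks of a component alone, and types \<open>Cs\<close>,
  which the later context is assumed to realize.\<close>

lemma pushed_real:
  assumes ok: "flat_ok (q, g, ys @ b # vs)" and j: "length ys = j" "j < n"
    and re: "realizes As (ys @ b # vs) 0" and lAs: "length As = n"
    and t: "\<tau> = Ne \<or> (\<exists>Cs q2 d2 Ds2 q3 m3 As'. \<tau> = Tok Cs q2 d2 Ds2 q3 m3 \<and>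
       list_all2 (|\<subseteq>|) As' (take (Suc j) As) \<and> T g (As' @ Cs) q2 (Suc j + d2) Ds2 q3 m3 \<and>
       sound g (As' @ Cs) q2 (Suc j + d2) Ds2 q3 m3)"
  shows "real (n - Suc j) \<tau> (b @ [stk g ys])"
proof (cases "\<tau> = Ne")
  case False
  then obtain Cs q2 d2 Ds2 q3 m3 As' where tau: "\<tau> = Tok Cs q2 d2 Ds2 q3 m3"
    and As': "list_all2 (|\<subseteq>|) As' (take (Suc j) As)"
    and T: "T g (As' @ Cs) q2 (Suc j + d2) Ds2 q3 m3"
    and S: "sound g (As' @ Cs) q2 (Suc j + d2) Ds2 q3 m3" using t by blast
  have l: "length As' = Suc j" using list_all2_lengthD[OF As'] lAs j by simp
  have r: "real (n - Suc i) \<sigma> ((ys @ b # vs) ! i)" if "i < Suc j" "\<sigma> |\<in>| As' ! i" for i \<sigma>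
    using realizes_sub[OF re As' that(1) _ _ that(2)] j lAs by simp
  have nth: "(ys @ [b]) ! i = (ys @ b # vs') ! i" if "i < Suc j" for i vs'
    using that j(1) by (auto simp: nth_append less_Suc_eq)
  have "fits As' (ys @ [b])"
  proof (rule list_all2_all_nthI)
    fix i assume "i < length As'"
    then show "fset (As' ! i) \<subseteq> tyl ((ys @ [b]) ! i)"
      using r[of i] real_tyl nth[of i vs] l by (auto simp del: tys.simps)
  qed (use l j in simp)
  then have "\<tau> \<in> tys (stk g (ys @ [b]))" unfolding tau Tok_tys_plug using T j by auto
  then have ty: "\<tau> \<in> tyl (b @ [stk g ys])" by simp
  have "\<exists>P. ret P (Suc j + d2) \<and> hd P = (q2, g2, zs2 @ b2 # vs2) \<and> state (last P) = q3 \<and> val P = m3 \<and>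
         realizes Ds2 (comps (last P)) (Suc (Suc j + d2))"
    if a: "b @ [stk g ys] = b2 @ [stk g2 zs2]" "length zs2 = j"
       "flat_ok (q2, g2, zs2 @ b2 # vs2)" "realizes Cs (zs2 @ b2 # vs2) (Suc j)" for b2 g2 zs2 vs2
  proof -
    have e: "b2 = b" "g2 = g" "zs2 = ys" using a(1,2) plug_inject[of ys zs2 g g2] j by auto
    have "realizes (As' @ Cs) (ys @ b # vs2) 0"
    proof (rule realizes_append)
      show "realizes Cs (ys @ b # vs2) (length As')" using a(4) l e by simp
      fix i \<sigma> assume "i < length As'" "\<sigma> |\<in>| As' ! i"
      then show "real (n - Suc i) \<sigma> ((ys @ b # vs2) ! i)"
        using r[of i \<sigma>] nth[of i vs] nth[of i vs2] l by simp
    qed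
    moreover have "flat_ok (q2, g, ys @ b # vs2)" using a(3) e by simp
    ultimately show ?thesis using soundD[OF S] unfolding e by blast
  qed
  then show ?thesis unfolding tau real_Tok_iff[OF j(2)] using ty tau by blast
qed simp

lemma realizes_pushed:
  assumes ok: "flat_ok (q, g, ys @ b # vs)" and j: "length ys = j" "j < n"
    and re: "realizes As (ys @ b # vs) 0" and lAs: "length As = n"
    and B: "\<forall>\<tau>. \<tau> |\<in>| B \<longrightarrow> \<tau> = Ne \<or> (\<exists>Cs q2 d2 Ds2 q3 m3 As'. \<tau> = Tok Cs q2 d2 Ds2 q3 m3 \<and>
       list_all2 (|\<subseteq>|) As' (take (Suc j) As) \<and> T g (As' @ Cs) q2 (Suc j + d2) Ds2 q3 m3 \<and>
       sound g (As' @ Cs) q2 (Suc j + d2) Ds2 q3 m3)"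
  shows "realizes (As[j := B]) (ys @ (b @ [stk g ys]) # vs) 0"
  unfolding realizes_def
proof (intro allI impI)
  fix i \<tau> assume i: "i < n - 0" "\<tau> |\<in>| As[j := B] ! i"
  show "real (n - 0 - Suc i) \<tau> ((ys @ (b @ [stk g ys]) # vs) ! (0 + i))"
  proof (cases "i = j")
    case True
    then have "\<tau> |\<in>| B" using i lAs by simp
    then show ?thesis using pushed_real[OF ok j re lAs B[rule_format]] True nth_mid[OF j(1)] by simp
  next
    case False
    then have "(ys @ (b @ [stk g ys]) # vs) ! i = (ys @ b # vs) ! i"
      using j(1) by (simp add: nth_append nth_Cons')
    then show ?thesis using realizesD[OF re, of i \<tau>] i False by simp
  qed
qed

text \<open>The fundamental lemma of the logical relation. For \<open>T_pop\<close> the return is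
  supplied by \<open>real\<close> of the token found in component j; for the push rules
  \<open>realizes_pushed\<close> turns the induction hypothesis on \<open>B\<close> into realized
  tokens.\<close>

lemma T_sound: "T g As q d Ds q' m \<Longrightarrow> sound g As q d Ds q' m"
proof (induction rule: T.induct)
  case (T_read q g f As a d Ds q' m)
  show ?case unfolding sound_def
  proof (intro allI impI)
    fix xs assume a: "flat_ok (q, g, xs)" "realizes As xs 0"
    then have "flat_ok (f a, g, xs)" by (simp add: flat_ok_def)
    from soundD[OF T_read(3) this a(2)] obtain P where
      P: "ret P d" "hd P = (f a, g, xs)" "state (last P) = q'" "val P = m" "realizes Ds (comps (last P)) (Suc d)"
      by blast
    have ne: "P \<noteq> []" using ret_Cons2[OF P(1)] by auto
    show "\<exists>P. ret P d \<and> hd P = (q, g, xs) \<and> state (last P) = q' \<and> val P = \<phi> [a] * m \<and> realizes Ds (comps (last P)) (Suc d)"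
      using ret.read[OF T_read(1) P(1,2)] val_read[OF T_read(1) P(2) ne, of xs] P ne
      by (intro exI[of _ "(q, g, xs) # P"]) simp
  qed
next
  case (T_pop_last q g q' j As)
  have j: "j < n" using popD[OF T_pop_last(1)] by simp
  have lAs: "length As = n" using T_pop_last(2) by (simp add: okl_def)
  show ?case unfolding sound_def
  proof (intro allI impI)
    fix xs assume a: "flat_ok (q, g, xs)" "realizes As xs 0"
    have len: "length xs = n" "comps_ok xs" using a(1) by (simp_all add: flat_ok_def)
    obtain ys x vs where xs: "xs = ys @ x # vs" "length ys = j" using split_comps[of j xs] j len(1) by blast
    have "real (n - Suc j) Ne (xs ! j)" by (rule realizesD[OF a(2) j T_pop_last(3)])
    then have "x \<noteq> []" using xs nth_mid[OF xs(2)] by simp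
    then obtain b t where x: "x = b @ [t]" by (cases x rule: rev_cases) simp_all
    have "shape j t" using comps_okD[of ys x vs t] len(2) xs x by simp
    then obtain g' zs where t: "t = stk g' zs" "length zs = j" using shape_decompose by blast
    let ?P = "[(q, g, xs), (q', g', zs @ b # vs)]"
    have r: "ret ?P j" using ret.pop_last[OF T_pop_last(1) xs(2) t(2), of b g' vs] xs x t by simp
    have "realizes (drop (Suc j) As) (zs @ b # vs) (Suc j)"
    proof (rule realizes_dropI[OF a(2) lAs])
      fix i assume "Suc j \<le> i"
      then obtain e where "i = Suc j + e" using le_iff_add by blast
      then show "xs ! i = (zs @ b # vs) ! i" using xs t by (simp add: nth_append)
    qed
    then show "\<exists>P. ret P j \<and> hd P = (q, g, xs) \<and> state (last P) = q' \<and> val P = 1 \<and>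
       realizes (drop (Suc j) As) (comps (last P)) (Suc j)"
      using r val_op[OF T_pop_last(1), of "[(q', g', zs @ b # vs)]" xs] by (intro exI[of _ ?P]) simp
  qed
next
  case (T_pop q g q1 j As d Ds q' m)
  have j: "j < n" using popD[OF T_pop(1)] by simp
  have lAs: "length As = n" using T_pop(2) by (simp add: okl_def)
  show ?case unfolding sound_def
  proof (intro allI impI)
    fix xs assume a: "flat_ok (q, g, xs)" "realizes As xs 0"
    have len: "length xs = n" "comps_ok xs" using a(1) by (simp_all add: flat_ok_def)
    obtain ys x vs where xs: "xs = ys @ x # vs" "length ys = j" using split_comps[of j xs] j len(1) by blast
    have "real (n - Suc j) (Tok (drop (Suc j) As) q1 d Ds q' m) (xs ! j)"
      by (rule realizesD[OF a(2) j T_pop(3)])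
    then have R: "real (n - Suc j) (Tok (drop (Suc j) As) q1 d Ds q' m) x" using xs nth_mid[OF xs(2)] by simp
    have "x \<noteq> []" using real_tyl[OF R] by auto
    then obtain b t where x: "x = b @ [t]" by (cases x rule: rev_cases) simp_all
    have "shape j t" using comps_okD[of ys x vs t] len(2) xs x by simp
    then obtain g' zs where t: "t = stk g' zs" "length zs = j" using shape_decompose by blast
    have s: "fstep (q, g, xs) (q1, g', zs @ b # vs)"
      using fstep.pop[OF T_pop(1) xs(2) t(2), of b g' vs] xs x t by simp
    have ok: "flat_ok (q1, g', zs @ b # vs)" using fstep_ok[OF s a(1)] .
    have re: "realizes (drop (Suc j) As) (zs @ b # vs) (Suc j)"
    proof (rule realizes_dropI[OF a(2) lAs])
      fix i assume "Suc j \<le> i"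
      then obtain e where "i = Suc j + e" using le_iff_add by blast
      then show "xs ! i = (zs @ b # vs) ! i" using xs t by (simp add: nth_append)
    qed
    obtain P where P: "ret P (Suc j + d)" "hd P = (q1, g', zs @ b # vs)" "state (last P) = q'" "val P = m"
         "realizes Ds (comps (last P)) (Suc (Suc j + d))"
      using R ok re x t unfolding real_Tok_iff[OF j] by blast
    have ne: "P \<noteq> []" using ret_Cons2[OF P(1)] by auto
    have "ret ((q, g, xs) # P) (Suc j + d)"
      using ret.pop[OF T_pop(1) xs(2) t(2) _ P(1,2)] xs x t by simp
    then show "\<exists>P. ret P (Suc j + d) \<and> hd P = (q, g, xs) \<and> state (last P) = q' \<and> val P = m \<and>
       realizes Ds (comps (last P)) (Suc (Suc j + d))"
      using val_op[OF T_pop(1) ne, of xs] P ne by (intro exI[of _ "(q, g, xs) # P"]) simp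
  qed
next
  case (T_push q g q1 j g1 As B d Ds q' m)
  have j: "j < n" using pushD[OF T_push(1)] by simp
  have lAs: "length As = n" using T_push(2) by (simp add: okl_def)
  show ?case unfolding sound_def
  proof (intro allI impI)
    fix xs assume a: "flat_ok (q, g, xs)" "realizes As xs 0"
    have len: "length xs = n" using a(1) by (simp add: flat_ok_def)
    obtain ys b vs where xs: "xs = ys @ b # vs" "length ys = j" using split_comps[of j xs] j len(1) by blast
    let ?X = "b @ [stk g ys]"
    have s: "fstep (q, g, xs) (q1, g1, ys @ ?X # vs)"
      using fstep.push[OF T_push(1) xs(2), of b vs] xs by simp
    have re: "realizes (As[j := B]) (ys @ ?X # vs) 0"
      using realizes_pushed[OF _ xs(2) j _ lAs T_push.IH(1)] a xs by blast
    from soundD[OF T_push.IH(2) fstep_ok[OF s a(1)] re] obtain P where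
      P: "ret P d" "hd P = (q1, g1, ys @ ?X # vs)" "state (last P) = q'" "val P = m" "realizes Ds (comps (last P)) (Suc d)"
      by blast
    have ne: "P \<noteq> []" using ret_Cons2[OF P(1)] by auto
    have "ret ((q, g, xs) # P) d" using ret.push[OF T_push(1) xs(2) T_push.hyps(4) P(1,2)] xs by simp
    then show "\<exists>P. ret P d \<and> hd P = (q, g, xs) \<and> state (last P) = q' \<and> val P = m \<and> realizes Ds (comps (last P)) (Suc d)"
      using val_op[OF T_push(1) ne, of xs] P ne by (intro exI[of _ "(q, g, xs) # P"]) simp
  qed
next
  case (T_push_pop q g q1 j g1 As B Es q2 m1 d Ds q' m2)
  have j: "j < n" using pushD[OF T_push_pop(1)] by simp
  have lAs: "length As = n" using T_push_pop(2) by (simp add: okl_def)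
  show ?case unfolding sound_def
  proof (intro allI impI)
    fix xs assume a: "flat_ok (q, g, xs)" "realizes As xs 0"
    have len: "length xs = n" using a(1) by (simp add: flat_ok_def)
    obtain ys b vs where xs: "xs = ys @ b # vs" "length ys = j" using split_comps[of j xs] j len(1) by blast
    let ?X = "b @ [stk g ys]"
    have s: "fstep (q, g, xs) (q1, g1, ys @ ?X # vs)"
      using fstep.push[OF T_push_pop(1) xs(2), of b vs] xs by simp
    have ok1: "flat_ok (q1, g1, ys @ ?X # vs)" using fstep_ok[OF s a(1)] .
    have re: "realizes (As[j := B]) (ys @ ?X # vs) 0"
      using realizes_pushed[OF _ xs(2) j _ lAs T_push_pop.IH(1)] a xs by blast
    from soundD[OF T_push_pop.IH(2) ok1 re] obtain P where
      P: "ret P j" "hd P = (q1, g1, ys @ ?X # vs)" "state (last P) = q2" "val P = m1" "realizes Es (comps (last P)) (Suc j)"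
      by blast
    obtain P' c where P': "P = P' @ [c]" using ret_Cons2[OF P(1)] by (cases P rule: rev_cases) simp_all
    have okP: "flat_ok (hd P)" using P(2) ok1 by simp
    have "comps (hd P) = ys @ ?X # vs" using P(2) by simp
    from ret_component[OF P(1) okP this xs(2,2)] obtain vs' where
      c: "comps c = ys @ b # vs'" "symb c = g" using P' by auto
    have cq: "c = (q2, g, ys @ b # vs')" using c P(3) P' by (cases c) simp
    have "frun P" using ret_frun P(1) okP by blast
    then have okc: "flat_ok (q2, g, ys @ b # vs')" using frun_all_ok[of P c] P' cq by simp
    \<comment> \<open>The first j+1 components after the return are the original ones, so their
      tokens are still realized; the others are covered by \<open>Es\<close>.\<close>
    have "realizes (take (Suc j) As @ Es) (ys @ b # vs') 0"
    proof (rule realizes_append)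
      have l: "length (take (Suc j) As) = Suc j" using lAs j by simp
      show "realizes Es (ys @ b # vs') (length (take (Suc j) As))" using P(5) P' c(1) unfolding l by simp
      fix i \<sigma> assume i: "i < length (take (Suc j) As)" "\<sigma> |\<in>| take (Suc j) As ! i"
      then have "i < Suc j" "\<sigma> |\<in>| As ! i" using l by simp_all
      moreover have "(ys @ b # vs') ! i = xs ! i" using calculation(1) xs by (auto simp: nth_append less_Suc_eq)
      ultimately show "real (n - Suc i) \<sigma> ((ys @ b # vs') ! i)" using realizesD[OF a(2), of i \<sigma>] j by simp
    qed
    from soundD[OF T_push_pop.IH(3) okc this] obtain Q where
      Q: "ret Q d" "hd Q = c" "state (last Q) = q'" "val Q = m2" "realizes Ds (comps (last Q)) (Suc d)"
      unfolding cq by blast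
    obtain Q' where Q': "Q = c # Q'" using ret_Cons2[OF Q(1)] Q(2) by (cases Q) auto
    have "ret ((q, g, xs) # P' @ Q) d"
      using ret.push_pop[OF T_push_pop(1) xs(2) T_push_pop.hyps(5), of P' c] P(1,2) Q(1) xs P' Q' by simp
    moreover have "val ((q, g, xs) # P' @ Q) = m1 * m2"
      using val_op[OF T_push_pop(1), of "P' @ Q" xs] val_append[of P' c Q'] P(4) Q(4) P' Q' by simp
    ultimately show "\<exists>P. ret P d \<and> hd P = (q, g, xs) \<and> state (last P) = q' \<and> val P = m1 * m2 \<and>
        realizes Ds (comps (last P)) (Suc d)"
      using Q Q' by (intro exI[of _ "(q, g, xs) # P' @ Q"]) simp
  qed
qed

end

lemma size_plug: "size s \<le> size (plug s xs)"
proof (induction xs arbitrary: s)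
  case (Cons x xs)
  have "size s \<le> size (Node (x @ [s]))" by simp
  also have "\<dots> \<le> size (plug (Node (x @ [s])) xs)" by (rule Cons)
  finally show ?case by simp
qed simp

lemma size_comp_plug: "i < length xs \<Longrightarrow> size (Node (xs ! i)) < size (plug s xs)"
proof (induction xs arbitrary: s i)
  case (Cons x xs)
  show ?case
  proof (cases i)
    case 0
    have "size (Node x) < size (Node (x @ [s]))" by simp
    also have "\<dots> \<le> size (plug (Node (x @ [s])) xs)" by (rule size_plug)
    finally show ?thesis using 0 by simp
  next
    case (Suc j)
    then show ?thesis using Cons.IH[of j "Node (x @ [s])"] Cons.prems by simp
  qed
qed simp

context dpda_monoid
begin

text \<open>A token of \<open>x\<close> is derived under hypotheses on the components
  \<open>zs\<close> and \<open>b\<close> into which \<open>x\<close> decomposes and on the context.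
  The former are smaller than \<open>x\<close> (\<open>size_comp_plug\<close>), so induction on the
  size realizes them, and \<open>T_sound\<close> applies.\<close>

lemma real_all:
  "\<forall>t\<in>set x. shape k t \<Longrightarrow> k < n \<Longrightarrow> \<tau> \<in> tyl x \<Longrightarrow> real (n - Suc k) \<tau> x"
proof (induction "size (Node x)" arbitrary: x k \<tau> rule: less_induct)
  case less
  show ?case
  proof (cases \<tau>)
    case Ne
    then show ?thesis using less(4) Ne_tyl by simp
  next
    case (Tok Cs q d Ds q' m)
    have "\<exists>P. ret P (Suc k + d) \<and> hd P = (q, g, zs @ b # vs) \<and> state (last P) = q' \<and> val P = m \<and>
         realizes Ds (comps (last P)) (Suc (Suc k + d))"
      if a: "x = b @ [stk g zs]" "length zs = k" "flat_ok (q, g, zs @ b # vs)"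
        "realizes Cs (zs @ b # vs) (Suc k)" for vs b g zs
    proof -
      have "\<tau> \<in> tys (stk g (zs @ [b]))" using less(4) a by simp
      then obtain As where As: "fits As (zs @ [b])"
        "T g (As @ Cs) q (length (zs @ [b]) + d) Ds q' m" unfolding Tok Tok_tys_plug by blast
      have l: "length As = Suc k" using list_all2_lengthD[OF As(1)] a(2) by simp
      have "realizes (As @ Cs) (zs @ b # vs) 0"
      proof (rule realizes_append)
        show "realizes Cs (zs @ b # vs) (length As)" using a(4) l by simp
        fix i \<sigma> assume i: "i < length As" "\<sigma> |\<in>| As ! i"
        let ?y = "(zs @ [b]) ! i"
        have li: "i < length (zs @ [b])" using i(1) l a(2) by simp
        have y: "(zs @ b # vs) ! i = ?y" using li by (auto simp: nth_append less_Suc_eq)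
        have "size (Node ?y) < size (stk g (zs @ [b]))" by (rule size_comp_plug[OF li])
        then have sz: "size (Node ?y) < size (Node x)" using a(1) by simp
        have "comps_ok (zs @ b # vs)" using a(3) by (simp add: flat_ok_def)
        then have sh: "\<forall>t\<in>set ?y. shape i t" unfolding comps_ok_def y[symmetric] using li by simp
        have "i < n" using i(1) l less(3) by simp
        moreover have "\<sigma> \<in> tyl ?y" using list_all2_nthD[OF As(1) i(1)] i(2) by blast
        ultimately show "real (n - Suc i) \<sigma> ((zs @ b # vs) ! i)" unfolding y using less(1)[OF sz sh] by blast
      qed
      from soundD[OF T_sound[OF As(2)] a(3) this] show ?thesis using a(2) by simp
    qed
    then show ?thesis unfolding Tok real_Tok_iff[OF less(3)] using less(4) Tok by blast
  qed
qed

end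

context dpda_fin
begin

text \<open>Completeness turns the given return into a derivation, and soundness executes the
  derivation on the other components. For indices up to d the final components come from unpacking
  the exposed stack; there \<open>ret_component\<close> gives the exact result.\<close>

theorem return_transfer:
  assumes r: "ret P d" and ok: "flat_ok (hd P)" "flat_ok (state (hd P), symb (hd P), xs)"
    and le: "\<And>i. i < n \<Longrightarrow> tyl (comps (hd P) ! i) \<subseteq> tyl (xs ! i)"
  shows "\<exists>Q. ret Q d \<and> hd Q = (state (hd P), symb (hd P), xs) \<and> state (last Q) = state (last P) \<and>
    val Q = val P \<and> (\<forall>i. Suc d \<le> i \<longrightarrow> i < n \<longrightarrow> tyl (comps (last P) ! i) \<subseteq> tyl (comps (last Q) ! i))"
proof -
  let ?As = "map tyf (comps (hd P))" and ?Ds = "map tyf (drop (Suc d) (comps (last P)))"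
  have len: "length (comps (hd P)) = n" "comps_ok (comps (hd P))" "length xs = n" "comps_ok xs"
    using ok by (simp_all add: flat_ok_def)
  have f: "frun P" using ret_frun[OF r ok(1)] .
  then have "flat_ok (last P)" using frun_all_ok frun_ne by auto
  then have len2: "length (comps (last P)) = n" "comps_ok (comps (last P))" by (simp_all add: flat_ok_def)
  have "realizes ?As xs 0"
    unfolding realizes_def
  proof (intro allI impI)
    fix i \<tau> assume i: "i < n - 0" "\<tau> |\<in>| ?As ! i"
    then have "\<tau> \<in> tyl (comps (hd P) ! i)" using fset_tyf_comps[OF len(2), of i] len(1) by simp
    then have "\<tau> \<in> tyl (xs ! i)" using le i(1) by auto
    moreover have "\<forall>t\<in>set (xs ! i). shape i t" using len(3,4) i(1) by (simp add: comps_ok_def)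
    ultimately show "real (n - 0 - Suc i) \<tau> (xs ! (0 + i))" using real_all[of "xs ! i" i \<tau>] i(1) by simp
  qed
  from soundD[OF T_sound[OF T_complete[OF r ok(1)]] ok(2) this] obtain Q where
    Q: "ret Q d" "hd Q = (state (hd P), symb (hd P), xs)" "state (last Q) = state (last P)" "val Q = val P"
      "realizes ?Ds (comps (last Q)) (Suc d)" by blast
  have "tyl (comps (last P) ! i) \<subseteq> tyl (comps (last Q) ! i)" if i: "Suc d \<le> i" "i < n" for i
  proof
    fix \<tau> assume t: "\<tau> \<in> tyl (comps (last P) ! i)"
    obtain e where e: "i = Suc d + e" using i(1) le_iff_add by blast
    have "?Ds ! e = tyf (comps (last P) ! i)" using e i len2(1) by simp
    then have "\<tau> |\<in>| ?Ds ! e" using t fset_tyf_comps[OF len2(2), of i] i len2(1) by simp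
    moreover have "e < n - Suc d" using e i by simp
    ultimately have "real (n - Suc d - Suc e) \<tau> (comps (last Q) ! (Suc d + e))"
      using Q(5) unfolding realizes_def by blast
    then show "\<tau> \<in> tyl (comps (last Q) ! i)" using real_tyl e by blast
  qed
  then show ?thesis using Q(1-4) by blast
qed

end

section \<open>Simulation of upper runs\<close>

lemma nth_after: "length ys = j \<Longrightarrow> (ys @ x # vs) ! (Suc j + i) = vs ! i"
  by (auto simp: nth_append)

lemma split_append_less:
  assumes "ys @ B # vs = us @ ws" "length ys < length us"
  shows "\<exists>us'. us = ys @ B # us' \<and> vs = us' @ ws"
proof -
  from assms obtain zs where zs: "us = ys @ zs" "zs @ ws = B # vs"
    by (auto simp: append_eq_append_conv2)
  then obtain us' where "zs = B # us'" using assms(2) by (cases zs) auto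
  then show ?thesis using zs by simp
qed

lemma split_append_ge:
  assumes "ys @ B # vs = us @ ws" "length us \<le> length ys"
  shows "\<exists>ws'. ys = us @ ws' \<and> ws = ws' @ B # vs"
proof -
  have "take (length us) (ys @ B # vs) = us" "drop (length us) (ys @ B # vs) = ws" using assms(1) by simp_all
  then have "take (length us) ys = us" "drop (length us) ys @ B # vs = ws" using assms(2) by simp_all
  then show ?thesis by (metis append_take_drop_id)
qed

section \<open>Pieces of upper runs\<close>

context dpda
begin

text \<open>The possible factors of \<open>kdecomp\<close>, that is, the k-upper runs with at least
  one step from which no shorter nonempty k-upper suffix can be cut off.\<close>

definition piece :: "nat \<Rightarrow> ('q, 'g) flat list \<Rightarrow> bool" where
  "piece k P \<longleftrightarrow> 2 \<le> length P \<and> upper k P \<and> (\<forall>i. 0 < i \<longrightarrow> Suc i < length P \<longrightarrow> \<not> upper k (drop i P))"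

text \<open>The second run traces its final top into the topmost k-stack of \<open>c\<close>, and
  there all leaves have, up to n-k coordinates, the same history as the top of
  \<open>c\<close>.\<close>

lemma upper_append:
  assumes "frun (P @ c # Q)" "upper k (P @ [c])" "upper k (c # Q)"
  shows "upper k (P @ c # Q)"
proof -
  have f: "frun (P @ [c])" "frun (c # Q)" using assms(1) frun_append by blast+
  let ?p = "trace (c # Q) (topc (last (c # Q)))"
  have "?p \<in> leafpaths c" using trace_leafpaths[OF f(2) top_leafpath] by simp
  then have "take (n - k) (trace (P @ [c]) ?p) = take (n - k) (trace (P @ [c]) (topc c))"
    using assms(3) by (intro take_trace[OF f(1)]) (simp_all add: top_leafpath upper_def)
  moreover have "trace (P @ c # Q) (topc (last (P @ c # Q))) = trace (P @ [c]) ?p"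
    using trace_append[of P c Q] by simp
  moreover have "hd (P @ c # Q) = hd (P @ [c])" by (cases P) simp_all
  ultimately show ?thesis using assms(2) unfolding upper_def by simp
qed

text \<open>\<open>kdecomp\<close> cuts from the end, but runs are simulated from the front.
  Suffixes starting within the old run are unchanged, so its cuts stay, and what remains when they
  are exhausted is the new piece.\<close>

lemma kdecomp_Cons:
  assumes "kdecomp n \<delta> k R Rs" "R = map conf (c # Q)" "frun (P @ c # Q)" "piece k (P @ [c])"
  shows "kdecomp n \<delta> k (map conf (P @ c # Q)) (map conf (P @ [c]) # Rs)"
  using assms
proof (induction R Rs arbitrary: Q rule: kdecomp.induct)
  case (empty R)
  let ?A = "map conf (P @ [c])"
  have Q: "Q = []" using empty by simp
  have f: "frun (P @ [c])" using empty(3) Q by simp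
  have "kdecomp n \<delta> k ?A ([] @ [drop 0 ?A])"
  proof (rule kdecomp.cut)
    show "0 + 1 < length ?A" using empty(4) by (auto simp: piece_def)
    show "kupper n \<delta> k (drop 0 ?A)" using kupper_iff[OF f] empty(4) by (simp add: piece_def)
    show "\<forall>j'. 0 < j' \<and> j' + 1 < length ?A \<longrightarrow> \<not> kupper n \<delta> k (drop j' ?A)"
    proof (intro allI impI)
      fix j assume j: "0 < j \<and> j + 1 < length ?A"
      then have "\<not> upper k (drop j (P @ [c]))" using empty(4) by (simp add: piece_def)
      moreover have "frun (drop j (P @ [c]))" using frun_drop[OF f] j by simp
      ultimately show "\<not> kupper n \<delta> k (drop j ?A)" unfolding drop_map using kupper_iff by blast
    qed
    show "kdecomp n \<delta> k (take (Suc 0) ?A) []" by (rule kdecomp.empty) simp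
  qed
  then show ?case using Q by simp
next
  case (cut j R Rs)
  let ?L = "length P"
  let ?R = "map conf (P @ c # Q)"
  have dr: "drop (?L + i) ?R = drop i R" for i using cut(6) by simp
  have j: "j < length (c # Q)" using cut(1,6) by simp
  have "kdecomp n \<delta> k (map conf (P @ c # take j Q)) (map conf (P @ [c]) # Rs)"
  proof (rule cut(5)[OF _ _ cut(8)])
    show "take (Suc j) R = map conf (c # take j Q)" using cut(6) by (simp add: take_map)
    have "?L + j < length (P @ c # Q)" using j by simp
    from frun_take[OF cut(7) this] show "frun (P @ c # take j Q)" by simp
  qed
  then have 1: "kdecomp n \<delta> k (take (Suc (?L + j)) ?R) (map conf (P @ [c]) # Rs)"
    by (simp add: take_map)
  have "kdecomp n \<delta> k ?R ((map conf (P @ [c]) # Rs) @ [drop (?L + j) ?R])"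
  proof (rule kdecomp.cut[OF _ _ _ 1])
    show "?L + j + 1 < length ?R" using cut(1,6) by simp
    show "kupper n \<delta> k (drop (?L + j) ?R)" unfolding dr by (rule cut(2))
    show "\<forall>j'. ?L + j < j' \<and> j' + 1 < length ?R \<longrightarrow> \<not> kupper n \<delta> k (drop j' ?R)"
    proof (intro allI impI)
      fix j' assume a: "?L + j < j' \<and> j' + 1 < length ?R"
      then obtain i where i: "j' = ?L + i" using less_imp_add_positive by (metis add.assoc)
      have "\<not> kupper n \<delta> k (drop i R)" using cut(3) a i cut(6) by simp
      then show "\<not> kupper n \<delta> k (drop j' ?R)" unfolding i dr .
    qed
  qed
  then show ?case unfolding dr by simp
qed

lemma piece_single: "upper k [c, d] \<Longrightarrow> piece k [c, d]"
  by (simp add: piece_def)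

text \<open>The final top is the old top, which lies below the copy and is traced to itself, so the
  whole loop is upper. Before its end the return avoids topmost j-stacks, so for k \<le> j no
  shorter nonempty suffix is k-upper.\<close>

lemma loop_piece:
  assumes c: "\<delta> q g = Op q' (Push (Suc j) g')" "length ys = j" "flat_ok (q, g, ys @ b # vs)"
    and R: "ret R j" "hd R = (q', g', ys @ (b @ [stk g ys]) # vs)"
    and k: "k \<le> j"
  shows "piece k ((q, g, ys @ b # vs) # R)"
proof -
  let ?X = "b @ [stk g ys]" and ?c = "(q, g, ys @ b # vs)"
  have n: "length (ys @ b # vs) = n" "comps_ok (ys @ b # vs)" using c(3) by (simp_all add: flat_ok_def)
  have "fstep ?c (hd R)" using fstep.push[OF c(1,2), of b vs] R(2) by simp
  then have ok: "flat_ok (hd R)" using fstep_ok c(3) by blast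
  have cR: "comps (hd R) = ys @ ?X # vs" using R(2) by simp
  from returnsD[OF ret_returns[OF R(1) ok] cR c(2)] obtain zs vs' where
    r: "comps (last R) = zs @ vs'" "length zs = Suc j" "length vs' = length vs"
      "stk (symb (last R)) zs = Node ?X"
    and r2: "\<forall>\<pi>\<in>paths (Node ?X). trace R (toppath vs' @ \<pi>) = toppath vs @ \<pi> \<and>
      avoids (Suc (length vs)) R (toppath vs' @ \<pi>)" by blast
  have "zs = ys @ [b]"
    using r(2,4) plug_inject[of zs "ys @ [b]" "symb (last R)" g] c(2) by simp
  then have top: "topc (last R) = toppath vs' @ Suc (length b) # toppath ys"
    using r(1) by (simp add: topc_def)
  have "toppath ys \<in> paths (stk g ys)" by (simp add: paths_plug)
  then have pi: "Suc (length b) # toppath ys \<in> paths (Node ?X)" unfolding paths_Node_snoc by blast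
  have t: "trace R (topc (last R)) = toppath vs @ Suc (length b) # toppath ys"
    and av: "avoids (Suc (length vs)) R (topc (last R))"
    using bspec[OF r2 pi] top by simp_all
  obtain c1 R' where R': "R = c1 # R'" "R' \<noteq> []" using ret_Cons2[OF R(1)] by auto
  have "hist1 ?c (hd R) (toppath vs @ Suc (length b) # toppath ys) = toppath vs @ Suc (length b) # toppath ys"
    unfolding R(2) using c(2) by (intro hist1_push_below[OF c(1,2) n(1)]) simp_all
  then have "trace (?c # R) (topc (last (?c # R))) = topc ?c"
    using t R' by simp
  then have u: "upper k (?c # R)" by (simp add: upper_def)
  have "\<not> upper k (drop i (?c # R))" if i: "0 < i" "Suc i < length (?c # R)" for i
  proof -
    obtain s where s: "i = Suc s" using i(1) by (cases i) simp_all
    have ls: "Suc s < length R" using i(2) s by simp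
    have m: "take (Suc (length vs)) (trace (drop s R) (topc (last R))) \<noteq> take (Suc (length vs)) (topc (R ! s))"
      by (rule avoids_drop[OF av ls])
    have le: "Suc (length vs) \<le> n - k" using n(1) c(2) k by simp
    have "take (n - k) u \<noteq> take (n - k) v" if "take (Suc (length vs)) u \<noteq> take (Suc (length vs)) v" for u v :: "nat list"
    proof
      assume "take (n - k) u = take (n - k) v"
      then have "take (Suc (length vs)) (take (n - k) u) = take (Suc (length vs)) (take (n - k) v)" by simp
      then show False using that le by (simp add: min_def)
    qed
    from this[OF m] show ?thesis unfolding upper_def s using ls by (simp add: hd_drop_conv_nth)
  qed
  then show ?thesis using u R' by (simp add: piece_def)
qed

end

context dpda_fin
begin

text \<open>The topmost k-stacks agree exactly, as parallel runs require up to positions. Beyond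
  them inclusion of types in one direction is enough, because returns from \<open>c\<close> are to
  be replaced by returns from \<open>d\<close>.\<close>

definition sim :: "nat \<Rightarrow> ('q, 'g) flat \<Rightarrow> ('q, 'g) flat \<Rightarrow> bool" where
  "sim k c d \<longleftrightarrow> flat_ok c \<and> flat_ok d \<and> state c = state d \<and> symb c = symb d \<and>
    (\<exists>us ws ws'. comps c = us @ ws \<and> comps d = us @ ws' \<and> length us = k \<and>
      tyle ws ws')"

lemma sim_cong:
  assumes "sim k c d" shows "stack_cong (ktop n k (snd (conf c))) (ktop n k (snd (conf d)))"
proof -
  have "take k (comps c) = take k (comps d)" "symb c = symb d" "flat_ok c" "flat_ok d"
    using assms unfolding sim_def by auto
  then show ?thesis by (simp add: stack_cong_def ktop_conf)
qed

lemma parallel_single: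
  assumes "sim k c d" shows "parallel n \<delta> \<phi> k (map conf [d]) (map conf [c])"
proof -
  have ok: "flat_ok c" "flat_ok d" using assms by (simp_all add: sim_def)
  have u: "kupper n \<delta> k (map conf [c])" if "flat_ok c" for c
    using kupper_iff[of "[c]" k] that by (simp add: upper_def)
  have "kdecomp n \<delta> k (map conf [c]) []" for c by (rule kdecomp.empty) simp
  moreover have "stack_cong (ktop n k (snd (last (map conf [d])))) (ktop n k (snd (last (map conf [c]))))"
    using sim_cong[OF assms] by (simp add: stack_cong_def)
  ultimately show ?thesis unfolding parallel_def using u[OF ok(1)] u[OF ok(2)]
    by (intro conjI exI[of _ "[]"]) simp_all
qed

lemma parallel_Cons:
  assumes par: "parallel n \<delta> \<phi> k (map conf (d # Q')) (map conf (c # Q))"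
    and f: "frun (P @ c # Q)" "frun (P' @ d # Q')"
    and pc: "piece k (P @ [c])" "piece k (P' @ [d])"
    and v: "val (P' @ [d]) = val (P @ [c])"
    and s: "sim k (hd (P @ [c])) (hd (P' @ [d]))"
  shows "parallel n \<delta> \<phi> k (map conf (P' @ d # Q')) (map conf (P @ c # Q))"
proof -
  obtain Rs Ss where d: "kdecomp n \<delta> k (map conf (d # Q')) Rs" "kdecomp n \<delta> k (map conf (c # Q)) Ss"
    "length Rs = length Ss"
    "\<forall>i<length Rs. \<phi> (run_word \<delta> (Rs ! i)) = \<phi> (run_word \<delta> (Ss ! i)) \<and>
            stack_cong (ktop n k (snd (hd (Rs ! i)))) (ktop n k (snd (hd (Ss ! i))))"
    "stack_cong (ktop n k (snd (last (map conf (d # Q'))))) (ktop n k (snd (last (map conf (c # Q)))))"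
    using par unfolding parallel_def by blast
  have f1: "frun (c # Q)" "frun (d # Q')" using f frun_append by blast+
  have u: "upper k (P' @ d # Q')" "upper k (P @ c # Q)"
    using par pc kupper_iff[OF f1(1)] kupper_iff[OF f1(2)] upper_append[OF f(1)] upper_append[OF f(2)]
    unfolding parallel_def piece_def by blast+
  let ?Rs = "map conf (P' @ [d]) # Rs" and ?Ss = "map conf (P @ [c]) # Ss"
  have "kdecomp n \<delta> k (map conf (P' @ d # Q')) ?Rs" "kdecomp n \<delta> k (map conf (P @ c # Q)) ?Ss"
    using kdecomp_Cons[OF d(1) refl f(2) pc(2)] kdecomp_Cons[OF d(2) refl f(1) pc(1)] .
  moreover have "\<phi> (run_word \<delta> (?Rs ! i)) = \<phi> (run_word \<delta> (?Ss ! i)) \<and>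
            stack_cong (ktop n k (snd (hd (?Rs ! i)))) (ktop n k (snd (hd (?Ss ! i))))" if i: "i < length ?Rs" for i
  proof (cases i)
    case 0
    have h: "hd (map conf (P @ [c])) = conf (hd (P @ [c]))" for P c by (rule hd_map) simp
    show ?thesis using v sim_cong[OF s] unfolding 0 nth_Cons_0 h val_def stack_cong_def by simp
  next
    case (Suc m)
    then show ?thesis using d(4) i by simp
  qed
  moreover have "last (map conf (P @ c # Q)) = last (map conf (c # Q))" for P c Q by simp
  then have "stack_cong (ktop n k (snd (last (map conf (P' @ d # Q'))))) (ktop n k (snd (last (map conf (P @ c # Q)))))"
    using d(5) by metis
  moreover have "length ?Rs = length ?Ss" using d(3) by simp
  ultimately show ?thesis unfolding parallel_def using u kupper_iff[OF f(1)] kupper_iff[OF f(2)]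
    by blast
qed

abbreviation simulated :: "nat \<Rightarrow> ('q, 'g) flat list \<Rightarrow> ('q, 'g) flat \<Rightarrow> bool" where
  "simulated k P c \<equiv> \<exists>R. frun R \<and> hd R = c \<and> sim k (last P) (last R) \<and> val R = val P \<and>
     parallel n \<delta> \<phi> k (map conf R) (map conf P)"

lemma sim_extend:
  assumes f: "frun (P @ c # Q)" "frun (P' @ [d])" 
    and pc: "piece k (P @ [c])" "piece k (P' @ [d])"
    and v: "val (P' @ [d]) = val (P @ [c])"
    and s: "sim k (hd (P @ [c])) (hd (P' @ [d]))"
    and IH: "simulated k (c # Q) d"
  shows "simulated k (P @ c # Q) (hd (P' @ [d]))"
proof -
  obtain R where R: "frun R" "hd R = d" "sim k (last (c # Q)) (last R)" "val R = val (c # Q)"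
      "parallel n \<delta> \<phi> k (map conf R) (map conf (c # Q))" using IH by blast
  obtain Q' where Q': "R = d # Q'" using R(1,2) by (cases R) (simp_all add: frun_def)
  have f': "frun (P' @ d # Q')" using f(2) R(1) Q' frun_append by blast
  have "val (P' @ d # Q') = val (P @ c # Q)"
    using val_append[of P' d Q'] val_append[of P c Q] v R(4) Q' by simp
  moreover have "parallel n \<delta> \<phi> k (map conf (P' @ d # Q')) (map conf (P @ c # Q))"
    using parallel_Cons[OF R(5)[unfolded Q'] f(1) f' pc v s] .
  moreover have "hd (P' @ d # Q') = hd (P' @ [d])" by (cases P') simp_all
  moreover have "last (P @ c # Q) = last (c # Q)" "last (P' @ d # Q') = last R" using Q' by simp_all
  ultimately show ?thesis using f' R(3) by (intro exI[of _ "P' @ d # Q'"]) simp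
qed

text \<open>The first step either works inside the topmost k-stack, or pushes a copy of it into
  which the final top is traced, or is a push below whose copy the final top is traced. The first
  two are imitated literally as pieces of one step; the third opens a loop, whose return is supplied
  by \<open>return_transfer\<close>.\<close>

theorem simulate:
  assumes "frun P" "upper k P" "sim k (hd P) c'"
  shows "simulated k P c'"
  using assms
proof (induction "length P" arbitrary: P c' rule: less_induct)
  case less
  obtain c P0 where P0: "P = c # P0" using less(2) by (cases P) (simp_all add: frun_def)
  have sc: "sim k c c'" using less(4) P0 by simp
  show ?case
  proof (cases P0)
    case Nil
    have "flat_ok c'" using sc by (simp add: sim_def)
    then show ?thesis using P0 Nil sc parallel_single[OF sc] by (intro exI[of _ "[c']"]) simp
  next
    case (Cons c1 P2)
    then have P: "P = [c] @ c1 # P2" using P0 by simp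
    have s: "fstep c c1" "flat_ok c" and f1: "frun (c1 # P2)" using less(2) P by (simp_all add: frun_Cons)
    have ok1: "flat_ok c1" using fstep_ok[OF s] .
    have l1: "last P = last (c1 # P2)" by (simp add: P)
    define p where "p = trace (c1 # P2) (topc (last P))"
    have p: "p \<in> leafpaths c1" "length p = n"
    proof -
      have t: "topc (last P) \<in> leafpaths (last (c1 # P2))" unfolding l1 by (rule top_leafpath)
      show "p \<in> leafpaths c1" "length p = n"
        using trace_leafpaths[OF f1 t] trace_length[OF f1 t] unfolding p_def list.sel .
    qed
    have up: "take (n - k) (hist1 c c1 p) = take (n - k) (topc c)"
      using less(3) by (simp add: upper_def P p_def)
    obtain q g us ws ws' where c: "c = (q, g, us @ ws)" "c' = (q, g, us @ ws')" "length us = k"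
      and le: "tyle ws ws'"
      using sc unfolding sim_def by (metis prod.collapse)
    have ok': "flat_ok (q, g, us @ ws')" using sc c by (simp add: sim_def)
    have lw: "length ws = n - k" "length ws' = n - k" "k \<le> n" using s(2) ok' c by (auto simp: flat_ok_def)
    have tc: "take (n - k) (topc c) = toppath ws" using c lw by simp
    have single: ?thesis if st: "fstep c' c1'" and v: "val [c', c1'] = val [c, c1]"
      and u: "upper k [c, c1]" "upper k [c', c1']" "upper k (c1 # P2)" and sm: "sim k c1 c1'" for c1'
    proof -
      have "simulated k (c1 # P2) c1'"
        using less(1)[of "c1 # P2" c1'] f1 u(3) sm P by simp
      moreover have "frun ([c'] @ [c1'])" using st ok' c sm by (simp add: frun_Cons sim_def)
      ultimately have "simulated k ([c] @ c1 # P2) (hd ([c'] @ [c1']))"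
        using less(2) P v sc piece_single[OF u(1)] piece_single[OF u(2)]
        by (intro sim_extend) simp_all
      then show ?thesis using P by simp
    qed
    have upper1: "upper k (c1 # P2) \<longleftrightarrow> take (n - k) p = take (n - k) (topc c1)"
      by (simp add: upper_def p_def l1)
    have upper2: "upper k [e, e1] \<longleftrightarrow> take (n - k) (hist1 e e1 (topc e1)) = take (n - k) (topc e)" for e e1
      by (simp add: upper_def)
    from s(1) show ?thesis
    proof cases
      case (read q0 g0 f xs a)
      have r: "\<delta> q g = Read f" "c1 = (f a, g, us @ ws)" using read c by simp_all
      let ?c1' = "(f a, g, us @ ws')"
      have h: "hist1 (q, g, xs) e x = x" for xs e x using r(1) by (simp add: hist1_simps)
      show ?thesis
      proof (rule single[of ?c1'])
        show "fstep c' ?c1'" using fstep.read[OF r(1)] c by simp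
        show "val [c', ?c1'] = val [c, c1]" using val_read[OF r(1), of "[(f a, g, ws)]" a g ws for ws] c r
          by (metis list.distinct(1) list.sel(1) val_read val_single)
        show "upper k [c, c1]" "upper k [c', ?c1']" using c r h by (simp_all add: upper2)
        show "upper k (c1 # P2)" unfolding upper1 using up h c r by simp
        show "sim k c1 ?c1'" using sc c r by (simp add: sim_def flat_ok_def)
      qed
    next
      case (pop q0 g0 q' j ys zs b g' vs)
      let ?B = "b @ [stk g' zs]"
      have r: "\<delta> q g = Op q' (Pop (Suc j))" "us @ ws = ys @ ?B # vs" "c1 = (q', g', zs @ b # vs)"
        using pop c by simp_all
      have h: "hist1 (q, g, xs) e x = x" for xs e x using r(1) by (simp add: hist1_simps)
      show ?thesis
      proof (cases "j < k")
        case True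
        then have "length ys < length us" using pop(4) c(3) by simp
        then obtain us1 where y: "us = ys @ ?B # us1" "vs = us1 @ ws" using split_append_less[OF r(2)[symmetric]] by blast
        let ?c1' = "(q', g', zs @ b # us1 @ ws')"
        have st: "fstep c' ?c1'" using fstep.pop[OF r(1) pop(4,5), of b g' "us1 @ ws'"] c y by simp
        have tw: "take (n - k) (toppath (zs @ b # us1 @ w)) = toppath w" if "length w = n - k" for w
          using that by simp
        show ?thesis
        proof (rule single[of ?c1'])
          show "fstep c' ?c1'" by (rule st)
          show "val [c', ?c1'] = val [c, c1]" using val_op[OF r(1)] c by simp
          show "upper k [c, c1]" "upper k [c', ?c1']" using c r(3) y h lw by (simp_all add: upper2)
          show "upper k (c1 # P2)" unfolding upper1 using up tc h c r(3) y lw by simp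
          have "length (zs @ b # us1) = k" using y c(3) pop(4,5) by simp
          moreover have "flat_ok ?c1'" using fstep_ok[OF st] ok' c by simp
          ultimately show "sim k c1 ?c1'" using ok1 r(3) y le unfolding sim_def
            by (intro conjI exI[of _ "zs @ b # us1"] exI[of _ ws] exI[of _ ws']) simp_all
        qed
      next
        case False
        then have "length us \<le> length ys" using pop(4) c(3) by simp
        then obtain ws2 where y: "ys = us @ ws2" "ws = ws2 @ ?B # vs"
          using split_append_ge[OF r(2)[symmetric]] by blast
        \<comment> \<open>A pop of order above k discards the topmost k-stack. The final top would
          have to be traced to the index of a stack that is gone.\<close>
        have pw: "take (n - k) p = toppath vs @ Suc (length ?B) # toppath ws2"
          using up tc h c y by simp
        have "leafpaths c1 = outer vs \<union> (\<lambda>p. toppath vs @ p) ` paths (Node ?B)"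
          using paths_plug[of "Node ?B" vs] r(3) by (simp add: leafpaths_def)
        moreover have "take (length vs) (take (n - k) p) = toppath vs" using pw by simp
        then have "take (length vs) p = toppath vs" using y lw by (simp add: min_def)
        ultimately obtain \<pi> where pi: "\<pi> \<in> paths (Node ?B)" "p = toppath vs @ \<pi>"
          using p(1) outer_not_prefix[of p vs] by blast
        obtain i \<rho> where i: "\<pi> = Suc i # \<rho>" "i < length ?B" using paths_Node_Cons[OF pi(1)] by blast
        have "n - k = Suc (length vs + length ws2)" using y lw by simp
        then have False using pw pi(2) i by simp
        then show ?thesis ..
      qed
    next
      case (push q0 g0 q' j g' ys b vs)
      let ?X = "b @ [stk g ys]"
      have r: "\<delta> q g = Op q' (Push (Suc j) g')" "us @ ws = ys @ b # vs" "c1 = (q', g', ys @ ?X # vs)"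
        using push c by simp_all
      have n0: "length (ys @ b # vs) = n" using s(2) c r(2) by (simp add: flat_ok_def)
      have nj: "n - j = Suc (length vs)" using n0 push(4) by simp
      have hp: "hist1 c c1 p = (if take (n - j) p = toppath vs @ [length b + 2]
         then toppath vs @ Suc (length b) # drop (n - j) p else p)"
        using hist1_push[OF r(1) push(4) n0 p(2), of "stk g ys"] c r by simp
      have copy: "hist1 (q, g, ys' @ b' # vs') (q', g', ys' @ (b' @ [t]) # vs') (toppath (ys' @ (b' @ [t]) # vs'))
         = toppath (ys' @ b' # vs')" if "length ys' = j" "length (ys' @ b' # vs') = n" for ys' b' vs' t
        using hist1_push_copy[OF r(1) that, of "toppath ys'" t] that by simp
      show ?thesis
      proof (cases "j < k")
        case True
        then have "length ys < length us" using push(4) c(3) by simp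
        then obtain us1 where y: "us = ys @ b # us1" "vs = us1 @ ws" using split_append_less[OF r(2)[symmetric]] by blast
        let ?c1' = "(q', g', ys @ ?X # us1 @ ws')"
        have n0': "length (ys @ b # us1 @ ws') = n" using ok' y by (simp add: flat_ok_def)
        have st: "fstep c' ?c1'" using fstep.push[OF r(1) push(4), of b "us1 @ ws'"] c y by simp
        show ?thesis
        proof (rule single[of ?c1'])
          show "fstep c' ?c1'" by (rule st)
          show "val [c', ?c1'] = val [c, c1]" using val_op[OF r(1)] c by simp
          show "upper k [c, c1]" using copy[OF push(4) n0] c r by (simp add: upper2)
          show "upper k [c', ?c1']" using copy[OF push(4) n0'] c y by (simp add: upper2)
          \<comment> \<open>The coordinate changed by this push has index \<open>length vs\<close>,
            which is at least n-k.\<close>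
          have "take (n - k) (hist1 c c1 p) = take (n - k) p"
          proof (cases "take (n - j) p = toppath vs @ [length b + 2]")
            case True
            then have "p = toppath vs @ (length b + 2) # drop (n - j) p"
              by (metis append_Cons append_Nil append_assoc append_take_drop_id)
            then have "take (n - k) p = take (n - k) (toppath vs @ (length b + 2) # drop (n - j) p)" by simp
            also have "\<dots> = take (n - k) (toppath vs)" using y lw by simp
            finally show ?thesis using True hp y lw by simp
          next
            case False
            then show ?thesis using hp by simp
          qed
          then show "upper k (c1 # P2)" unfolding upper1 using up tc r(3) y lw by simp
          have "length (ys @ ?X # us1) = k" using y c(3) by simp
          moreover have "flat_ok ?c1'" using fstep_ok[OF st] ok' c by simp
          ultimately show "sim k c1 ?c1'" using ok1 r(3) y le unfolding sim_def
            by (intro conjI exI[of _ "ys @ ?X # us1"] exI[of _ ws] exI[of _ ws']) simp_all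
        qed
      next
        case False
        then have kj: "k \<le> j" by simp
        then have "length us \<le> length ys" using push(4) c(3) by simp
        then obtain ws2 where y: "ys = us @ ws2" "ws = ws2 @ b # vs"
          using split_append_ge[OF r(2)[symmetric]] by blast
        obtain ws2' b' vs' where y': "ws' = ws2' @ b' # vs'" "tyle ws2 ws2'"
          "tyl b \<subseteq> tyl b'" "tyle vs vs'"
          using le unfolding y(2) list_all2_append1 list_all2_Cons1 by blast
        let ?ys' = "us @ ws2'"
        let ?X' = "b' @ [stk g ?ys']"
        let ?c1' = "(q', g', ?ys' @ ?X' # vs')"
        have lys': "length ?ys' = j" using list_all2_lengthD[OF y'(2)] y(1) push(4) by simp
        have c'': "c' = (q, g, ?ys' @ b' # vs')" using c y'(1) by simp
        have n0': "length (?ys' @ b' # vs') = n" using ok' y'(1) by (simp add: flat_ok_def)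
        have st: "fstep c' ?c1'" using fstep.push[OF r(1) lys', of b' vs'] c'' by simp
        have okc1': "flat_ok ?c1'" using fstep_ok[OF st] ok' c by simp
        have refl: "tyle us us" by (simp add: list_all2_refl)
        have lys: "tyle ys ?ys'" unfolding y(1)
          by (rule list_all2_appendI[OF refl y'(2)])
        \<comment> \<open>The two pushes store different old tops; monotonicity of types keeps the
          invariant.\<close>
        have XX: "tyl ?X \<subseteq> tyl ?X'"
          by (rule tyl_plug_mono, rule list_all2_appendI[OF lys]) (use y'(3) in \<open>simp del: tys.simps\<close>)
        have simc1: "sim k c1 ?c1'" unfolding sim_def
        proof (intro conjI exI)
          show "comps c1 = us @ (ws2 @ ?X # vs)" using r(3) y by simp
          show "comps ?c1' = us @ (ws2' @ ?X' # vs')" by simp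
          show "tyle (ws2 @ ?X # vs) (ws2' @ ?X' # vs')"
            using y'(2,4) XX by (intro list_all2_appendI) (simp_all del: tys.simps)
        qed (use ok1 okc1' r(3) c(3) in simp_all)
        show ?thesis
        proof (cases "take (n - j) p = toppath vs @ [length b + 2]")
          case True
          \<comment> \<open>The final top is traced into the copy, more precisely into the copy of
            the former topmost k-stack, so the push alone is a piece.\<close>
          have nk: "n - k = length vs + Suc (length ws2)" using y lw by simp
          have "take (n - k) (toppath vs @ Suc (length b) # drop (n - j) p) = toppath vs @ Suc (length b) # toppath ws2"
            using up tc hp True y by simp
          then have d: "take (length ws2) (drop (n - j) p) = toppath ws2" unfolding nk by simp
          have "p = toppath vs @ (length b + 2) # drop (n - j) p"
            using True by (metis append_Cons append_Nil append_assoc append_take_drop_id)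
          then have "take (n - k) p = take (n - k) (toppath vs @ (length b + 2) # drop (n - j) p)" by simp
          also have "\<dots> = toppath vs @ (length b + 2) # toppath ws2" unfolding nk using d by simp
          finally have u1: "upper k (c1 # P2)" unfolding upper1 using r(3) y nk by simp
          show ?thesis
          proof (rule single[of ?c1'])
            show "fstep c' ?c1'" by (rule st)
            show "val [c', ?c1'] = val [c, c1]" using val_op[OF r(1)] c by simp
            show "upper k [c, c1]" using copy[OF push(4) n0] c r by (simp add: upper2)
            show "upper k [c', ?c1']" using copy[OF lys' n0'] c'' by (simp add: upper2)
          qed (rule u1 simc1)+
        next
          case False
          \<comment> \<open>The final top is traced below the copy, so the run must return there.
            The push and this return form the first piece.\<close>
          then have pp: "hist1 c c1 p = p" using hp by simp
          have pw: "take (n - k) p = toppath vs @ Suc (length b) # toppath ws2" using up tc pp y by simp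
          have nk: "n - k = length vs + Suc (length ws2)" using y lw by simp
          have "p \<in> leafpaths c" using hist1_leafpaths[OF s p(1)] pp by simp
          then have "p \<in> outer vs \<union> (\<lambda>p. toppath vs @ p) ` paths (Node ?X)"
            using paths_plug[of "Node ?X" vs] c r(2) by (simp add: leafpaths_def)
          moreover have "take (length vs) (take (n - k) p) = toppath vs" using pw by simp
          then have "take (length vs) p = toppath vs" using nk by (simp add: min_def)
          ultimately obtain \<pi> where pi: "\<pi> \<in> paths (Node ?X)" "p = toppath vs @ \<pi>"
            using outer_not_prefix[of p vs] by blast
          have pi2: "take (Suc (length ws2)) \<pi> = Suc (length b) # toppath ws2"
            using pw unfolding pi(2) nk by simp
          have c1c: "comps (hd (c1 # P2)) = ys @ ?X # vs" using r(3) by simp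
          have "trace (c1 # P2) (topc (last (c1 # P2))) = toppath vs @ \<pi>" using pi(2) p_def l1 by simp
          from return_exists[OF f1 c1c pi(1) this] obtain P1 d P3 where
            D: "c1 # P2 = P1 @ d # P3" "ret (P1 @ [d]) (length ys)"
              "take (length vs) (trace (d # P3) (topc (last (c1 # P2)))) = take (length vs) (topc d)" by blast
          have f1': "frun (P1 @ d # P3)" using f1 D(1) by simp
          have f2: "frun (P1 @ [d])" "frun (d # P3)" using f1' frun_append by blast+
          have hd1: "hd (P1 @ [d]) = c1" using D(1) by (cases P1) simp_all
          have hc: "comps (hd (P1 @ [d])) = ys @ ?X # vs" using hd1 r(3) by simp
          have l3: "last (c1 # P2) = last (d # P3)" using D(1) by simp
          have t3: "topc (last (c1 # P2)) \<in> leafpaths (last (d # P3))" unfolding l3 by (rule top_leafpath)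
          from return_position[OF f1' D(2) hc t3 D(3)] obtain zs vs3 \<pi>' where
            E: "comps d = zs @ vs3" "length zs = Suc (length ys)" "length vs3 = length vs"
              "stk (symb d) zs = Node ?X" 
              "trace (d # P3) (topc (last (c1 # P2))) = toppath vs3 @ \<pi>'"
              "trace (P1 @ d # P3) (topc (last (c1 # P2))) = toppath vs @ \<pi>'"
            by (elim exE conjE)
          have "toppath vs @ \<pi>' = toppath vs @ \<pi>" using E(6) D(1) p_def pi(2) l1 by simp
          then have pi': "\<pi>' = \<pi>" by simp
          have "zs = ys @ [b] \<and> symb d = g"
            using E(2,4) plug_inject[of zs "ys @ [b]" "symb d" g] by simp
          then have d: "d = (state d, g, ys @ b # vs3)" using E(1) by (simp add: prod_eq_iff)
          have nk3: "n - k = length vs3 + Suc (length ws2)" using nk E(3) by simp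
          have "take (n - k) (trace (d # P3) (topc (last (d # P3)))) = toppath vs3 @ Suc (length b) # toppath ws2"
            using E(5) l3 pi' pi2 unfolding nk3 by simp
          moreover have "topc d = toppath (us @ (ws2 @ b # vs3))" using d y(1) by (metis append_assoc snd_conv topc_def)
          then have "take (n - k) (topc d) = toppath vs3 @ Suc (length b) # toppath ws2" unfolding nk3 by simp
          ultimately have u3: "upper k (d # P3)" by (simp add: upper_def)
          have okd: "flat_ok d" using frun_all_ok[OF f2(1)] by simp
          have j: "length ys = j" using push(4) .
          have tr1: "flat_ok (hd (P1 @ [d]))" using hd1 ok1 by simp
          have hs: "state (hd (P1 @ [d])) = q'" "symb (hd (P1 @ [d])) = g'" using hd1 r(3) by simp_all
          have L2: "tyle (ys @ ?X # vs) (?ys' @ ?X' # vs')"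
            using lys y'(4) XX by (intro list_all2_appendI) (simp_all del: tys.simps)
          have tr2: "flat_ok (state (hd (P1 @ [d])), symb (hd (P1 @ [d])), ?ys' @ ?X' # vs')" unfolding hs by (rule okc1')
          have tr3: "tyl (comps (hd (P1 @ [d])) ! i) \<subseteq> tyl ((?ys' @ ?X' # vs') ! i)" if "i < n" for i
            unfolding hc using list_all2_nthD[OF L2, of i] that n0 by simp
          from return_transfer[OF D(2) tr1 tr2 tr3] obtain Q where
            Q: "ret Q j" "hd Q = ?c1'" "state (last Q) = state d" "val Q = val (P1 @ [d])"
              "\<forall>i. Suc j \<le> i \<longrightarrow> i < n \<longrightarrow> tyl (comps d ! i) \<subseteq> tyl (comps (last Q) ! i)"
            unfolding hs j by auto
          have okQ: "flat_ok (hd Q)" using Q(2) okc1' by simp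
          have fQ: "frun Q" using ret_frun[OF Q(1) okQ] .
          have "comps (hd Q) = ?ys' @ ?X' # vs'" using Q(2) by simp
          from ret_component[OF Q(1) okQ this lys' lys'] obtain vs4 where
            v4: "comps (last Q) = ?ys' @ b' # vs4" "symb (last Q) = g" "length vs4 = length vs'" by blast
          define d' where "d' = last Q"
          obtain Q' where Q': "Q = Q' @ [d']" using frun_ne[OF fQ] by (metis append_butlast_last_id d'_def)
          have okd': "flat_ok d'" using frun_all_ok[OF fQ] Q' by simp
          have cd: "comps d = ys @ b # vs3" "comps d' = ?ys' @ b' # vs4" using d v4 d'_def by (metis snd_conv, simp)
          have l4: "length vs4 = length vs3" using v4(3) E(3) list_all2_lengthD[OF y'(4)] by simp
          have v34: "tyle vs3 vs4"
          proof (rule list_all2_all_nthI)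
            fix i assume i: "i < length vs3"
            have "Suc j \<le> Suc j + i" "Suc j + i < n" using i E(3) nj by simp_all
            then have "tyl (comps d ! (Suc j + i)) \<subseteq> tyl (comps d' ! (Suc j + i))" using Q(5) d'_def by blast
            moreover have "comps d ! (Suc j + i) = vs3 ! i" unfolding cd by (rule nth_after[OF push(4)])
            moreover have "comps d' ! (Suc j + i) = vs4 ! i" unfolding cd by (rule nth_after[OF lys'])
            ultimately show "tyl (vs3 ! i) \<subseteq> tyl (vs4 ! i)" by simp
          qed (use l4 in simp)
          have simd: "sim k d d'" unfolding sim_def
          proof (intro conjI exI)
            show "comps d = us @ (ws2 @ b # vs3)" using cd(1) y(1) by simp
            show "comps d' = us @ (ws2' @ b' # vs4)" using cd(2) by simp
            show "tyle (ws2 @ b # vs3) (ws2' @ b' # vs4)"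
              using y'(2,3) v34 by (intro list_all2_appendI) (simp_all del: tys.simps)
            show "state d = state d'" "symb d = symb d'" using Q(3) d'_def v4(2) d by (simp, metis fst_conv snd_conv)
          qed (use okd okd' c(3) in simp_all)
          have "length (d # P3) < length P" using arg_cong[OF D(1), of length] ret_Cons2[OF D(2)] by (simp add: P)
          then have IH: "simulated k (d # P3) d'"
            using less(1)[of "d # P3" d'] f2(2) u3 simd by simp
          have okc: "flat_ok (q, g, ys @ b # vs)" using s(2) c r(2) by simp
          have pc1: "piece k ((c # P1) @ [d])"
            using loop_piece[OF r(1) push(4) okc D(2)[unfolded j] _ kj] hd1 r c by simp
          have okc': "flat_ok (q, g, ?ys' @ b' # vs')" using ok' y'(1) by simp
          have pc2: "piece k ((c' # Q') @ [d'])"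
            using loop_piece[OF r(1) lys' okc' Q(1,2) kj] Q' c'' by simp
          have Pd: "P = (c # P1) @ d # P3" using P D(1) by simp
          have fr1: "frun ((c # P1) @ d # P3)" using less(2) Pd by simp
          obtain e Q'' where e: "Q = e # Q''" using ret_Cons2[OF Q(1)] by auto
          have "frun (c' # Q)" using fQ st Q(2) ok' c unfolding e by (simp add: frun_Cons)
          then have fr2: "frun ((c' # Q') @ [d'])" using Q' by simp
          have ne: "Q \<noteq> []" "P1 @ [d] \<noteq> []" using e by simp_all
          have v: "val ((c' # Q') @ [d']) = val ((c # P1) @ [d])"
            using val_op[OF r(1) ne(1)] val_op[OF r(1) ne(2)] Q(4) Q' c by simp
          have "sim k (hd ((c # P1) @ [d])) (hd ((c' # Q') @ [d']))" using sc by simp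
          from sim_extend[OF fr1 fr2 pc1 pc2 v this IH] show ?thesis unfolding Pd by simp
        qed
      qed
    qed
  qed
qed

end

section \<open>Pumping along a milestone\<close>

context dpda
begin

lemma fstep_deterministic:
  assumes "\<delta> (state c) (symb c) = Op q op" "flat_ok c" "fstep c d" "fstep c d'"
  shows "d = d'"
proof (rule conf_inject)
  show "flat_ok d" "flat_ok d'" using fstep_ok assms(2-4) by blast+
  have s: "step n \<delta> (conf c) (conf d)" "step n \<delta> (conf c) (conf d')"
    using step_conf[OF assms(2)] assms(3,4) by blast+
  show "conf d = conf d'"
    using s unfolding step_def conf_simps assms(1)
    by (cases op) (auto simp: prod_eq_iff)
qed

lemma fstep_Read:
  assumes "\<delta> (state c) (symb c) = Read h" "fstep c d"
  shows "\<exists>a. d = (h a, symb c, comps c) \<and> step_letters \<delta> (conf c) (conf d) = [a]"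
  using assms(2)
proof cases
  case (read q g f xs a)
  then have "h = f" using assms(1) by simp
  moreover have "step_letters \<delta> (conf (q, g, xs)) (conf (f a, g, xs)) = [a]"
    by (rule step_letters_read[of \<delta> q g f xs a g xs, OF read(3) readD[OF read(3)]])
  ultimately show ?thesis using read by simp
qed (use assms in auto)

lemma leafpath_cases:
  assumes "p \<in> leafpaths c" "p \<noteq> topc c"
  shows "\<exists>ys x vs \<pi>. comps c = ys @ x # vs \<and> \<pi> \<in> paths (Node x) \<and> p = toppath vs @ \<pi>"
proof -
  have "p \<in> outer (comps c)" using assms unfolding leafpaths_def paths_plug topc_def by simp
  from outer_cases[OF this] obtain ys x vs i \<pi> where
    "comps c = ys @ x # vs" "i < length x" "\<pi> \<in> paths (x ! i)" "p = toppath vs @ Suc i # \<pi>" by blast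
  moreover from calculation have "Suc i # \<pi> \<in> paths (Node x)" by auto
  ultimately show ?thesis by blast
qed

lemma take_eq_mono: "take b u = take b v \<Longrightarrow> a \<le> b \<Longrightarrow> take a u = take a v"
proof -
  assume "take b u = take b v" "a \<le> b"
  then have "take a (take b u) = take a (take b v)" "min a b = a" by simp_all
  then show ?thesis unfolding take_take by simp
qed

lemma upper_mono: "upper k P \<Longrightarrow> k \<le> l \<Longrightarrow> upper l P"
  unfolding upper_def by (rule take_eq_mono) auto

lemma frun_join:
  assumes "frun P" "frun Q" "last P = hd Q"
  shows "frun (P @ tl Q)"
proof -
  obtain P' where P: "P = P' @ [last P]" using frun_ne[OF assms(1)] by (metis append_butlast_last_id)
  obtain Q' where Q: "Q = hd Q # Q'" using frun_ne[OF assms(2)] by (cases Q) auto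
  have "frun (P' @ last P # Q')" using frun_append[of P' "last P" Q'] P Q assms by metis
  then show ?thesis using P Q by (metis append.assoc append_Cons append_Nil list.sel(3))
qed

lemma last_join: "frun Q \<Longrightarrow> last P = hd Q \<Longrightarrow> P \<noteq> [] \<Longrightarrow> last (P @ tl Q) = last Q"
  by (cases Q) (auto simp: frun_def)

lemma run_word_join:
  assumes "P \<noteq> []" "Q \<noteq> []" "last P = hd Q"
  shows "run_word \<delta> (map conf (P @ tl Q)) = run_word \<delta> (map conf P) @ run_word \<delta> (map conf Q)"
proof -
  obtain P' where P: "P = P' @ [last P]" using assms(1) by (metis append_butlast_last_id)
  obtain Q' where Q: "Q = last P # Q'" using assms(2,3) by (cases Q) auto
  have "run_word \<delta> (map conf P' @ conf (last P) # map conf Q') =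
     run_word \<delta> (map conf P' @ [conf (last P)]) @ run_word \<delta> (conf (last P) # map conf Q')"
    by (rule run_word_append)
  moreover have "map conf (P @ tl Q) = map conf P' @ conf (last P) # map conf Q'"
    by (subst P, subst Q) simp
  moreover have "map conf P = map conf P' @ [conf (last P)]" by (subst P) simp
  moreover have "map conf Q = conf (last P) # map conf Q'" by (subst Q) simp
  ultimately show ?thesis by simp
qed

end

context dpda_fin
begin

lemma val_join:
  "P \<noteq> [] \<Longrightarrow> Q \<noteq> [] \<Longrightarrow> last P = hd Q \<Longrightarrow> val (P @ tl Q) = val P * val Q"
  unfolding val_def by (subst run_word_join) (simp_all add: phi_append)

lemma val_split:
  assumes "i < length P" shows "val P = val (take (Suc i) P) * val (drop i P)"
  using val_append[of "take i P" "P ! i" "drop (Suc i) P"] assms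
  by (simp add: Cons_nth_drop_Suc take_Suc_conv_app_nth)

text \<open>Equal components have equal types, so a part of the common top may be counted among the
  components beyond it.\<close>

lemma sim_mono:
  assumes "sim l c d" "k \<le> l" shows "sim k c d"
proof -
  obtain us ws ws' where a: "comps c = us @ ws" "comps d = us @ ws'" "length us = l"
      "tyle ws ws'"
    using assms(1) unfolding sim_def by blast
  have "comps c = take k us @ (drop k us @ ws)" "comps d = take k us @ (drop k us @ ws')"
    using a by simp_all
  moreover have "tyle (drop k us) (drop k us)" by (simp add: list_all2_refl)
  then have "tyle (drop k us @ ws) (drop k us @ ws')"
    using a(4) by (rule list_all2_appendI)
  moreover have "length (take k us) = k" using a(3) assms(2) by simp
  ultimately show ?thesis using assms(1) unfolding sim_def by blast
qed

end

section \<open>The infinite run of a milestone and its recurrent indices\<close>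

locale ray = dpda_fin n \<delta> \<phi>
  for n :: nat and \<delta> :: "'q::finite \<Rightarrow> 'g::finite \<Rightarrow> ('q, 'a, 'g) transition"
    and \<phi> :: "'a list \<Rightarrow> 'm::{monoid_mult, finite}" +
  fixes f :: "nat \<Rightarrow> ('q, 'g) flat" and star :: 'a and I :: "nat set"
  assumes ok: "\<And>i. flat_ok (f i)"
    and fstep_f: "\<And>i. fstep (f i) (f (Suc i))"
    and stars: "\<And>i. set (step_letters \<delta> (conf (f i)) (conf (f (Suc i)))) \<subseteq> {star}"
    and inf: "infinite I" and zero: "0 \<in> I"
    and upper_I: "\<And>i j. i \<in> I \<Longrightarrow> j \<in> I \<Longrightarrow> i \<le> j \<Longrightarrow> upper 0 (map f [i..<Suc j])"
begin

definition seg :: "nat \<Rightarrow> nat \<Rightarrow> ('q, 'g) flat list" where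
  "seg i j = map f [i..<Suc j]"

lemma length_seg [simp]: "length (seg i j) = Suc j - i"
  by (simp add: seg_def del: upt_Suc)

lemma seg_Cons: "i \<le> j \<Longrightarrow> seg i j = f i # map f [Suc i..<Suc j]"
  by (simp add: seg_def upt_conv_Cons del: upt_Suc)

lemma seg_Suc: "i \<le> Suc j \<Longrightarrow> seg i (Suc j) = seg i j @ [f (Suc j)]"
  by (simp add: seg_def)

lemma seg_snoc: "i \<le> j \<Longrightarrow> seg i j = map f [i..<j] @ [f j]"
  by (simp add: seg_def)

lemma hd_seg [simp]: "i \<le> j \<Longrightarrow> hd (seg i j) = f i"
  by (simp add: seg_Cons)

lemma last_seg [simp]: "i \<le> j \<Longrightarrow> last (seg i j) = f j"
  by (simp add: seg_snoc)

lemma seg_ne: "i \<le> j \<Longrightarrow> seg i j \<noteq> []"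
  by (simp add: seg_Cons)

lemma frun_seg: "i \<le> j \<Longrightarrow> frun (seg i j)"
proof (induction j)
  case 0
  then show ?case using ok by (simp add: seg_def)
next
  case (Suc j)
  show ?case
  proof (cases "i = Suc j")
    case True
    then show ?thesis using ok by (simp add: seg_def)
  next
    case False
    then have le: "i \<le> j" using Suc(2) by simp
    have "frun (map f [i..<j] @ f j # [f (Suc j)])"
      unfolding frun_append[of _ "f j" "[f (Suc j)]"] using Suc(1)[OF le] seg_snoc[OF le] ok fstep_f
      by (simp add: frun_Cons)
    then show ?thesis using seg_Suc[of i j] seg_snoc[OF le] le by simp
  qed
qed

definition word :: "nat \<Rightarrow> 'a list" where
  "word j = run_word \<delta> (map conf (seg 0 j))"

lemma word_Suc: "word (Suc j) = word j @ step_letters \<delta> (conf (f j)) (conf (f (Suc j)))"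
proof -
  have "run_word \<delta> (map conf (map f [0..<j]) @ conf (f j) # [conf (f (Suc j))]) =
    run_word \<delta> (map conf (map f [0..<j]) @ [conf (f j)]) @ run_word \<delta> (conf (f j) # [conf (f (Suc j))])"
    by (rule run_word_append)
  then show ?thesis by (simp add: word_def seg_def run_word_Cons)
qed

lemma word_mono: "i \<le> j \<Longrightarrow> length (word i) \<le> length (word j)"
  by (induction j rule: dec_induct) (simp_all add: word_Suc)

lemma word_stars: "word j = replicate (length (word j)) star"
proof (induction j)
  case 0
  then show ?case by (simp add: word_def seg_def)
next
  case (Suc j)
  let ?s = "step_letters \<delta> (conf (f j)) (conf (f (Suc j)))"
  have "?s = replicate (length ?s) star" using stars[of j] by (intro replicate_eqI) auto
  then show ?case using Suc unfolding word_Suc by (metis length_append replicate_add)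
qed

text \<open>While fewer than b letters have been read, the next letter of \<open>R\<close>, if there
  is one, is a star, and steps that read nothing are deterministic. \<open>R\<close> cannot end
  here, since its word has at least b letters.\<close>

lemma follow:
  assumes R: "frun R" "hd R = f 0" "take b (run_word \<delta> (map conf R)) = replicate b star"
  shows "length (word m) < b \<Longrightarrow> m < length R \<and> take (Suc m) R = seg 0 m"
proof (induction m)
  case 0
  then show ?case using R by (cases R) (simp_all add: frun_def seg_def)
next
  case (Suc m)
  have lm: "length (word m) < b" using Suc(2) by (simp add: word_Suc)
  then have m: "m < length R" "take (Suc m) R = seg 0 m" using Suc(1) by blast+
  show ?case
  proof (cases "Suc m < length R")
    case False
    then have "R = seg 0 m" using m by simp
    then have "take b (word m) = replicate b star" using R(3) by (simp add: word_def)
    then have "length (word m) \<ge> b" by (metis length_replicate length_take min.cobounded1)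
    then show ?thesis using lm by simp
  next
    case True
    let ?d = "R ! Suc m"
    have tk: "take (Suc (Suc m)) R = seg 0 m @ [?d]" using True m(2) by (simp add: take_Suc_conv_app_nth)
    have sp: "R = map f [0..<m] @ f m # ?d # drop (Suc (Suc m)) R"
    proof -
      have "R = take (Suc (Suc m)) R @ drop (Suc (Suc m)) R" by simp
      then show ?thesis unfolding tk using seg_snoc[of 0 m] by simp
    qed
    have "frun (map f [0..<m] @ f m # ?d # drop (Suc (Suc m)) R)" unfolding sp[symmetric] by (rule R(1))
    then have "frun (f m # ?d # drop (Suc (Suc m)) R)" using frun_append by blast
    then have st: "fstep (f m) ?d" by (simp add: frun_Cons)
    have "?d = f (Suc m)"
    proof (cases "\<delta> (state (f m)) (symb (f m))")
      case (Op q op)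
      then show ?thesis using fstep_deterministic[OF Op ok st fstep_f] by simp
    next
      case (Read h)
      obtain a where a: "?d = (h a, symb (f m), comps (f m))"
        "step_letters \<delta> (conf (f m)) (conf ?d) = [a]" using fstep_Read[OF Read st] by blast
      obtain a' where a': "f (Suc m) = (h a', symb (f m), comps (f m))"
        "step_letters \<delta> (conf (f m)) (conf (f (Suc m))) = [a']" using fstep_Read[OF Read fstep_f] by blast
      have "a' = star" using stars[of m] a'(2) by simp
      moreover have "a = star"
      proof -
        let ?r = "map conf (drop (Suc (Suc m)) R)"
        have "run_word \<delta> (map conf R) = run_word \<delta> (map conf (map f [0..<m] @ f m # ?d # drop (Suc (Suc m)) R))"
          unfolding sp[symmetric] ..
        also have "\<dots> = run_word \<delta> (map conf (map f [0..<m]) @ conf (f m) # conf ?d # ?r)" by simp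
        also have "\<dots> = word m @ run_word \<delta> (conf (f m) # conf ?d # ?r)"
          using run_word_append[of \<delta> "map conf (map f [0..<m])" "conf (f m)" "conf ?d # ?r"]
          by (simp add: word_def seg_def)
        also have "\<dots> = word m @ a # run_word \<delta> (conf ?d # ?r)"
          by (simp add: run_word_Cons a(2))
        finally have "run_word \<delta> (map conf R) ! length (word m) = a" by simp
        moreover have "run_word \<delta> (map conf R) ! length (word m) = take b (run_word \<delta> (map conf R)) ! length (word m)"
          using lm by simp
        ultimately show ?thesis using R(3) lm by simp
      qed
      ultimately show ?thesis using a(1) a'(1) by simp
    qed
    then show ?thesis using True tk seg_Suc[of 0 m] by simp
  qed
qed

text \<open>What can be exposed and is already fixed at index \<open>t\<close>: an unpacked
  component of \<open>f t\<close>, or merely a symbol, which serves for k = 0. Unpacking is unique,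
  whence the finiteness below.\<close>

definition goal_tops :: "nat \<Rightarrow> ('g \<times> 'g stack list list) set" where
  "goal_tops t = range (\<lambda>g. (g, [])) \<union>
     (\<Union>d<n. {z. length (snd z) = Suc d \<and> stk (fst z) (snd z) = Node (comps (f t) ! d)})"

lemma finite_goal_tops: "finite (goal_tops t)"
proof -
  have "finite {z. length (snd z) = Suc d \<and> stk (fst z) (snd z) = s}" (is "finite ?A")
    for d and s :: "'g stack"
  proof (cases "?A = {}")
    case False
    then obtain z where z: "z \<in> ?A" by blast
    have "?A \<subseteq> {z}"
    proof
      fix y assume "y \<in> ?A"
      then have l: "length (snd y) = length (snd z)"
        and p: "stk (fst y) (snd y) = stk (fst z) (snd z)" using z by auto
      have "fst y = fst z \<and> snd y = snd z" using p unfolding plug_inject[OF l] .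
      then show "y \<in> {z}" by (simp add: prod_eq_iff)
    qed
    then show ?thesis using finite_subset by blast
  next
    case True
    show ?thesis unfolding True by (rule finite.emptyI)
  qed
  then have "finite (\<Union>d<n. {z. length (snd z) = Suc d \<and> stk (fst z) (snd z) = Node (comps (f t) ! d)})"
    by (intro finite_UN_I finite_lessThan)
  moreover have "finite (range (\<lambda>g :: 'g. (g, [] :: 'g stack list list)))" by (intro finite_imageI finite)
  ultimately show ?thesis unfolding goal_tops_def by (intro finite_UnI)
qed

text \<open>What has to be reproduced when another index replaces \<open>j\<close>: state, exposed
  stack and value exactly, the remaining components by type. All runs from \<open>f j\<close> are
  collected, so that the index can be chosen before \<open>R\<close> is known.\<close>

definition outcomes :: "nat \<Rightarrow> nat \<Rightarrow>
    ('q \<times> ('g \<times> 'g stack list list) \<times> ('q, 'm) tok fset list \<times> 'm) set" where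
  "outcomes t j = {z. \<exists>q g us P ws. z = (q, (g, us), map tyf ws, val P) \<and> (g, us) \<in> goal_tops t \<and>
     frun P \<and> hd P = f j \<and> last P = (q, g, us @ ws)}"

text \<open>For fixed \<open>t\<close> all outcomes are subsets of one finite set, independently of
  \<open>j\<close>.\<close>

lemma finite_outcomes_range: "finite (range (outcomes t))"
proof -
  let ?W = "(UNIV :: 'q set) \<times> goal_tops t \<times> (\<Union>r\<le>n. {As :: ('q, 'm) tok fset list. okl (n - r) As}) \<times> (UNIV :: 'm set)"
  have "outcomes t j \<subseteq> ?W" for j
  proof
    fix z assume "z \<in> outcomes t j"
    then obtain q g us P ws where z: "z = (q, (g, us), map tyf ws, val P)" "(g, us) \<in> goal_tops t"
      "frun P" "last P = (q, g, us @ ws)" unfolding outcomes_def mem_Collect_eq by (elim exE conjE)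
    have "flat_ok (q, g, us @ ws)" using frun_all_ok[OF z(3) last_in_set[OF frun_ne[OF z(3)]]] unfolding z(4) .
    then have l: "comps_ok (us @ ws)" "length (us @ ws) = n" by (simp_all add: flat_ok_def)
    have "okl n (map tyf us @ map tyf ws)" using okl_tyf[OF l] by simp
    from okl_append[OF this] have "okl (n - length us) (map tyf ws)" by simp
    moreover have "length us \<le> n" using l(2) by simp
    ultimately show "z \<in> ?W" unfolding z(1) using z(2) by (intro SigmaI UNIV_I UN_I[of "length us"]) simp_all
  qed
  then have "range (outcomes t) \<subseteq> Pow ?W" by blast
  moreover have "finite ?W"
    using finite_goal_tops finite_okl by (intro finite_cartesian_product finite_UN_I) simp_all
  ultimately show ?thesis using finite_subset finite_Pow_iff by blast
qed

definition kind :: "nat \<Rightarrow> nat \<Rightarrow> 'm \<times> ('q \<times> ('g \<times> 'g stack list list) \<times> ('q, 'm) tok fset list \<times> 'm) set" where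
  "kind t j = (val (seg 0 j), outcomes t j)"

lemma recurrent_index: "\<exists>j\<in>I. t < j \<and> infinite {i \<in> I. kind t i = kind t j}"
proof -
  let ?J = "{j \<in> I. t < j}"
  have "I \<subseteq> ?J \<union> {..t}" by auto
  then have J: "infinite ?J" using inf finite_subset[of I "?J \<union> {..t}"] by blast
  have "finite (range (kind t))"
  proof (rule finite_subset)
    show "range (kind t) \<subseteq> UNIV \<times> range (outcomes t)" by (auto simp: kind_def)
    show "finite ((UNIV :: 'm set) \<times> range (outcomes t))" using finite_outcomes_range by simp
  qed
  then have "finite (kind t ` ?J)" by (rule finite_subset[OF image_mono[OF subset_UNIV]])
  from pigeonhole_infinite[OF J this] obtain j where j: "j \<in> ?J" "infinite {i \<in> ?J. kind t i = kind t j}"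
    by blast
  have "{i \<in> ?J. kind t i = kind t j} \<subseteq> {i \<in> I. kind t i = kind t j}" by auto
  then show ?thesis using j finite_subset by blast
qed

lemma recurrent_chain:
  "\<exists>idx :: nat \<Rightarrow> nat. idx 0 = 0 \<and> (\<forall>i. idx i \<in> I \<and> idx i < idx (Suc i) \<and>
     infinite {j \<in> I. kind (idx i) j = kind (idx i) (idx (Suc i))})"
proof -
  define nx where "nx t = (SOME j. j \<in> I \<and> t < j \<and> infinite {i \<in> I. kind t i = kind t j})" for t
  have nx: "nx t \<in> I \<and> t < nx t \<and> infinite {i \<in> I. kind t i = kind t (nx t)}" for t
    unfolding nx_def by (rule someI_ex) (use recurrent_index[of t] in blast)
  define idx where "idx = rec_nat 0 (\<lambda>_. nx)"
  have s: "idx 0 = 0" "idx (Suc i) = nx (idx i)" for i by (simp_all add: idx_def)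
  have "idx i \<in> I" for i
  proof (cases i)
    case 0
    then show ?thesis using zero s(1) by simp
  next
    case (Suc j)
    then show ?thesis using nx[of "idx j"] s(2)[of j] by simp
  qed
  then have "idx i \<in> I \<and> idx i < idx (Suc i) \<and>
     infinite {j \<in> I. kind (idx i) j = kind (idx i) (idx (Suc i))}" for i
    unfolding s(2) using nx[of "idx i"] by blast
  then show ?thesis using s(1) by blast
qed

section \<open>Exchanging an index of the ray\<close>

definition pumped :: "nat \<Rightarrow> nat \<Rightarrow> ('q, 'g) config list \<Rightarrow> ('q, 'g) config list \<Rightarrow> bool" where
  "pumped k l R R' \<longleftrightarrow> (\<exists>S S'. is_run n \<delta> S \<and> hd S = conf (f 0) \<and> is_run n \<delta> S' \<and> hd S' = last S \<and>
     \<phi> (run_word \<delta> S) = \<phi> (run_word \<delta> R) \<and> take l (run_word \<delta> S) = replicate l star \<and>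
     parallel n \<delta> \<phi> k S' R')"

text \<open>At time \<open>e\<close>, not before \<open>j\<close>, the run \<open>R\<close> has
  exposed a stack fixed at \<open>t\<close>. The new run follows the ray to a later index of the
  kind of \<open>j\<close>, takes a run with the same outcome instead of the part of
  \<open>R\<close> from \<open>j\<close> to \<open>e\<close>, and then simulates the rest of
  \<open>R\<close>. As k \<le> r, it ends in a configuration from which \<open>R'\<close> can be
  simulated.\<close>

lemma finish:
  assumes R: "frun R" "hd R = f 0" "take (Suc j) R = seg 0 j"
    and R': "frun R'" "hd R' = last R" "upper k R'"
    and rec: "infinite {i \<in> I. kind t i = kind t j}"
    and e: "j \<le> e" "e < length R" "upper r (drop e R)" "k \<le> r" "r \<le> n"
    and tops: "(symb (R ! e), take r (comps (R ! e))) \<in> goal_tops t"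
    and unbounded: "l \<le> length (word m)"
  shows "pumped k l (map conf R) (map conf R')"
proof -
  have jl: "j < length R" using e by simp
  let ?P = "take (Suc (e - j)) (drop j R)"
  have fd: "frun (drop j R)" using frun_drop[OF R(1) jl] .
  have fP: "frun ?P" using frun_take[OF fd, of "e - j"] e by simp
  have fE: "frun (drop e R)" using frun_drop[OF R(1) e(2)] .
  have "R ! j = take (Suc j) R ! j" by simp
  also have "\<dots> = f j" unfolding R(3) by (simp add: seg_def del: upt_Suc)
  finally have Rj: "R ! j = f j" .
  have hP: "hd ?P = f j" using jl Rj by (simp add: hd_drop_conv_nth hd_take)
  have lP: "last ?P = R ! e"
  proof -
    have "take (Suc (e - j)) (drop j R) = take (e - j) (drop j R) @ [drop j R ! (e - j)]"
      using e by (intro take_Suc_conv_app_nth) simp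
    then show ?thesis using e by simp
  qed
  have okE: "flat_ok (R ! e)" using frun_all_ok[OF R(1)] e(2) by simp
  let ?c = "R ! e"
  have cE: "comps ?c = take r (comps ?c) @ drop r (comps ?c)" by simp
  let ?z = "(state ?c, (symb ?c, take r (comps ?c)), map tyf (drop r (comps ?c)), val ?P)"
  have "?z \<in> outcomes t j" unfolding outcomes_def mem_Collect_eq
    using fP hP lP tops by (intro exI conjI) (rule refl, assumption+, simp add: prod_eq_iff)
  obtain i where i: "kind t i = kind t j" "m \<le> i"
  proof -
    have "\<not> {i \<in> I. kind t i = kind t j} \<subseteq> {..m}" using rec finite_subset by blast
    then show ?thesis using that by (metis (mono_tags, lifting) atMost_iff mem_Collect_eq nat_le_linear subsetI)
  qed
  have ki: "val (seg 0 i) = val (seg 0 j)" "outcomes t i = outcomes t j" using i(1) by (simp_all add: kind_def)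
  have "?z \<in> outcomes t i" using \<open>?z \<in> outcomes t j\<close> ki(2) by simp
  then obtain q g us Q ws where Q: "?z = (q, (g, us), map tyf ws, val Q)" "frun Q" "hd Q = f i"
      "last Q = (q, g, us @ ws)" unfolding outcomes_def mem_Collect_eq by (elim exE conjE)
  define c' where "c' = (q, g, us @ ws)"
  have q: "q = state ?c" "g = symb ?c" "us = take r (comps ?c)" "map tyf ws = map tyf (drop r (comps ?c))"
    "val Q = val ?P" using Q(1) by simp_all
  have okc': "flat_ok c'" using frun_all_ok[OF Q(2) last_in_set[OF frun_ne[OF Q(2)]]] unfolding Q(4) c'_def .
  have lr: "length (take r (comps ?c)) = r" using okE e(5) by (simp add: flat_ok_def)
  have lw: "length ws = length (drop r (comps ?c))" using arg_cong[OF q(4), of length] by simp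
  have "tyle (drop r (comps ?c)) ws"
  proof (rule list_all2_all_nthI)
    fix i assume i: "i < length (drop r (comps ?c))"
    have "tyf (ws ! i) = tyf (drop r (comps ?c) ! i)"
      using arg_cong[OF q(4), of "\<lambda>x. x ! i"] i lw by simp
    moreover have "fset (tyf (drop r (comps ?c) ! i)) = tyl (drop r (comps ?c) ! i)"
      using fset_tyf_comps[of "comps ?c" "r + i"] okE i by (simp add: flat_ok_def del: tys.simps)
    moreover have "fset (tyf (ws ! i)) = tyl (ws ! i)"
      using fset_tyf_comps[of "us @ ws" "r + i"] okc' i lw lr q(3)
      by (simp add: flat_ok_def c'_def nth_append del: tys.simps)
    ultimately show "tyl (drop r (comps ?c) ! i) \<subseteq> tyl (ws ! i)" by simp
  qed (use lw in simp)
  then have sm: "sim r ?c c'" unfolding sim_def using okE okc' q lr cE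
    by (intro conjI exI[of _ "take r (comps ?c)"] exI[of _ "drop r (comps ?c)"] exI[of _ ws])
      (simp_all add: c'_def del: tys.simps)
  have hE: "hd (drop e R) = ?c" using e(2) by (simp add: hd_drop_conv_nth)
  from simulate[OF fE e(3)] sm obtain T where T: "frun T" "hd T = c'" "sim r (last (drop e R)) (last T)"
    "val T = val (drop e R)" unfolding hE by blast
  have "last (drop e R) = last R" using e(2) by simp
  then have "sim k (hd R') (last T)" using sim_mono[OF T(3) e(4)] R'(2) by simp
  from simulate[OF R'(1,3) this] obtain S' where
    S': "frun S'" "hd S' = last T" "parallel n \<delta> \<phi> k (map conf S') (map conf R')" by blast
  let ?S1 = "seg 0 i @ tl Q"
  let ?S = "?S1 @ tl T"
  have s0: "frun (seg 0 i)" "last (seg 0 i) = hd Q" "hd (seg 0 i) = f 0" "seg 0 i \<noteq> []"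
    using frun_seg Q(3) seg_ne by simp_all
  have s1: "frun ?S1" "last ?S1 = hd T" using frun_join[OF s0(1) Q(2) s0(2)]
      last_join[OF Q(2) s0(2,4)] Q(4) T(2) by (simp_all add: c'_def)
  have ne: "Q \<noteq> []" "T \<noteq> []" "?S1 \<noteq> []" using frun_ne Q(2) T(1) s0(4) by auto
  have fS: "frun ?S" using frun_join[OF s1(1) T(1) s1(2)] .
  have lS: "last ?S = last T" using last_join[OF T(1) s1(2) ne(3)] .
  have hS: "hd ?S = f 0" using s0(3,4) by simp
  have "val ?S = val (seg 0 i) * val Q * val T"
    using val_join[OF ne(3,2) s1(2)] val_join[OF s0(4) ne(1) s0(2)] by simp
  also have "\<dots> = val (seg 0 j) * (val ?P * val (drop e R))"
    using ki(1) q(5) T(4) by (simp add: mult.assoc)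
  also have "val ?P * val (drop e R) = val (drop j R)"
    using val_split[of "e - j" "drop j R"] e by simp
  also have "val (seg 0 j) * val (drop j R) = val R" using val_split[OF jl] R(3) by simp
  finally have vS: "val ?S = val R" .
  have "run_word \<delta> (map conf ?S) = run_word \<delta> (map conf ?S1) @ run_word \<delta> (map conf T)"
    by (rule run_word_join[OF ne(3,2) s1(2)])
  also have "run_word \<delta> (map conf ?S1) = word i @ run_word \<delta> (map conf Q)"
    unfolding word_def by (rule run_word_join[OF s0(4) ne(1) s0(2)])
  finally have wS: "run_word \<delta> (map conf ?S) = word i @ run_word \<delta> (map conf Q) @ run_word \<delta> (map conf T)" by simp
  have "l \<le> length (word i)" using unbounded word_mono[OF i(2)] by simp
  moreover have "take l (word i) = take l (replicate (length (word i)) star)" using word_stars[of i] by simp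
  ultimately have tS: "take l (run_word \<delta> (map conf ?S)) = replicate l star" unfolding wS by simp
  have neS: "?S \<noteq> []" "S' \<noteq> []" using frun_ne fS S'(1) by blast+
  have "hd (map conf ?S) = conf (f 0)" using hS hd_map[OF neS(1), of conf] by simp
  moreover have "hd (map conf S') = last (map conf ?S)"
    using hd_map[OF neS(2), of conf] last_map[OF neS(1), of conf] S'(2) lS by simp
  moreover have "\<phi> (run_word \<delta> (map conf ?S)) = \<phi> (run_word \<delta> (map conf R))" using vS by (simp add: val_def)
  ultimately show ?thesis unfolding pumped_def using frun_is_run[OF fS] frun_is_run[OF S'(1)] tS S'(3)
    by (intro exI[of _ "map conf ?S"] exI[of _ "map conf S'"] conjI)
qed

text \<open>If the exchange were impossible at every stage, the indices \<open>idx 0\<close> to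
  \<open>idx n\<close> would belong to components of strictly increasing levels, all below
  n.\<close>

lemma pumping_flat:
  assumes idx: "idx 0 = 0" "\<And>i. idx i \<in> I" "\<And>i. idx i < idx (Suc i)"
    "\<And>i. infinite {j \<in> I. kind (idx i) j = kind (idx i) (idx (Suc i))}"
    and R: "frun R" "hd R = f 0" "idx n < length R" "take (Suc (idx n)) R = seg 0 (idx n)"
    and R': "frun R'" "hd R' = last R" "upper k R'"
    and k: "k \<le> n" "k = 0 \<or> \<not> upper (k - 1) R"
    and m: "l \<le> length (word m)"
  shows "pumped k l (map conf R) (map conf R')"
    (is ?thesis)
proof -
  have n: "1 \<le> n" using is_dpda by (simp add: is_dpda_def)
  have mono: "idx i \<le> idx j" if "i \<le> j" for i j
    using that
  proof (induction j rule: dec_induct)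
    case (step m)
    then show ?case using idx(3)[of m] by simp
  qed simp
  have tk: "take (Suc j) R = seg 0 j" if "j \<le> idx n" for j
  proof -
    have "take (Suc j) R = take (Suc j) (take (Suc (idx n)) R)" using that by (simp add: min_def)
    then show ?thesis unfolding R(4) using that by (simp add: seg_def take_map take_upt del: upt_Suc)
  qed
  have nth: "R ! j = f j" if "j \<le> idx n" for j
  proof -
    have "R ! j = take (Suc j) R ! j" by simp
    then show ?thesis unfolding tk[OF that] by (simp add: seg_def del: upt_Suc)
  qed
  let ?t = "topc (last R)"
  show ?thesis
  proof (cases "k = 0")
    case True
    have i1: "idx 1 \<le> idx n" using mono n by simp
    \<comment> \<open>For k = 0 it suffices to keep the final top symbol, so the whole rest of
      \<open>R\<close> is exchanged, with r = 0.\<close>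
    define e where "e = length R - 1"
    have e: "e < length R" "idx 1 \<le> e" using R(3) i1 by (auto simp: e_def)
    have "drop e R = [last R]"
    proof -
      have "R = butlast R @ [last R]" using frun_ne[OF R(1)] by simp
      moreover have "length (butlast R) = e" by (simp add: e_def)
      ultimately show ?thesis by (metis append_eq_conv_conj)
    qed
    then have u: "upper 0 (drop e R)" by (simp add: upper_def)
    have "(symb (R ! e), take 0 (comps (R ! e))) \<in> goal_tops (idx 0)" by (simp add: goal_tops_def)
    from finish[OF R(1,2) tk[OF i1] R' _ e(2,1) u _ _ this m] idx(4)[of 0] True show ?thesis by simp
  next
    case False
    then have nu: "\<not> upper (k - 1) R" using k(2) by simp
    show ?thesis
    proof (rule ccontr)
      assume no: "\<not> ?thesis"
      \<comment> \<open>Seen from \<open>idx i\<close>, the final top is traced into component d.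
        The bound on k allows r = d+1 in \<open>finish\<close>.\<close>
      define good where "good d i \<longleftrightarrow> k \<le> Suc d \<and> (\<exists>ys x vs \<pi>. comps (f (idx i)) = ys @ x # vs \<and> length ys = d \<and>
        \<pi> \<in> paths (Node x) \<and> trace (drop (idx i) R) ?t = toppath vs @ \<pi>)" for d i
      have facts: "idx i < length R" "frun (drop (idx i) R)" "hd (drop (idx i) R) = f (idx i)"
        "last (drop (idx i) R) = last R" "trace (drop (idx i) R) ?t \<in> leafpaths (f (idx i))" if "i \<le> n" for i
      proof -
        have le: "idx i \<le> idx n" using mono[OF that] .
        then show a: "idx i < length R" using R(3) by simp
        then show b: "frun (drop (idx i) R)" "hd (drop (idx i) R) = f (idx i)" "last (drop (idx i) R) = last R"
          using frun_drop[OF R(1)] nth[OF le] by (simp_all add: hd_drop_conv_nth)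
        have "?t \<in> leafpaths (last (drop (idx i) R))" unfolding b(3) by (rule top_leafpath)
        from trace_leafpaths[OF b(1) this] show "trace (drop (idx i) R) ?t \<in> leafpaths (f (idx i))"
          unfolding b(2) .
      qed
      have level: "length vs = n - Suc (length ys)" "length ys < n" if "comps (f j) = ys @ x # vs" for j ys x vs
        using ok[of j] that by (auto simp: flat_ok_def)
      \<comment> \<open>Up to \<open>idx i\<close> the run is 0-upper, hence (k-1)-upper. Upper runs
        compose, so the remaining part is not (k-1)-upper, and its final top is traced outside the
        topmost (k-1)-stack.\<close>
      have ex: "\<exists>d. good d i" if i: "i \<le> n" for i
      proof -
        let ?a = "idx i"
        note F = facts[OF i]
        have "upper 0 (seg 0 ?a)" using upper_I[OF zero idx(2)] by (simp add: seg_def)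
        then have "upper (k - 1) (seg 0 ?a)" using upper_mono by blast
        then have u0: "upper (k - 1) (map f [0..<?a] @ [f ?a])" using seg_snoc[of 0 ?a] by simp
        have sp: "map f [0..<?a] @ f ?a # drop (Suc ?a) R = R"
        proof -
          have "take (Suc ?a) R @ drop (Suc ?a) R = R" by simp
          then show ?thesis unfolding tk[OF mono[OF i]] using seg_snoc[of 0 ?a] by simp
        qed
        have dr: "drop ?a R = f ?a # drop (Suc ?a) R" using F(1) nth[OF mono[OF i]] by (simp add: Cons_nth_drop_Suc[symmetric])
        have nu': "\<not> upper (k - 1) (drop ?a R)"
        proof
          assume "upper (k - 1) (drop ?a R)"
          then have u1: "upper (k - 1) (f ?a # drop (Suc ?a) R)" unfolding dr .
          have "frun (map f [0..<?a] @ f ?a # drop (Suc ?a) R)" unfolding sp by (rule R(1))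
          from upper_append[OF this u0 u1] show False using nu unfolding sp by blast
        qed
        have np: "take (n - (k - 1)) (trace (drop ?a R) ?t) \<noteq> take (n - (k - 1)) (topc (f ?a))"
          using nu' F(3,4) by (simp add: upper_def)
        then have "trace (drop ?a R) ?t \<noteq> topc (f ?a)" by auto
        from leafpath_cases[OF F(5) this] obtain ys x vs \<pi> where
          y: "comps (f ?a) = ys @ x # vs" "\<pi> \<in> paths (Node x)" "trace (drop ?a R) ?t = toppath vs @ \<pi>" by blast
        have "k \<le> Suc (length ys)"
        proof (rule ccontr)
          assume "\<not> k \<le> Suc (length ys)"
          then have "n - (k - 1) \<le> length vs" using level[OF y(1)] k(1) by simp
          then show False using np y(1,3) by (simp add: topc_def)
        qed
        then have "good (length ys) i" unfolding good_def using y by blast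
        then show ?thesis by blast
      qed
      \<comment> \<open>Otherwise the traced leaf and the top at the next index lie in a common stack of order \<open>d + 1\<close>,
        so tracing both back to the return shows that the top at index \<open>i\<close> lies in the component.\<close>
      have step: "d < d'" if i: "i < n" and g: "good d i" "good d' (Suc i)" for d d' i
      proof -
        let ?a = "idx i" and ?b = "idx (Suc i)"
        have i': "i \<le> n" "Suc i \<le> n" using i by simp_all
        note F = facts[OF i'(1)] and G = facts[OF i'(2)]
        have kd: "k \<le> Suc d" using g(1) unfolding good_def by blast
        from g(1) obtain ys x vs \<pi> where y: "comps (f ?a) = ys @ x # vs" "length ys = d" "\<pi> \<in> paths (Node x)"
          "trace (drop ?a R) ?t = toppath vs @ \<pi>" unfolding good_def by blast
        from g(2) obtain ys' x' vs' \<pi>' where y': "comps (f ?b) = ys' @ x' # vs'" "length ys' = d'" "\<pi>' \<in> paths (Node x')"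
          "trace (drop ?b R) ?t = toppath vs' @ \<pi>'" unfolding good_def by blast
        have ca: "comps (hd (drop ?a R)) = ys @ x # vs" using F(3) y(1) by simp
        have tr: "trace (drop ?a R) (topc (last (drop ?a R))) = toppath vs @ \<pi>" using y(4) F(4) by simp
        from return_exists[OF F(2) ca y(3) tr] obtain P1 c P2 where
          P: "drop ?a R = P1 @ c # P2" "ret (P1 @ [c]) (length ys)"
            "take (length vs) (trace (c # P2) ?t) = take (length vs) (topc c)" unfolding F(4) by blast
        define e where "e = ?a + length P1"
        have elen: "e < length R" using arg_cong[OF P(1), of length] F(1) by (simp add: e_def)
        have dre: "drop e R = c # P2"
        proof -
          have "drop e R = drop (length P1) (drop ?a R)" by (simp add: e_def add.commute)
          then show ?thesis unfolding P(1) by simp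
        qed
        have Re: "R ! e = c" using dre elen by (metis Cons_nth_drop_Suc list.inject)
        have lst: "last (c # P2) = last R" using F(4) P(1) by simp
        have f1: "frun (P1 @ c # P2)" using F(2) P(1) by simp
        have hdc: "comps (hd (P1 @ [c])) = ys @ x # vs" using ca P(1) by (cases P1) simp_all
        have tl: "?t \<in> leafpaths (last (c # P2))" unfolding lst by (rule top_leafpath)
        from return_position[OF f1 P(2) hdc tl P(3)] obtain zs vs2 \<pi>2 where
          Z: "comps c = zs @ vs2" "length zs = Suc (length ys)" "stk (symb c) zs = Node x"
          by (elim exE conjE)
        have "x = comps (f ?a) ! d" using nth_mid[OF y(2)] y(1) by simp
        then have "stk (symb c) zs = Node (comps (f ?a) ! d)" using Z(3) by simp
        moreover have "take (Suc d) (comps c) = zs" using Z(1,2) y(2) by simp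
        \<comment> \<open>The return exposes component d of \<open>f (idx i)\<close>, one of the
          stacks fixed at that index.\<close>
        ultimately have tops: "(symb (R ! e), take (Suc d) (comps (R ! e))) \<in> goal_tops ?a"
          unfolding goal_tops_def Re using level(2)[OF y(1)] Z(2) y(2) by auto
        have lv: "length vs = n - Suc d" using level(1)[OF y(1)] y(2) by simp
        have ue: "upper (Suc d) (drop e R)" unfolding upper_def dre lst using P(3) lv by simp
        have dn: "Suc d \<le> n" using level(2)[OF y(1)] y(2) by simp
        have eb: "e < ?b"
        proof (rule ccontr)
          assume "\<not> e < ?b"
          then have "?b \<le> e" by simp
          from finish[OF R(1,2) tk[OF mono[OF i'(2)]] R' idx(4) this elen ue kd dn tops m] no show False by blast
        qed
        show "d < d'"
        proof (rule ccontr)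
          assume "\<not> d < d'"
          then have dd: "d' \<le> d" by simp
          define Q where "Q = take (?b - e) P2"
          have cQ: "c # Q = take (Suc (?b - e)) (drop e R)" unfolding dre Q_def by simp
          have ble: "?b - e < length (drop e R)" using G(1) eb by simp
          have dd': "drop (?b - e) (drop e R) = drop ?b R" using eb by simp
          have "trace (drop e R) ?t = trace (c # Q) (trace (drop ?b R) ?t)"
            using trace_split[OF ble, of ?t] unfolding cQ dd' .
          then have t1: "trace (c # P2) ?t = trace (c # Q) (trace (drop ?b R) ?t)" unfolding dre .
          have sg: "P1 @ c # Q = seg ?a ?b"
          proof -
            have ab: "?a \<le> ?b" using idx(3)[of i] by simp
            have "P1 @ c # Q = take (Suc (?b - ?a)) (drop ?a R)"
              unfolding P(1) Q_def using eb by (simp add: e_def Suc_diff_le)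
            also have "\<dots> = drop ?a (take (Suc ?b) R)" using ab by (simp add: drop_take Suc_diff_le)
            also have "\<dots> = seg ?a ?b" unfolding tk[OF mono[OF i'(2)]]
              using ab by (simp add: seg_def drop_map drop_upt del: upt_Suc)
            finally show ?thesis .
          qed
          have ab: "?a \<le> ?b" using idx(3)[of i] by simp
          have fseg: "frun (P1 @ c # Q)" unfolding sg using frun_seg[OF ab] .
          then have fQ: "frun (c # Q)" using frun_append by blast
          have lQ: "last (c # Q) = f ?b"
          proof -
            have "last (P1 @ c # Q) = f ?b" unfolding sg using last_seg[OF ab] .
            then show ?thesis by simp
          qed
          have tb: "topc (f ?b) \<in> leafpaths (last (c # Q))" unfolding lQ by (rule top_leafpath)
          have pb: "trace (drop ?b R) ?t \<in> leafpaths (last (c # Q))" unfolding lQ by (rule G(5))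
          have "length vs \<le> length vs'" using level(1)[OF y'(1)] y'(2) lv dd by simp
          then have "take (length vs) (topc (f ?b)) = take (length vs) (trace (drop ?b R) ?t)"
            using y'(1,4) by (simp add: topc_def)
          from take_trace[OF fQ tb pb this]
          have "take (length vs) (trace (c # Q) (topc (f ?b))) = take (length vs) (topc c)"
            using t1 P(3) by simp
          from return_position[OF fseg P(2) hdc tb this] obtain \<pi>3 where
            p3: "\<pi>3 \<in> paths (Node x)" "trace (P1 @ c # Q) (topc (f ?b)) = toppath vs @ \<pi>3" by blast
          have ta: "topc (f ?a) = toppath (ys @ x # vs)" by (simp only: topc_def y(1))
          \<comment> \<open>Both indices are in \<open>I\<close>, so the top at the later one is
            traced to the top at the earlier one, which belongs to no component.\<close>
          have "upper 0 (seg ?a ?b)" using upper_I[OF idx(2) idx(2) ab] by (simp add: seg_def)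
          then have "take n (trace (seg ?a ?b) (topc (f ?b))) = take n (topc (f ?a))"
            using ab by (simp add: upper_def)
          then have "take n (toppath vs @ \<pi>3) = take n (toppath (ys @ x # vs))"
            unfolding p3(2)[unfolded sg] ta .
          then have "take (Suc (length vs)) (toppath vs @ \<pi>3) = take (Suc (length vs)) (toppath (ys @ x # vs))"
            by (rule take_eq_mono) (use lv dn in simp)
          then show False using not_top_prefix[OF p3(1)] by blast
        qed
      qed
      have "i \<le> d" if "i \<le> n" "good d i" for i d
        using that
      proof (induction i arbitrary: d)
        case (Suc i)
        then obtain d0 where "good d0 i" using ex[of i] by auto
        then have "i \<le> d0" "d0 < d" using Suc step[of i d0 d] by simp_all
        then show ?case by simp
      qed simp
      moreover obtain d where d: "good d n" using ex by blast
      ultimately have "n \<le> d" by simp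
      moreover have "d < n" using d level(2) unfolding good_def by blast
      ultimately show False by simp
    qed
  qed
qed

theorem pumping:
  "\<exists>pb. \<forall>k R R'. k \<le> n \<and> is_run n \<delta> R \<and> hd R = conf (f 0) \<and> is_run n \<delta> R' \<and> hd R' = last R \<and>
     (k = 0 \<or> \<not> kupper n \<delta> (k - 1) R) \<and> take pb (run_word \<delta> R) = replicate pb star \<and>
     kupper n \<delta> k R' \<longrightarrow>
     (\<forall>l. pumped k l R R')"
proof -
  obtain idx where idx: "idx 0 = 0" "\<And>i. idx i \<in> I" "\<And>i. idx i < idx (Suc i)"
    "\<And>i. infinite {j \<in> I. kind (idx i) j = kind (idx i) (idx (Suc i))}"
    using recurrent_chain by blast
  \<comment> \<open>If the ray reads boundedly many stars, \<open>pb\<close> exceeds the bound, and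
    a finite run beginning with \<open>pb\<close> stars would have to follow the ray forever.
    Otherwise the ray has read fewer than \<open>pb\<close> letters at \<open>idx n\<close>, which
    is the strict inequality that \<open>follow\<close> requires.\<close>
  define pb where "pb = (if \<exists>B. \<forall>m. length (word m) \<le> B then Suc (SOME B. \<forall>m. length (word m) \<le> B)
    else Suc (length (word (idx n))))"
  have main: "pumped k l R R'"
    if a: "k \<le> n" "is_run n \<delta> R" "hd R = conf (f 0)" "is_run n \<delta> R'" "hd R' = last R"
     "k = 0 \<or> \<not> kupper n \<delta> (k - 1) R" "take pb (run_word \<delta> R) = replicate pb star" "kupper n \<delta> k R'"
   for k R R' l
  proof -
    obtain P where P: "frun P" "R = map conf P" using is_run_frun[OF a(2)] by blast
    obtain P' where P': "frun P'" "R' = map conf P'" using is_run_frun[OF a(4)] by blast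
    have ne: "P \<noteq> []" "P' \<noteq> []" using frun_ne P(1) P'(1) by blast+
    have okh: "flat_ok (hd P)" "flat_ok (last P)" "flat_ok (hd P')"
      using frun_all_ok[OF P(1)] frun_all_ok[OF P'(1)] ne by simp_all
    have "conf (hd P) = conf (f 0)" using a(3) P(2) hd_map[OF ne(1), of conf] by simp
    then have h: "hd P = f 0" by (rule conf_inject[OF okh(1) ok])
    have "conf (hd P') = conf (last P)"
      using a(5) P(2) P'(2) hd_map[OF ne(2), of conf] last_map[OF ne(1), of conf] by simp
    then have h': "hd P' = last P" by (rule conf_inject[OF okh(3,2)])
    have w: "take pb (run_word \<delta> (map conf P)) = replicate pb star" using a(7) P(2) by simp
    have u: "upper k P'" "k = 0 \<or> \<not> upper (k - 1) P" using a(6,8) kupper_iff[OF P(1)] kupper_iff[OF P'(1)] P(2) P'(2) by simp_all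
    have nb: "\<not> (\<exists>B. \<forall>m. length (word m) \<le> B)"
    proof
      assume b: "\<exists>B. \<forall>m. length (word m) \<le> B"
      then have "\<forall>m. length (word m) \<le> (SOME B. \<forall>m. length (word m) \<le> B)" by (rule someI_ex)
      moreover have "pb = Suc (SOME B. \<forall>m. length (word m) \<le> B)" unfolding pb_def by (rule if_P[OF b])
      ultimately have "length (word m) < pb" for m by (simp add: less_Suc_eq_le)
      then have "length P < length P" using follow[OF P(1) h w] by blast
      then show False by simp
    qed
    have "pb = Suc (length (word (idx n)))" unfolding pb_def by (rule if_not_P[OF nb])
    then have "length (word (idx n)) < pb" by simp
    from follow[OF P(1) h w this] have f: "idx n < length P" "take (Suc (idx n)) P = seg 0 (idx n)" by blast+
    obtain m where m: "l \<le> length (word m)"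
    proof -
      have "\<not> (\<forall>m. length (word m) \<le> l)" using nb by blast
      then obtain m where "\<not> length (word m) \<le> l" by blast
      then show ?thesis using that[of m] by simp
    qed
    from pumping_flat[OF idx P(1) h f P'(1) h' u(1) a(1) u(2) m] show ?thesis unfolding P(2) P'(2) .
  qed
  show ?thesis by (intro exI[of _ pb] allI impI, elim conjE, rule main)
qed

end

theorem mainTheorem18:
  fixes n :: nat
    and \<delta> :: "'q::finite \<Rightarrow> 'g::finite \<Rightarrow> ('q, 'a::finite, 'g) transition"
    and star :: 'a
    and \<phi> :: "'a list \<Rightarrow> 'm::{monoid_mult, finite}"
  assumes "is_dpda n \<delta>"
    and "monoid_morphism \<phi>"
  shows "\<forall>c. milestone n \<delta> star c \<longrightarrow>
     (\<exists>pb::nat. \<forall>k R R'. k \<le> n \<and>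
        is_run n \<delta> R \<and> hd R = c \<and> is_run n \<delta> R' \<and> hd R' = last R \<and>
        (k = 0 \<or> \<not> kupper n \<delta> (k - 1) R) \<and>
        take pb (run_word \<delta> R) = replicate pb star \<and>
        kupper n \<delta> k R' \<longrightarrow>
        (\<forall>l::nat. \<exists>S S'. is_run n \<delta> S \<and> hd S = c \<and> is_run n \<delta> S' \<and> hd S' = last S \<and>
            \<phi> (run_word \<delta> S) = \<phi> (run_word \<delta> R) \<and>
            take l (run_word \<delta> S) = replicate l star \<and>
            parallel n \<delta> \<phi> k S' R'))"
proof (intro allI impI)
  fix c assume c: "milestone n \<delta> star c"
  interpret D: dpda_fin n \<delta> \<phi> by unfold_locales (rule assms)+
  obtain \<rho> I where r: "\<rho> 0 = c" "\<And>i. valid_config n (\<rho> i)" "\<And>i. step n \<delta> (\<rho> i) (\<rho> (Suc i))"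
    "\<And>i. set (step_letters \<delta> (\<rho> i) (\<rho> (Suc i))) \<subseteq> {star}"
    "infinite I" "0 \<in> I" "\<And>i j. i \<in> I \<Longrightarrow> j \<in> I \<Longrightarrow> i \<le> j \<Longrightarrow> kupper n \<delta> 0 (map \<rho> [i..<Suc j])"
    using c unfolding milestone_def by blast
  \<comment> \<open>Flat representatives are chosen separately at each index; injectivity of
    \<open>conf\<close> makes them consecutive.\<close>
  define f where "f i = (SOME d. D.flat_ok d \<and> \<rho> i = conf d)" for i
  have f: "D.flat_ok (f i)" "\<rho> i = conf (f i)" for i
    using someI_ex[OF D.valid_flat[OF r(2)[of i]]] unfolding f_def by blast+
  have st: "D.fstep (f i) (f (Suc i))" for i
  proof -
    obtain d where d: "D.fstep (f i) d" "conf (f (Suc i)) = conf d"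
      using r(3)[of i] D.step_conf[OF f(1)[of i]] unfolding f(2) by blast
    have "f (Suc i) = d" by (rule D.conf_inject[OF f(1) D.fstep_ok[OF d(1) f(1)] d(2)])
    then show ?thesis using d(1) by simp
  qed
  have frun: "D.frun (map f [i..<Suc j])" if "i \<le> j" for i j
    using that f(1) st unfolding D.frun_def
    by (simp add: successively_conv_nth hd_map del: upt_Suc)
  interpret ray n \<delta> \<phi> f star I
  proof unfold_locales
    show "D.upper 0 (map f [i..<Suc j])" if "i \<in> I" "j \<in> I" "i \<le> j" for i j
    proof -
      have "map \<rho> [i..<Suc j] = map conf (map f [i..<Suc j])"
        by (simp add: f(2) del: upt_Suc)
      then have "kupper n \<delta> 0 (map conf (map f [i..<Suc j]))" using r(7)[OF that] by (simp only:)
      then show ?thesis unfolding D.kupper_iff[OF frun[OF that(3)]] .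
    qed
    show "set (step_letters \<delta> (conf (f i)) (conf (f (Suc i)))) \<subseteq> {star}" for i
      using r(4)[of i] unfolding f(2) .
  qed (rule f(1) st r(5) r(6))+
  have "c = conf (f 0)" using r(1) f(2)[of 0] by simp
  then show "\<exists>pb::nat. \<forall>k R R'. k \<le> n \<and>
        is_run n \<delta> R \<and> hd R = c \<and> is_run n \<delta> R' \<and> hd R' = last R \<and>
        (k = 0 \<or> \<not> kupper n \<delta> (k - 1) R) \<and>
        take pb (run_word \<delta> R) = replicate pb star \<and>
        kupper n \<delta> k R' \<longrightarrow>
        (\<forall>l::nat. \<exists>S S'. is_run n \<delta> S \<and> hd S = c \<and> is_run n \<delta> S' \<and> hd S' = last S \<and>
            \<phi> (run_word \<delta> S) = \<phi> (run_word \<delta> R) \<and>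
            take l (run_word \<delta> S) = replicate l star \<and>
            parallel n \<delta> \<phi> k S' R')"
    using pumping by (simp add: pumped_def)
qed

end
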